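(* Let $\nu>0$ and $\lambda_0>0$, and set $\lambda(t)=\sqrt{\lambda_0^2+4\nu t}$ for $t\ge 0$. Let $\omega_0\in L^\infty(\mathbb{R}^2)$ satisfy $$\mathcal{E}(0)=\int_{\mathbb{R}^2}\Phi_{\lambda_0}(x)^{-1}\,\omega_0(x)^2\,dx<\infty,$$ and let $\omega(x,t)$ be the solution of the two-dimensional vorticity equation with initial datum $\omega_0$. Then for every $t>0$ the weighted enstrophy $$\mathcal{E}(t)=\int_{\mathbb{R}^2}\Phi_{\lambda(t)}(x)^{-1}\,\omega(x,t)^2\,dx$$ is finite.
   Context: For $\lambda>0$, $\Phi_\lambda(x)=\frac{1}{\pi\lambda^2}e^{-|x|^2/\lambda^2}$ for $x\in\mathbb{R}^2$. The two-dimensional vorticity equation is $\partial_t\omega=\nu\Delta\omega-\mathbf{u}\cdot\nabla\omega$ for $x\in\mathbb{R}^2$, $t>0$, $\omega(x,0)=\omega_0(x)$, where the velocity is given by the Biot–Savart law $\mathbf{u}(x,t)=\frac{1}{2\pi}\int_{\mathbb{R}^2}\frac{(x-y)^\perp}{|x-y|^2}\omega(y,t)\,dy$ with $z^\perp=(-z_2,z_1)$. (Finiteness of $\mathcal{E}(0)$ implies $\omega_0\in L^1(\mathbb{R}^2)$, so $\omega_0\in L^1\cap L^\infty$ and the solution is global.) *)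

theory Defs
  imports "HOL-Analysis.Analysis"
begin

definition Phi :: "real \<Rightarrow> real \<times> real \<Rightarrow> real" where
  "Phi lam x = exp (- (norm x)\<^sup>2 / lam\<^sup>2) / (pi * lam\<^sup>2)"

text \<open>Biot--Savart law: u(x) = 1/(2 pi) int (x-y)^perp / |x-y|^2 w(y) dy, with z^perp = (-z2, z1).\<close>

definition BS_velocity :: "(real \<times> real \<Rightarrow> real) \<Rightarrow> real \<times> real \<Rightarrow> real \<times> real" where
  "BS_velocity w x =
     ((1 / (2 * pi)) * (\<integral>y. (- (snd x - snd y)) / (norm (x - y))\<^sup>2 * w y \<partial>lborel),
      (1 / (2 * pi)) * (\<integral>y. (fst x - fst y) / (norm (x - y))\<^sup>2 * w y \<partial>lborel))"

definition vorticity_solution ::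
  "real \<Rightarrow> (real \<times> real \<Rightarrow> real) \<Rightarrow> (real \<times> real \<Rightarrow> real \<Rightarrow> real) \<Rightarrow> bool" where
  "vorticity_solution nu w0 w \<longleftrightarrow>
     (\<forall>t>0. integrable lborel (\<lambda>x. w x t)) \<and>
     (\<forall>T>0. \<exists>C. \<forall>t\<in>{0<..T}. \<forall>x. \<bar>w x t\<bar> \<le> C) \<and>
     ((\<lambda>t. \<integral>\<^sup>+x. ennreal \<bar>w x t - w0 x\<bar> \<partial>lborel) \<longlongrightarrow> 0) (at_right 0) \<and>
     (\<exists>w1 w2 w11 w22 wt.
        continuous_on (UNIV \<times> {0<..}) (\<lambda>p. w (fst p) (snd p)) \<and>
        continuous_on (UNIV \<times> {0<..}) (\<lambda>p. w1 (fst p) (snd p)) \<and>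
        continuous_on (UNIV \<times> {0<..}) (\<lambda>p. w2 (fst p) (snd p)) \<and>
        continuous_on (UNIV \<times> {0<..}) (\<lambda>p. w11 (fst p) (snd p)) \<and>
        continuous_on (UNIV \<times> {0<..}) (\<lambda>p. w22 (fst p) (snd p)) \<and>
        continuous_on (UNIV \<times> {0<..}) (\<lambda>p. wt (fst p) (snd p)) \<and>
        (\<forall>x1 x2 t. t > 0 \<longrightarrow>
           ((\<lambda>s. w (s, x2) t) has_real_derivative w1 (x1, x2) t) (at x1) \<and>
           ((\<lambda>s. w (x1, s) t) has_real_derivative w2 (x1, x2) t) (at x2) \<and>
           ((\<lambda>s. w1 (s, x2) t) has_real_derivative w11 (x1, x2) t) (at x1) \<and>
           ((\<lambda>s. w2 (x1, s) t) has_real_derivative w22 (x1, x2) t) (at x2) \<and>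
           ((\<lambda>s. w (x1, x2) s) has_real_derivative wt (x1, x2) t) (at t) \<and>
           wt (x1, x2) t =
             nu * (w11 (x1, x2) t + w22 (x1, x2) t)
             - (fst (BS_velocity (\<lambda>y. w y t) (x1, x2)) * w1 (x1, x2) t
                + snd (BS_velocity (\<lambda>y. w y t) (x1, x2)) * w2 (x1, x2) t)))"

end

theory Submission
  imports Defs
begin

text \<open>
  In the weighted energy inequality the transport term is absorbed by Young's inequality, using the full
  dissipation: the weight \<open>exp (|x|\<^sup>2 / L(t))\<close>, \<open>L(t) = \<lambda>\<^sub>0\<^sup>2 + 4 \<nu> t\<close>, satisfies
  \<open>\<partial>\<^sub>t G + \<nu> \<Delta> G = O(G)\<close>, so \<open>E' \<le> (C + |u|\<^sub>\<infinity>\<^sup>2 / \<nu>) E\<close>. Since finiteness of \<open>E(t)\<close> is not known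
  beforehand, \<open>|x|\<^sup>2 / L\<close> is replaced by \<open>|x|\<^sup>2 / (L + \<epsilon> |x|\<^sup>2) - 2 ln (1 + \<epsilon> |x|\<^sup>2)\<close>, which keeps the
  inequality uniformly in \<open>\<epsilon>\<close>, and Fatou's lemma removes \<open>\<epsilon>\<close>.

  It remains to bound \<open>u\<close> on \<open>(0, T]\<close>. One has \<open>|u| \<le> C (|w|\<^sub>\<infinity> + |w|\<^sub>1)\<close>, but the solution concept does
  not bound the \<open>L\<^sup>1\<close> norm \<open>M(t)\<close> locally uniformly in \<open>t > 0\<close>. A Serfati-type estimate, based on
  \<open>w u = div (u \<otimes> u) + gradient\<close> up to rotation, shows that a bound for \<open>u\<close> at one time propagates
  forwards and backwards over a time step depending only on \<open>|w|\<^sub>\<infinity>\<close>, as soon as \<open>u\<close> is bounded at all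
  on that interval. As \<open>M\<close> is finite and lower semicontinuous, a Baire argument bounds \<open>M\<close> on a
  portion of the closed set of times near which \<open>u\<close> is unbounded; propagation across the gaps of
  this set then bounds \<open>u\<close> near a point of it, so the set is empty.
\<close>

section \<open>Integration by parts in the plane\<close>

text \<open>The rate 4\<nu> in L(t) is the one at which the |x|^2 terms of the time derivative of G
  and of \<nu> \<Delta> G cancel, leaving 4\<nu>/L times G. The dissipation thus stays whole and
  Young's inequality can spend it on transport; the price is |u|_\<infinity>, hence the work on the
  velocity. In the modified exponent the fraction makes the weight bounded, so that L^1 convergence
  to the datum suffices at time 0. The logarithm makes it integrable, so that a cutoff at radius R
  costs O(1/R^2) against |w|_\<infinity>^2, in the absence of any decay estimate for w or its
  gradient; R is chosen depending on \<epsilon>. The Biot--Savart kernel is too singular to be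
  differentiated classically. Identities for u are derived with |z|^2 + d^2 in place of |z|^2 in the
  denominator, where divergence and curl are explicit, and then d tends to 0. The velocity error is
  O(d |w|_\<infinity>), free of the L^1 norm. The same splitting drives the Serfati estimate:
  |w|_\<infinity> alone controls the singular part, and (\<nu> |w|_\<infinity> + |u|_\<infinity>^2)
  / d the time derivative of the smooth part.\<close>

definition pd1 :: "(real \<times> real \<Rightarrow> real) \<Rightarrow> (real \<times> real \<Rightarrow> real) \<Rightarrow> bool" where
  "pd1 f f1 \<longleftrightarrow> continuous_on UNIV f \<and> continuous_on UNIV f1 \<and>
     (\<forall>x1 x2. ((\<lambda>s. f (s, x2)) has_real_derivative f1 (x1, x2)) (at x1))"

text \<open>Joint continuity of the function and of its derivative belongs to both predicates: with
  compact support both are then integrable, and Fubini and the fundamental theorem apply without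
  further regularity checks.\<close>

definition pd2 :: "(real \<times> real \<Rightarrow> real) \<Rightarrow> (real \<times> real \<Rightarrow> real) \<Rightarrow> bool" where
  "pd2 f f2 \<longleftrightarrow> continuous_on UNIV f \<and> continuous_on UNIV f2 \<and>
     (\<forall>x1 x2. ((\<lambda>s. f (x1, s)) has_real_derivative f2 (x1, x2)) (at x2))"

lemma pd1_mult: "pd1 f f1 \<Longrightarrow> pd1 g g1 \<Longrightarrow> pd1 (\<lambda>x. f x * g x) (\<lambda>x. f1 x * g x + f x * g1 x)"
  unfolding pd1_def by (auto intro!: continuous_intros derivative_eq_intros)

lemma pd2_mult: "pd2 f f1 \<Longrightarrow> pd2 g g1 \<Longrightarrow> pd2 (\<lambda>x. f x * g x) (\<lambda>x. f1 x * g x + f x * g1 x)"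
  unfolding pd2_def by (auto intro!: continuous_intros derivative_eq_intros)

lemma integrable_compact_support:
  fixes f :: "real \<times> real \<Rightarrow> real"
  assumes "continuous_on UNIV f" "\<And>x. norm x > R \<Longrightarrow> f x = 0"
  shows "integrable lborel f"
proof -
  have "integrable lborel (\<lambda>x. indicator (cball 0 R) x *\<^sub>R f x)"
    by (rule borel_integrable_compact) (auto intro: continuous_on_subset[OF assms(1)])
  also have "(\<lambda>x. indicator (cball 0 R) x *\<^sub>R f x) = f"
    using assms(2) by (auto simp: indicator_def fun_eq_iff not_le)
  finally show ?thesis .
qed

lemma line_integral_zero:
  fixes f f' :: "real \<Rightarrow> real"
  assumes d: "\<And>x. (f has_real_derivative f' x) (at x)" and c: "continuous_on UNIV f'"
    and z: "\<And>x. \<bar>x\<bar> > R \<Longrightarrow> f x = 0" and z': "\<And>x. \<bar>x\<bar> > R \<Longrightarrow> f' x = 0"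
  shows "(\<integral>x. f' x \<partial>lborel) = 0"
proof -
  \<comment> \<open>Radius |R| + 1: R may be negative, and the endpoints must lie strictly outside
    the support.\<close>
  have "(\<integral>x. f' x * indicator {-\<bar>R\<bar>-1..\<bar>R\<bar>+1} x \<partial>lborel) = f (\<bar>R\<bar>+1) - f (-\<bar>R\<bar>-1)"
    using c by (intro integral_FTC_Icc_real d) (auto simp: continuous_on_eq_continuous_at)
  moreover have "(\<lambda>x. f' x * indicator {-\<bar>R\<bar>-1..\<bar>R\<bar>+1} x) = f'"
    using z' by (force simp: indicator_def fun_eq_iff)
  ultimately show ?thesis by (simp add: z)
qed

lemma abs_le_norm_pair: "\<bar>a\<bar> \<le> norm (a, b)" "\<bar>b\<bar> \<le> norm (a, b)" for a b :: real
  by (simp_all add: norm_prod_def)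

text \<open>The function vanishes on an open set, hence so does its derivative. Supports are passed
  on to derivatives in this way throughout.\<close>

lemma pd1_support:
  assumes "pd1 f f1" "\<And>x. norm x > R \<Longrightarrow> f x = 0" "norm x > R"
  shows "f1 x = 0"
proof (cases x)
  case (Pair a b)
  have "((\<lambda>s. f (s, b)) has_real_derivative f1 (a, b)) (at a)"
    using assms(1) by (simp add: pd1_def)
  moreover have "((\<lambda>s. f (s, b)) has_real_derivative 0) (at a)"
  proof (rule has_field_derivative_transform_within_open[where f = "\<lambda>_. 0" and S = "{s. norm (s, b) > R}"])
    show "open {s. norm (s, b) > R}"
      by (intro open_Collect_less continuous_intros)
  qed (use assms(2,3) Pair in auto)
  ultimately show ?thesis using Pair DERIV_unique by blast
qed

lemma pd2_support:
  assumes "pd2 f f1" "\<And>x. norm x > R \<Longrightarrow> f x = 0" "norm x > R"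
  shows "f1 x = 0"
proof (cases x)
  case (Pair a b)
  have "((\<lambda>s. f (a, s)) has_real_derivative f1 (a, b)) (at b)"
    using assms(1) by (simp add: pd2_def)
  moreover have "((\<lambda>s. f (a, s)) has_real_derivative 0) (at b)"
  proof (rule has_field_derivative_transform_within_open[where f = "\<lambda>_. 0" and S = "{s. norm (a, s) > R}"])
    show "open {s. norm (a, s) > R}"
      by (intro open_Collect_less continuous_intros)
  qed (use assms(2,3) Pair in auto)
  ultimately show ?thesis using Pair DERIV_unique by blast
qed

text \<open>Fubini with the first coordinate innermost: on each horizontal line the fundamental
  theorem gives 0.\<close>

lemma integral_pd1_zero:
  assumes p: "pd1 f f1" and z: "\<And>x. norm x > R \<Longrightarrow> f x = 0"
  shows "(\<integral>x. f1 x \<partial>lborel) = 0"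
proof -
  have z': "f1 x = 0" if "norm x > R" for x using pd1_support[OF p z that] by simp
  have int: "integrable lborel f1"
    using p z' by (intro integrable_compact_support[of _ R]) (auto simp: pd1_def)
  have c: "continuous_on UNIV f1" using p by (simp add: pd1_def)
  have "(\<integral>x. f1 x \<partial>lborel) = (\<integral>x2. (\<integral>x1. f1 (x1, x2) \<partial>lborel) \<partial>lborel)"
    using lborel_pair.integral_snd[of "\<lambda>x y. f1 (x, y)"] int by (simp add: lborel_prod)
  also have "\<dots> = (\<integral>x2. 0 \<partial>(lborel::real measure))"
  proof (rule Bochner_Integration.integral_cong[OF refl])
    fix x2 :: real
    show "(\<integral>x1. f1 (x1, x2) \<partial>lborel) = 0"
    proof (rule line_integral_zero[of "\<lambda>s. f (s, x2)" _ R])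
      show "continuous_on UNIV (\<lambda>x. f1 (x, x2))"
        by (rule continuous_on_compose2[OF c]) (auto intro!: continuous_intros)
      show "R < \<bar>x\<bar> \<Longrightarrow> f (x, x2) = 0" for x using z abs_le_norm_pair(1)[of x x2] by force
      show "R < \<bar>x\<bar> \<Longrightarrow> f1 (x, x2) = 0" for x using z' abs_le_norm_pair(1)[of x x2] by force
    qed (use p in \<open>auto simp: pd1_def\<close>)
  qed
  finally show ?thesis by simp
qed

lemma integral_pd2_zero:
  assumes p: "pd2 f f1" and z: "\<And>x. norm x > R \<Longrightarrow> f x = 0"
  shows "(\<integral>x. f1 x \<partial>lborel) = 0"
proof -
  have z': "f1 x = 0" if "norm x > R" for x using pd2_support[OF p z that] by simp
  have int: "integrable lborel f1"
    using p z' by (intro integrable_compact_support[of _ R]) (auto simp: pd2_def)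
  have c: "continuous_on UNIV f1" using p by (simp add: pd2_def)
  have "(\<integral>x. f1 x \<partial>lborel) = (\<integral>x1. (\<integral>x2. f1 (x1, x2) \<partial>lborel) \<partial>lborel)"
    using lborel_pair.integral_fst'[of "\<lambda>x. f1 x"] int by (simp add: lborel_prod)
  also have "\<dots> = (\<integral>x1. 0 \<partial>(lborel::real measure))"
  proof (rule Bochner_Integration.integral_cong[OF refl])
    fix x1 :: real
    show "(\<integral>x2. f1 (x1, x2) \<partial>lborel) = 0"
    proof (rule line_integral_zero[of "\<lambda>s. f (x1, s)" _ R])
      show "continuous_on UNIV (\<lambda>x. f1 (x1, x))"
        by (rule continuous_on_compose2[OF c]) (auto intro!: continuous_intros)
      show "R < \<bar>x\<bar> \<Longrightarrow> f (x1, x) = 0" for x using z abs_le_norm_pair(2)[of x x1] by force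
      show "R < \<bar>x\<bar> \<Longrightarrow> f1 (x1, x) = 0" for x using z' abs_le_norm_pair(2)[of x x1] by force
    qed (use p in \<open>auto simp: pd2_def\<close>)
  qed
  finally show ?thesis by simp
qed

text \<open>Compact support is asked of the second factor only, so the first may be a velocity or a
  vorticity without decay.\<close>

lemma ibp1:
  assumes f: "pd1 f f1" and g: "pd1 g g1" and z: "\<And>x. norm x > R \<Longrightarrow> g x = 0"
  shows "(\<integral>x. f1 x * g x \<partial>lborel) = - (\<integral>x. f x * g1 x \<partial>lborel)"
proof -
  have z': "g1 x = 0" if "norm x > R" for x using pd1_support[OF g z that] by simp
  have "(\<integral>x. f1 x * g x + f x * g1 x \<partial>lborel) = 0"
    by (rule integral_pd1_zero[OF pd1_mult[OF f g], of R]) (use z in auto)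
  moreover have "integrable lborel (\<lambda>x. f1 x * g x)" "integrable lborel (\<lambda>x. f x * g1 x)"
    by (rule integrable_compact_support[of _ R];
        use f g z z' in \<open>auto simp: pd1_def intro!: continuous_intros\<close>)+
  ultimately show ?thesis by simp
qed

lemma ibp2:
  assumes f: "pd2 f f1" and g: "pd2 g g1" and z: "\<And>x. norm x > R \<Longrightarrow> g x = 0"
  shows "(\<integral>x. f1 x * g x \<partial>lborel) = - (\<integral>x. f x * g1 x \<partial>lborel)"
proof -
  have z': "g1 x = 0" if "norm x > R" for x using pd2_support[OF g z that] by simp
  have "(\<integral>x. f1 x * g x + f x * g1 x \<partial>lborel) = 0"
    by (rule integral_pd2_zero[OF pd2_mult[OF f g], of R]) (use z in auto)
  moreover have "integrable lborel (\<lambda>x. f1 x * g x)" "integrable lborel (\<lambda>x. f x * g1 x)"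
    by (rule integrable_compact_support[of _ R];
        use f g z z' in \<open>auto simp: pd2_def intro!: continuous_intros\<close>)+
  ultimately show ?thesis by simp
qed

section \<open>Differentiation under the integral sign\<close>

lemma has_real_derivative_integral:
  fixes f f' :: "real \<Rightarrow> 'a \<Rightarrow> real"
  assumes x0: "a < x0" "x0 < b"
    and int: "\<And>s. a < s \<Longrightarrow> s < b \<Longrightarrow> integrable M (f s)"
    and der: "\<And>s y. a < s \<Longrightarrow> s < b \<Longrightarrow> ((\<lambda>s. f s y) has_real_derivative f' s y) (at s)"
    and bnd: "\<And>s y. a < s \<Longrightarrow> s < b \<Longrightarrow> \<bar>f' s y\<bar> \<le> g y"
    and g: "integrable M g" and meas: "f' x0 \<in> borel_measurable M"
  shows "((\<lambda>s. \<integral>y. f s y \<partial>M) has_real_derivative (\<integral>y. f' x0 y \<partial>M)) (at x0)"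
  unfolding has_field_derivative_iff
proof (rule tendsto_at_iff_sequentially[THEN iffD2], safe)
  fix X :: "nat \<Rightarrow> real"
  assume X: "\<forall>i. X i \<in> UNIV - {x0}" and lim: "X \<longlonglongrightarrow> x0"
  have ev: "\<forall>\<^sub>F n in sequentially. a < X n \<and> X n < b"
    using order_tendstoD[OF lim] x0 by (auto intro: eventually_conj)
  then obtain N where N: "\<And>n. n \<ge> N \<Longrightarrow> a < X n \<and> X n < b"
    by (auto simp: eventually_sequentially)
  \<comment> \<open>The sequence enters (a, b), where the hypotheses hold, only from index N on; the
    shift is undone by \<open>LIMSEQ_offset\<close>.\<close>
  have "(\<lambda>n. \<integral>y. (f (X (n + N)) y - f x0 y) / (X (n + N) - x0) \<partial>M) \<longlonglongrightarrow> (\<integral>y. f' x0 y \<partial>M)"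
  proof (rule integral_dominated_convergence[where w = g])
    show "(\<lambda>y. (f (X (n + N)) y - f x0 y) / (X (n + N) - x0)) \<in> borel_measurable M" for n
      using int[of "X (n+N)"] int[of x0] N[of "n+N"] x0 by auto
    show "AE y in M. (\<lambda>n. (f (X (n + N)) y - f x0 y) / (X (n + N) - x0)) \<longlonglongrightarrow> f' x0 y"
    proof (rule AE_I2)
      fix y
      have "((\<lambda>s. (f s y - f x0 y) / (s - x0)) \<longlongrightarrow> f' x0 y) (at x0)"
        using der[of x0 y] x0 by (simp add: has_field_derivative_iff)
      then have "(\<lambda>n. (f (X n) y - f x0 y) / (X n - x0)) \<longlonglongrightarrow> f' x0 y"
        using X lim unfolding tendsto_at_iff_sequentially by (auto simp: o_def)
      then show "(\<lambda>n. (f (X (n + N)) y - f x0 y) / (X (n + N) - x0)) \<longlonglongrightarrow> f' x0 y"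
        by (rule LIMSEQ_ignore_initial_segment)
    qed
    show "AE y in M. norm ((f (X (n + N)) y - f x0 y) / (X (n + N) - x0)) \<le> g y" for n
    proof (rule AE_I2)
      fix y
      have Xn: "a < X (n+N)" "X (n+N) < b" "X (n+N) \<noteq> x0" using N[of "n+N"] X by auto
      \<comment> \<open>Mean value inequality: the bound on the derivative dominates every
        difference quotient.\<close>
      have "norm (f (X (n+N)) y - f x0 y) \<le> g y * norm (X (n+N) - x0)"
      proof (rule field_differentiable_bound[where S = "{a<..<b}" and f = "\<lambda>s. f s y" and f' = "\<lambda>s. f' s y"])
        show "((\<lambda>s. f s y) has_real_derivative f' z y) (at z within {a<..<b})" if "z \<in> {a<..<b}" for z
          using der[of z y] that by (auto intro: has_field_derivative_at_within)
        show "norm (f' z y) \<le> g y" if "z \<in> {a<..<b}" for z using bnd[of z y] that by auto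
      qed (use Xn x0 in auto)
      then show "norm ((f (X (n + N)) y - f x0 y) / (X (n + N) - x0)) \<le> g y"
        using Xn by (simp add: divide_simps abs_divide)
    qed
  qed (use g meas in auto)
  then have "(\<lambda>n. \<integral>y. (f (X n) y - f x0 y) / (X n - x0) \<partial>M) \<longlonglongrightarrow> (\<integral>y. f' x0 y \<partial>M)"
    by (rule LIMSEQ_offset)
  moreover have "\<forall>\<^sub>F n in sequentially. (\<integral>y. (f (X n) y - f x0 y) / (X n - x0) \<partial>M)
      = ((\<integral>y. f (X n) y \<partial>M) - (\<integral>y. f x0 y \<partial>M)) / (X n - x0)"
    using ev by eventually_elim (use int x0 in auto)
  ultimately show "((\<lambda>y. ((\<integral>ya. f y ya \<partial>M) - (\<integral>y. f x0 y \<partial>M)) / (y - x0)) \<circ> X)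
      \<longlonglongrightarrow> (\<integral>y. f' x0 y \<partial>M)"
    by (simp add: o_def Lim_transform_eventually)
qed

section \<open>The Biot--Savart kernel\<close>

lemma norm_pair_sq: "(norm z)\<^sup>2 = (fst z)\<^sup>2 + (snd z)\<^sup>2" for z :: "real \<times> real"
  by (simp add: norm_prod_def)

text \<open>A dilation by c scales area by c^2, whatever the sign of c. The case c = -1 gives
  reflections, c = d and c = -d the scaling of the kernels.\<close>

lemma plane_affine:
  fixes f :: "real \<times> real \<Rightarrow> real"
  assumes [measurable]: "f \<in> borel_measurable borel" and c: "c \<noteq> 0"
  shows "integrable lborel f \<longleftrightarrow> integrable lborel (\<lambda>x. f (t + c *\<^sub>R x))"
    and "(\<integral>x. f x \<partial>lborel) = c\<^sup>2 * (\<integral>x. f (t + c *\<^sub>R x) \<partial>lborel)"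
proof -
  have eq: "lborel = density (distr lborel borel (\<lambda>x. t + c *\<^sub>R x)) (\<lambda>_. ennreal (c\<^sup>2))"
    using lborel_affine[OF c, of t] by (simp add: ennreal_power power2_eq_square flip: abs_mult)
  show "integrable lborel f \<longleftrightarrow> integrable lborel (\<lambda>x. f (t + c *\<^sub>R x))"
    using c by (subst eq) (simp add: integrable_density integrable_distr_eq)
  show "(\<integral>x. f x \<partial>lborel) = c\<^sup>2 * (\<integral>x. f (t + c *\<^sub>R x) \<partial>lborel)"
    by (subst eq) (simp add: integral_density integral_distr)
qed

lemma plane_reflect:
  fixes f :: "real \<times> real \<Rightarrow> real"
  assumes "f \<in> borel_measurable borel"
  shows "integrable lborel (\<lambda>y. f (x - y)) \<longleftrightarrow> integrable lborel f"
    and "(\<integral>y. f (x - y) \<partial>lborel) = (\<integral>x. f x \<partial>lborel)"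
  using plane_affine[OF assms, of "-1" x] by simp_all

section \<open>An integrable majorant for the kernel singularity\<close>

lemma integrable_profile:
  "integrable lborel (\<lambda>x::real. 1 / (sqrt \<bar>x\<bar> * sqrt (1 + x\<^sup>2)))"
proof -
  \<comment> \<open>The exponent -1/2 is integrable at 0 and -3/2 at infinity; negative arguments
    are covered by the reflection of g.\<close>
  define g where "g x = indicator {0..1} x * x powr (-1/2) + indicator {1..} x * x powr (-3/2)" for x :: real
  have "(\<lambda>x::real. x powr (-1/2)) absolutely_integrable_on {0..1}"
    using integrable_on_powr_from_0[of "-1/2" 1]
    by (subst absolutely_integrable_on_iff_nonneg) auto
  then have 1: "integrable lborel (\<lambda>x::real. indicator {0..1} x * x powr (-1/2))"
    unfolding set_integrable_def by (subst (asm) integrable_completion) auto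
  have "(\<lambda>x::real. x powr (-3/2)) absolutely_integrable_on {1..}"
    using has_integral_powr_to_inf[of "-3/2" 1]
    by (subst absolutely_integrable_on_iff_nonneg) (auto simp: integrable_on_def)
  then have 2: "integrable lborel (\<lambda>x::real. indicator {1..} x * x powr (-3/2))"
    unfolding set_integrable_def by (subst (asm) integrable_completion) auto
  have g: "integrable lborel g" unfolding g_def using 1 2 by auto
  have g': "integrable lborel (\<lambda>x. g (0 + -1 * x))"
    by (rule lborel_integrable_real_affine[OF g]) simp
  have bound: "1 / (sqrt x * sqrt (1 + x\<^sup>2)) \<le> g x" if "x > 0" for x :: real
  proof -
    have p1: "x powr (-1/2) = 1 / sqrt x"
      using that by (simp add: powr_minus_divide powr_half_sqrt)
    have "x powr (-3/2) = x powr (-1) * x powr (-1/2)"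
      using that by (subst powr_add[symmetric]) simp
    then have p2: "x powr (-3/2) = 1 / (sqrt x * x)"
    proof -
      have "x powr (-1) = 1 / x" using that by (simp add: powr_minus_divide)
      with \<open>x powr (-3/2) = x powr (-1) * x powr (-1/2)\<close> show ?thesis
        by (simp only: p1) (simp add: mult.commute)
    qed
    have nn: "0 \<le> g x" "x \<le> 1 \<Longrightarrow> 1 / sqrt x \<le> g x" "1 \<le> x \<Longrightarrow> 1 / (sqrt x * x) \<le> g x"
      using that unfolding g_def p1 p2 by (auto simp: indicator_def)
    show ?thesis
    proof (cases "x \<le> 1")
      case True
      have "1 / (sqrt x * sqrt (1 + x\<^sup>2)) \<le> 1 / sqrt x"
      proof -
        have "\<not> 1 + x\<^sup>2 < 0" using zero_le_power2[of x] by linarith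
        then show ?thesis using that by (simp add: divide_simps)
      qed
      then show ?thesis using nn True by linarith
    next
      case False
      have "x \<le> sqrt (1 + x\<^sup>2)" by (rule real_le_rsqrt) simp
      then have "1 / (sqrt x * sqrt (1 + x\<^sup>2)) \<le> 1 / (sqrt x * x)"
      proof (intro divide_left_mono mult_left_mono mult_pos_pos)
        show "0 < sqrt (1 + x\<^sup>2)" by (simp add: add_pos_nonneg)
      qed (use that in auto)
      then show ?thesis using nn False by linarith
    qed
  qed
  have nng: "0 \<le> g x" for x by (auto simp: g_def)
  show ?thesis
  proof (rule Bochner_Integration.integrable_bound[OF Bochner_Integration.integrable_add[OF g g']])
    show "AE x in lborel. norm (1 / (sqrt \<bar>x\<bar> * sqrt (1 + x\<^sup>2))) \<le> norm (g x + g (0 + -1 * x))"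
    proof (rule AE_I2)
      fix x :: real
      consider "x > 0" | "x = 0" | "x < 0" by linarith
      then show "norm (1 / (sqrt \<bar>x\<bar> * sqrt (1 + x\<^sup>2))) \<le> norm (g x + g (0 + -1 * x))"
      proof cases
        case 1
        show ?thesis using bound[OF 1] nng[of x] nng[of "-x"] 1 by simp
      next
        case 3
        show ?thesis using bound[of "-x"] nng[of x] nng[of "-x"] 3 by simp
      qed simp
    qed
  qed simp
qed

text \<open>One majorant for two purposes: d^2 times it bounds the error of regularising the kernel
  (\<open>kern_diff\<close>), and a multiple of it bounds the second derivatives of the truncated
  kernel (\<open>truncated_kernel\<close>). Its value at 0 is 0 by the convention for
  division.\<close>

definition sing :: "real \<Rightarrow> real \<times> real \<Rightarrow> real" where
  "sing d z = 1 / (norm z * ((norm z)\<^sup>2 + d\<^sup>2))"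

definition sing_mass :: real where "sing_mass = (\<integral>z. sing 1 z \<partial>lborel)"

lemma sing_nonneg [simp]: "0 \<le> sing d z" by (simp add: sing_def)

lemma sing_measurable [measurable]: "sing d \<in> borel_measurable borel"
  unfolding sing_def by measurable

text \<open>For z = (a, b), |z|^2 >= |a| |b| and (1 + |z|^2)^2 >= (1 + a^2) (1 + b^2), so a product
  of one-dimensional profiles dominates; Fubini takes the place of polar coordinates.\<close>

lemma integrable_sing1: "integrable lborel (sing 1)"
proof -
  let ?h = "\<lambda>x::real. 1 / (sqrt \<bar>x\<bar> * sqrt (1 + x\<^sup>2))"
  have "integrable (lborel \<Otimes>\<^sub>M lborel) (\<lambda>(x, y). ?h x * ?h y)"
  proof (rule lborel_pair.Fubini_integrable)
    show "integrable lborel (\<lambda>x. \<integral>y. norm (case (x, y) of (x, y) \<Rightarrow> ?h x * ?h y) \<partial>lborel)"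
    proof -
      have "(\<lambda>x. \<integral>y. norm (case (x, y) of (x, y) \<Rightarrow> ?h x * ?h y) \<partial>lborel) = (\<lambda>x. ?h x * (\<integral>y. ?h y \<partial>lborel))"
        by (subst Bochner_Integration.integral_mult_right_zero[symmetric]) (simp add: abs_mult)
      then show ?thesis using integrable_profile by (simp only: integrable_mult_left)
    qed
    show "AE x in lborel. integrable lborel (\<lambda>y. case (x, y) of (x, y) \<Rightarrow> ?h x * ?h y)"
      unfolding prod.case using integrable_profile
      by (intro AE_I2 Bochner_Integration.integrable_mult_right)
  qed measurable
  then have int: "integrable lborel (\<lambda>z. ?h (fst z) * ?h (snd z))"
    by (simp add: lborel_prod case_prod_beta')
  show ?thesis
  proof (rule Bochner_Integration.integrable_bound[OF int])
    show "AE z in lborel. norm (sing 1 z) \<le> norm (?h (fst z) * ?h (snd z))"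
    proof -
      \<comment> \<open>On the axes division by zero gives the product majorant the value 0, so they
        are discarded as null sets.\<close>
      have "AE z in lborel. z \<notin> {0::real} \<times> UNIV \<union> UNIV \<times> {0::real}"
      proof (rule AE_not_in)
        have "{0::real} \<times> UNIV \<in> null_sets (lborel \<Otimes>\<^sub>M lborel)"
          by (auto simp: null_sets_def lborel.emeasure_pair_measure_Times)
        moreover have "UNIV \<times> {0::real} \<in> null_sets (lborel \<Otimes>\<^sub>M lborel)"
          by (auto simp: null_sets_def lborel.emeasure_pair_measure_Times)
        ultimately show "{0::real} \<times> UNIV \<union> UNIV \<times> {0::real} \<in> null_sets lborel"
          by (auto simp: lborel_prod)
      qed
      then show ?thesis
      proof eventually_elim
        case (elim z)
        obtain a b where z: "z = (a, b)" by fastforce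
        have ab: "a \<noteq> 0" "b \<noteq> 0" using elim z by auto
        have n: "norm z = sqrt (a\<^sup>2 + b\<^sup>2)" by (simp add: z norm_prod_def)
        have "\<bar>a\<bar> * \<bar>b\<bar> \<le> a\<^sup>2 + b\<^sup>2"
        proof -
          have "0 \<le> \<bar>a\<bar> * \<bar>b\<bar>" by simp
          then show ?thesis using sum_squares_bound[of "\<bar>a\<bar>" "\<bar>b\<bar>"] by (simp only: power2_abs)
        qed
        then have 1: "sqrt \<bar>a\<bar> * sqrt \<bar>b\<bar> \<le> norm z"
          unfolding n by (simp flip: real_sqrt_mult)
        have "(1 + (a\<^sup>2 + b\<^sup>2))\<^sup>2 - (1 + a\<^sup>2) * (1 + b\<^sup>2)
            = a\<^sup>2 + b\<^sup>2 + (a\<^sup>2)\<^sup>2 + (b\<^sup>2)\<^sup>2 + a\<^sup>2 * b\<^sup>2"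
          by (simp add: power2_eq_square algebra_simps)
        also have "\<dots> \<ge> 0" by (intro add_nonneg_nonneg) auto
        finally have "(1 + a\<^sup>2) * (1 + b\<^sup>2) \<le> (1 + (a\<^sup>2 + b\<^sup>2))\<^sup>2" by simp
        then have 2: "sqrt (1 + a\<^sup>2) * sqrt (1 + b\<^sup>2) \<le> (norm z)\<^sup>2 + 1"
          unfolding n by (simp add: real_le_lsqrt add.commute flip: real_sqrt_mult)
        have "(sqrt \<bar>a\<bar> * sqrt \<bar>b\<bar>) * (sqrt (1 + a\<^sup>2) * sqrt (1 + b\<^sup>2)) \<le> norm z * ((norm z)\<^sup>2 + 1)"
          by (intro mult_mono 1 2) auto
        moreover have "0 < (sqrt \<bar>a\<bar> * sqrt \<bar>b\<bar>) * (sqrt (1 + a\<^sup>2) * sqrt (1 + b\<^sup>2))"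
          using ab by (intro mult_pos_pos) (auto intro: add_pos_nonneg)
        ultimately have "1 / (norm z * ((norm z)\<^sup>2 + 1))
            \<le> 1 / ((sqrt \<bar>a\<bar> * sqrt \<bar>b\<bar>) * (sqrt (1 + a\<^sup>2) * sqrt (1 + b\<^sup>2)))"
          by (intro divide_left_mono) (auto intro!: mult_pos_pos)
        then show ?case by (simp add: sing_def z mult_ac)
      qed
    qed
  qed simp
qed

text \<open>Homogeneity of degree -3; against the area factor d^2 this leaves a mass proportional to
  1/d.\<close>

lemma sing_scale: assumes "d > 0" shows "sing d (d *\<^sub>R z) = sing 1 z / d ^ 3"
proof -
  have "sing d (d *\<^sub>R z) = 1 / (d * norm z * (d\<^sup>2 * ((norm z)\<^sup>2 + 1)))"
    using assms by (simp only: sing_def norm_scaleR power_mult_distrib) (simp add: distrib_left)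
  then show ?thesis using assms by (simp add: sing_def power2_eq_square power3_eq_cube mult_ac)
qed

lemma integrable_sing: assumes "d > 0" shows "integrable lborel (sing d)"
  using plane_affine(1)[OF sing_measurable, of d d 0] assms integrable_sing1 by (simp add: sing_scale)

lemma integral_sing: assumes "d > 0" shows "(\<integral>z. sing d z \<partial>lborel) = sing_mass / d"
  using plane_affine(2)[OF sing_measurable, of d d 0] assms
  by (simp add: sing_scale sing_mass_def power2_eq_square power3_eq_cube)

lemma sing_mass_nonneg: "0 \<le> sing_mass" by (simp add: sing_mass_def)

lemma integrable_sing_reflect: "d > 0 \<Longrightarrow> integrable lborel (\<lambda>y. sing d (x - y))"
  using plane_reflect(1)[OF sing_measurable, of d x] integrable_sing by blast

lemma integral_sing_reflect: "d > 0 \<Longrightarrow> (\<integral>y. sing d (x - y) \<partial>lborel) = sing_mass / d"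
  using plane_reflect(2)[OF sing_measurable, of d x] integral_sing by simp

section \<open>The regularised Biot--Savart kernel and velocity\<close>

definition kern :: "real \<times> real \<Rightarrow> real \<Rightarrow> real \<times> real \<Rightarrow> real" where
  "kern e d z = (e \<bullet> z) / ((norm z)\<^sup>2 + d\<^sup>2)"

lemma kern_measurable [measurable]: "kern e d \<in> borel_measurable borel"
  unfolding kern_def by measurable

lemma kern_bound:
  assumes "norm e \<le> 1" "d > 0" shows "\<bar>kern e d z\<bar> \<le> 1 / d"
proof -
  have "\<bar>e \<bullet> z\<bar> \<le> norm z"
    using Cauchy_Schwarz_ineq2[of e z] mult_right_mono[OF assms(1), of "norm z"] by simp
  moreover have "norm z * d \<le> (norm z)\<^sup>2 + d\<^sup>2"
  proof -
    have "0 \<le> norm z * d" using assms by simp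
    then show ?thesis using sum_squares_bound[of "norm z" d] by linarith
  qed
  ultimately have "\<bar>e \<bullet> z\<bar> * d \<le> (norm z)\<^sup>2 + d\<^sup>2"
    using mult_right_mono[of "\<bar>e \<bullet> z\<bar>" "norm z" d] assms by linarith
  moreover have "0 < (norm z)\<^sup>2 + d\<^sup>2" using assms by (simp add: add_nonneg_pos)
  ultimately show ?thesis using assms by (simp add: kern_def abs_divide divide_simps)
qed

text \<open>The difference of the fractions has numerator d^2 times the inner product of e and z,
  which is at most d^2 |z| and so cancels one power of the singularity. At z = 0 both kernels are 0
  by the convention for division.\<close>

lemma kern_diff:
  assumes "norm e \<le> 1" "d > 0" shows "\<bar>kern e 0 z - kern e d z\<bar> \<le> d\<^sup>2 * sing d z"
proof (cases "z = 0")
  case False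
  then have n: "norm z > 0" by simp
  have cs: "\<bar>e \<bullet> z\<bar> \<le> norm z"
    using Cauchy_Schwarz_ineq2[of e z] mult_right_mono[OF assms(1), of "norm z"] by simp
  have q: "0 < (norm z)\<^sup>2 + d\<^sup>2" using assms by (simp add: add_nonneg_pos)
  have "kern e 0 z - kern e d z = (e \<bullet> z) * d\<^sup>2 / ((norm z)\<^sup>2 * ((norm z)\<^sup>2 + d\<^sup>2))"
    using n q by (simp add: kern_def divide_simps) (simp add: algebra_simps)
  then have "\<bar>kern e 0 z - kern e d z\<bar> = \<bar>e \<bullet> z\<bar> * d\<^sup>2 / ((norm z)\<^sup>2 * ((norm z)\<^sup>2 + d\<^sup>2))"
    using n q by (simp add: abs_mult)
  also have "\<dots> \<le> norm z * d\<^sup>2 / ((norm z)\<^sup>2 * ((norm z)\<^sup>2 + d\<^sup>2))"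
    using cs q by (intro divide_right_mono mult_right_mono) auto
  also have "\<dots> = d\<^sup>2 * sing d z" using n by (simp add: sing_def power2_eq_square)
  finally show ?thesis .
qed (simp add: kern_def)

text \<open>Biot--Savart components: \<open>e = (0, -1)\<close> gives the first one, \<open>e = (1, 0)\<close> the second one;
  \<open>d > 0\<close> regularises the kernel.\<close>

definition velo :: "real \<times> real \<Rightarrow> real \<Rightarrow> (real \<times> real \<Rightarrow> real) \<Rightarrow> real \<times> real \<Rightarrow> real" where
  "velo e d v x = (1 / (2 * pi)) * (\<integral>y. kern e d (x - y) * v y \<partial>lborel)"

lemma BS_velocity_eq: "BS_velocity v x = (velo (0, -1) 0 v x, velo (1, 0) 0 v x)"
  by (simp add: BS_velocity_def velo_def kern_def inner_prod_def)

lemma integrable_bounded_mult: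
  fixes k v :: "'a \<Rightarrow> real"
  assumes "integrable M v" "k \<in> borel_measurable M" "\<And>x. \<bar>k x\<bar> \<le> C"
  shows "integrable M (\<lambda>x. k x * v x)"
proof (rule Bochner_Integration.integrable_bound[of _ "\<lambda>x. C * v x"])
  show "AE x in M. norm (k x * v x) \<le> norm (C * v x)"
    using order_trans[OF assms(3) abs_ge_self] by (intro AE_I2) (auto simp: abs_mult intro!: mult_right_mono)
qed (use assms in \<open>auto intro!: borel_measurable_times\<close>)

lemma integrable_kern_pos:
  assumes "norm e \<le> 1" "d > 0" "integrable lborel v"
  shows "integrable lborel (\<lambda>y. kern e d (x - y) * v y)"
  by (rule integrable_bounded_mult[OF assms(3), where C = "1 / d"]) (use kern_bound assms in auto)

lemma kern_diff_conv:
  assumes e: "norm e \<le> 1" "d > 0" and v: "integrable lborel v" "\<And>y. \<bar>v y\<bar> \<le> B"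
  shows "integrable lborel (\<lambda>y. (kern e 0 (x - y) - kern e d (x - y)) * v y)"
    and "\<bar>\<integral>y. (kern e 0 (x - y) - kern e d (x - y)) * v y \<partial>lborel\<bar> \<le> d * sing_mass * B"
proof -
  have [measurable]: "v \<in> borel_measurable borel" using v(1) by (auto dest: borel_measurable_integrable)
  have b: "norm ((kern e 0 (x - y) - kern e d (x - y)) * v y) \<le> d\<^sup>2 * B * sing d (x - y)" for y
  proof -
    have "norm ((kern e 0 (x - y) - kern e d (x - y)) * v y) \<le> (d\<^sup>2 * sing d (x - y)) * B"
      unfolding real_norm_def abs_mult using kern_diff[OF e] v(2) by (intro mult_mono) auto
    then show ?thesis by (simp add: mult_ac)
  qed
  have i: "integrable lborel (\<lambda>y. d\<^sup>2 * B * sing d (x - y))"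
    using integrable_sing_reflect[OF e(2)] by simp
  show 1: "integrable lborel (\<lambda>y. (kern e 0 (x - y) - kern e d (x - y)) * v y)"
    by (rule Bochner_Integration.integrable_bound[OF i])
      (use b in \<open>auto intro!: AE_I2 order_trans[OF _ abs_ge_self]\<close>)
  have "\<bar>\<integral>y. (kern e 0 (x - y) - kern e d (x - y)) * v y \<partial>lborel\<bar> \<le> (\<integral>y. d\<^sup>2 * B * sing d (x - y) \<partial>lborel)"
    by (rule Bochner_Integration.integral_abs_bound_integral[OF 1 i]) (use b in simp)
  also have "\<dots> = d * sing_mass * B" using e by (simp add: integral_sing_reflect power2_eq_square)
  finally show "\<bar>\<integral>y. (kern e 0 (x - y) - kern e d (x - y)) * v y \<partial>lborel\<bar> \<le> d * sing_mass * B" .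
qed

text \<open>The prefactor of the velocity is below 1 and is dropped from all bounds.\<close>

lemma two_pi_scale: "\<bar>x\<bar> \<le> c \<Longrightarrow> \<bar>(1 / (2 * pi)) * x\<bar> \<le> c"
proof -
  assume *: "\<bar>x\<bar> \<le> c"
  have "\<bar>(1 / (2 * pi)) * x\<bar> = (1 / (2 * pi)) * \<bar>x\<bar>" by (simp add: abs_mult)
  also have "\<dots> \<le> 1 * \<bar>x\<bar>" using pi_gt3 by (intro mult_right_mono) auto
  finally show ?thesis using * by simp
qed

text \<open>A bounded v is paired with d^2 times a function of mass \<open>sing_mass / d\<close>, so
  the error is linear in d and free of the L^1 norm of v. This freedom is what allows the
  regularisation length to be tuned later.\<close>

lemma velo_diff:
  assumes e: "norm e \<le> 1" "d > 0" and v: "integrable lborel v" "\<And>y. \<bar>v y\<bar> \<le> B"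
  shows "\<bar>velo e 0 v x - velo e d v x\<bar> \<le> d * sing_mass * B"
proof -
  note k = kern_diff_conv[OF e v, of x] integrable_kern_pos[OF e v(1), of x]
  have "integrable lborel (\<lambda>y. kern e 0 (x - y) * v y)"
    using Bochner_Integration.integrable_add[OF k(1) k(3)] by (simp add: algebra_simps)
  then have "velo e 0 v x - velo e d v x
      = (1 / (2 * pi)) * (\<integral>y. (kern e 0 (x - y) - kern e d (x - y)) * v y \<partial>lborel)"
    using k(3) by (simp add: velo_def left_diff_distrib diff_divide_distrib)
  then show ?thesis using two_pi_scale[OF k(2)] by simp
qed

lemma velo_pos_bound:
  assumes e: "norm e \<le> 1" "d > 0" and v: "integrable lborel v"
  shows "\<bar>velo e d v x\<bar> \<le> (\<integral>y. \<bar>v y\<bar> \<partial>lborel) / d"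
proof -
  have "\<bar>\<integral>y. kern e d (x - y) * v y \<partial>lborel\<bar> \<le> (\<integral>y. \<bar>v y\<bar> / d \<partial>lborel)"
  proof (rule Bochner_Integration.integral_abs_bound_integral)
    show "\<bar>kern e d (x - y) * v y\<bar> \<le> \<bar>v y\<bar> / d" for y
      using mult_right_mono[OF kern_bound[OF e, of "x-y"], of "\<bar>v y\<bar>"] by (simp add: abs_mult)
  qed (use integrable_kern_pos[OF e v] v in auto)
  then show ?thesis unfolding velo_def by (intro two_pi_scale) simp
qed

text \<open>Regularisation length 1: the sup norm pays for the singular part, the L^1 norm for the
  rest.\<close>

lemma velo_bound:
  assumes e: "norm e \<le> 1" and v: "integrable lborel v" "\<And>y. \<bar>v y\<bar> \<le> B"
  shows "\<bar>velo e 0 v x\<bar> \<le> sing_mass * B + (\<integral>y. \<bar>v y\<bar> \<partial>lborel)"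
  using velo_diff[OF e _ v, of 1 x] velo_pos_bound[OF e _ v(1), of 1 x] by simp

section \<open>Continuity and derivatives of the velocity\<close>

lemma continuous_conv:
  fixes k :: "real \<times> real \<Rightarrow> real"
  assumes k: "continuous_on UNIV k" "\<And>z. \<bar>k z\<bar> \<le> C" and v: "integrable lborel v"
  shows "continuous_on UNIV (\<lambda>x. \<integral>y. k (x - y) * v y \<partial>lborel)"
proof (rule continuous_at_imp_continuous_on, safe)
  fix x :: "real \<times> real"
  have [measurable]: "k \<in> borel_measurable borel" using k(1) by (rule borel_measurable_continuous_onI)
  have [measurable]: "v \<in> borel_measurable borel" using v by (auto dest: borel_measurable_integrable)
  show "isCont (\<lambda>x. \<integral>y. k (x - y) * v y \<partial>lborel) x"
    unfolding continuous_at_sequentially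
  proof safe
    fix X :: "nat \<Rightarrow> real \<times> real" assume X: "X \<longlonglongrightarrow> x"
    show "((\<lambda>x. \<integral>y. k (x - y) * v y \<partial>lborel) \<circ> X) \<longlonglongrightarrow> (\<integral>y. k (x - y) * v y \<partial>lborel)"
      unfolding o_def
    proof (rule integral_dominated_convergence[where w = "\<lambda>y. C * \<bar>v y\<bar>"])
      show "AE y in lborel. (\<lambda>n. k (X n - y) * v y) \<longlonglongrightarrow> k (x - y) * v y"
      proof (rule AE_I2)
        fix y
        have "(\<lambda>n. X n - y) \<longlonglongrightarrow> x - y" by (intro tendsto_intros X)
        then have "(\<lambda>n. k (X n - y)) \<longlonglongrightarrow> k (x - y)"
          using k(1) continuous_on_eq_continuous_at[OF open_UNIV] isCont_tendsto_compose by (metis UNIV_I)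
        then show "(\<lambda>n. k (X n - y) * v y) \<longlonglongrightarrow> k (x - y) * v y" by (intro tendsto_intros)
      qed
      show "AE y in lborel. norm (k (X n - y) * v y) \<le> C * \<bar>v y\<bar>" for n
        using k(2) by (intro AE_I2) (simp only: real_norm_def abs_mult mult_right_mono abs_ge_zero)
    qed (use v in auto)
  qed
qed

lemma pd1_conv:
  fixes k :: "real \<times> real \<Rightarrow> real"
  assumes k: "pd1 k k1" "\<And>z. \<bar>k z\<bar> \<le> C" "\<And>z. \<bar>k1 z\<bar> \<le> C1" and v: "integrable lborel v"
  shows "pd1 (\<lambda>x. \<integral>y. k (x - y) * v y \<partial>lborel) (\<lambda>x. \<integral>y. k1 (x - y) * v y \<partial>lborel)"
  unfolding pd1_def
proof safe
  have kc: "continuous_on UNIV k" "continuous_on UNIV k1" using k(1) by (auto simp: pd1_def)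
  show "continuous_on UNIV (\<lambda>x. \<integral>y. k (x - y) * v y \<partial>lborel)"
    "continuous_on UNIV (\<lambda>x. \<integral>y. k1 (x - y) * v y \<partial>lborel)"
    using continuous_conv[OF _ _ v] kc k by blast+
  have [measurable]: "k \<in> borel_measurable borel" "k1 \<in> borel_measurable borel"
    using kc by (auto intro: borel_measurable_continuous_onI)
  have [measurable]: "v \<in> borel_measurable borel" using v by (auto dest: borel_measurable_integrable)
  fix x1 x2 :: real
  show "((\<lambda>s. \<integral>y. k ((s, x2) - y) * v y \<partial>lborel) has_real_derivative
        (\<integral>y. k1 ((x1, x2) - y) * v y \<partial>lborel)) (at x1)"
  proof (rule has_real_derivative_integral[where a = "x1 - 1" and b = "x1 + 1" and g = "\<lambda>y. C1 * \<bar>v y\<bar>"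
      and f' = "\<lambda>s y. k1 ((s, x2) - y) * v y"])
    fix s :: real and y :: "real \<times> real"
    show "((\<lambda>s. k ((s, x2) - y) * v y) has_real_derivative k1 ((s, x2) - y) * v y) (at s)"
    proof -
      have "((\<lambda>s. k (s, x2 - snd y)) has_real_derivative k1 (s - fst y, x2 - snd y)) (at (s - fst y))"
        using k(1) by (simp add: pd1_def)
      moreover have "((\<lambda>s. s - fst y) has_real_derivative 1) (at s)"
        by (auto intro!: derivative_eq_intros)
      ultimately
      have "((\<lambda>s. k (s - fst y, x2 - snd y)) has_real_derivative k1 (s - fst y, x2 - snd y)) (at s)"
        using DERIV_chain2 by fastforce
      then show ?thesis by (auto simp: minus_prod_def intro!: derivative_eq_intros)
    qed
    show "\<bar>k1 ((s, x2) - y) * v y\<bar> \<le> C1 * \<bar>v y\<bar>"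
      using k(3) by (simp only: abs_mult mult_right_mono abs_ge_zero)
    show "integrable lborel (\<lambda>y. k ((s, x2) - y) * v y)"
      by (rule integrable_bounded_mult[OF v]) (use k(2) in auto)
  qed (use v in auto)
qed

lemma pd2_conv:
  fixes k :: "real \<times> real \<Rightarrow> real"
  assumes k: "pd2 k k1" "\<And>z. \<bar>k z\<bar> \<le> C" "\<And>z. \<bar>k1 z\<bar> \<le> C1" and v: "integrable lborel v"
  shows "pd2 (\<lambda>x. \<integral>y. k (x - y) * v y \<partial>lborel) (\<lambda>x. \<integral>y. k1 (x - y) * v y \<partial>lborel)"
  unfolding pd2_def
proof safe
  have kc: "continuous_on UNIV k" "continuous_on UNIV k1" using k(1) by (auto simp: pd2_def)
  show "continuous_on UNIV (\<lambda>x. \<integral>y. k (x - y) * v y \<partial>lborel)"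
    "continuous_on UNIV (\<lambda>x. \<integral>y. k1 (x - y) * v y \<partial>lborel)"
    using continuous_conv[OF _ _ v] kc k by blast+
  have [measurable]: "k \<in> borel_measurable borel" "k1 \<in> borel_measurable borel"
    using kc by (auto intro: borel_measurable_continuous_onI)
  have [measurable]: "v \<in> borel_measurable borel" using v by (auto dest: borel_measurable_integrable)
  fix x1 x2 :: real
  show "((\<lambda>s. \<integral>y. k ((x1, s) - y) * v y \<partial>lborel) has_real_derivative
        (\<integral>y. k1 ((x1, x2) - y) * v y \<partial>lborel)) (at x2)"
  proof (rule has_real_derivative_integral[where a = "x2 - 1" and b = "x2 + 1" and g = "\<lambda>y. C1 * \<bar>v y\<bar>"
      and f' = "\<lambda>s y. k1 ((x1, s) - y) * v y"])
    fix s :: real and y :: "real \<times> real"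
    show "((\<lambda>s. k ((x1, s) - y) * v y) has_real_derivative k1 ((x1, s) - y) * v y) (at s)"
    proof -
      have "((\<lambda>s. k (x1 - fst y, s)) has_real_derivative k1 (x1 - fst y, s - snd y)) (at (s - snd y))"
        using k(1) by (simp add: pd2_def)
      moreover have "((\<lambda>s. s - snd y) has_real_derivative 1) (at s)"
        by (auto intro!: derivative_eq_intros)
      ultimately
      have "((\<lambda>s. k (x1 - fst y, s - snd y)) has_real_derivative k1 (x1 - fst y, s - snd y)) (at s)"
        using DERIV_chain2 by fastforce
      then show ?thesis by (auto simp: minus_prod_def intro!: derivative_eq_intros)
    qed
    show "\<bar>k1 ((x1, s) - y) * v y\<bar> \<le> C1 * \<bar>v y\<bar>"
      using k(3) by (simp only: abs_mult mult_right_mono abs_ge_zero)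
    show "integrable lborel (\<lambda>y. k ((x1, s) - y) * v y)"
      by (rule integrable_bounded_mult[OF v]) (use k(2) in auto)
  qed (use v in auto)
qed

definition dkern1 :: "real \<times> real \<Rightarrow> real \<Rightarrow> real \<times> real \<Rightarrow> real" where
  "dkern1 e d z = fst e / ((norm z)\<^sup>2 + d\<^sup>2) - 2 * fst z * (e \<bullet> z) / ((norm z)\<^sup>2 + d\<^sup>2)\<^sup>2"

definition dkern2 :: "real \<times> real \<Rightarrow> real \<Rightarrow> real \<times> real \<Rightarrow> real" where
  "dkern2 e d z = snd e / ((norm z)\<^sup>2 + d\<^sup>2) - 2 * snd z * (e \<bullet> z) / ((norm z)\<^sup>2 + d\<^sup>2)\<^sup>2"

lemma kern_denom_pos: "d > 0 \<Longrightarrow> 0 < (norm z)\<^sup>2 + d\<^sup>2" for d :: real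
  by (simp add: add_nonneg_pos)

lemma kern_denom_ne: "d > 0 \<Longrightarrow> (norm z)\<^sup>2 + d\<^sup>2 \<noteq> 0" for d :: real
  using kern_denom_pos[of d z] by linarith

lemma pd1_kern: assumes "d > 0" shows "pd1 (kern e d) (dkern1 e d)"
  unfolding pd1_def
proof safe
  show "continuous_on UNIV (kern e d)" "continuous_on UNIV (dkern1 e d)"
    unfolding kern_def dkern1_def
    by (intro continuous_intros ballI power_not_zero kern_denom_ne[OF assms])+
  fix x1 x2 :: real
  have ne: "x1\<^sup>2 + x2\<^sup>2 + d\<^sup>2 \<noteq> 0" using kern_denom_ne[OF assms, of "(x1, x2)"] by (simp add: norm_pair_sq)
  have "((\<lambda>s. (fst e * s + snd e * x2) / (s\<^sup>2 + x2\<^sup>2 + d\<^sup>2)) has_real_derivative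
      (fst e * (x1\<^sup>2 + x2\<^sup>2 + d\<^sup>2) - (fst e * x1 + snd e * x2) * (2 * x1))
        / ((x1\<^sup>2 + x2\<^sup>2 + d\<^sup>2) * (x1\<^sup>2 + x2\<^sup>2 + d\<^sup>2))) (at x1)"
    using ne by (intro DERIV_divide) (auto intro!: derivative_eq_intros)
  then show "((\<lambda>s. kern e d (s, x2)) has_real_derivative dkern1 e d (x1, x2)) (at x1)"
    unfolding kern_def dkern1_def norm_pair_sq inner_prod_def
    using ne by (simp add: diff_divide_distrib power2_eq_square mult.commute)
qed

lemma pd2_kern: assumes "d > 0" shows "pd2 (kern e d) (dkern2 e d)"
  unfolding pd2_def
proof safe
  show "continuous_on UNIV (kern e d)" "continuous_on UNIV (dkern2 e d)"
    unfolding kern_def dkern2_def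
    by (intro continuous_intros ballI power_not_zero kern_denom_ne[OF assms])+
  fix x1 x2 :: real
  have ne: "x1\<^sup>2 + x2\<^sup>2 + d\<^sup>2 \<noteq> 0" using kern_denom_ne[OF assms, of "(x1, x2)"] by (simp add: norm_pair_sq)
  have "((\<lambda>s. (fst e * x1 + snd e * s) / (x1\<^sup>2 + s\<^sup>2 + d\<^sup>2)) has_real_derivative
      (snd e * (x1\<^sup>2 + x2\<^sup>2 + d\<^sup>2) - (fst e * x1 + snd e * x2) * (2 * x2))
        / ((x1\<^sup>2 + x2\<^sup>2 + d\<^sup>2) * (x1\<^sup>2 + x2\<^sup>2 + d\<^sup>2))) (at x2)"
    using ne by (intro DERIV_divide) (auto intro!: derivative_eq_intros)
  then show "((\<lambda>s. kern e d (x1, s)) has_real_derivative dkern2 e d (x1, x2)) (at x2)"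
    unfolding kern_def dkern2_def norm_pair_sq inner_prod_def
    using ne by (simp add: diff_divide_distrib power2_eq_square mult.commute)
qed

text \<open>The two terms are bounded by 1 and 2 times 1 / (|z|^2 + d^2), whence the 3. Here a is a
  coordinate of e and b one of z, so both partial derivatives are covered at once.\<close>

lemma dkern_aux:
  assumes d: "d > 0" and e: "norm e \<le> 1" and ab: "\<bar>a\<bar> \<le> 1" "\<bar>b\<bar> \<le> norm z"
  shows "\<bar>a / ((norm z)\<^sup>2 + d\<^sup>2) - 2 * b * (e \<bullet> z) / ((norm z)\<^sup>2 + d\<^sup>2)\<^sup>2\<bar> \<le> 3 / d\<^sup>2"
proof -
  let ?q = "(norm z)\<^sup>2 + d\<^sup>2"
  have q: "0 < ?q" "d\<^sup>2 \<le> ?q" "(norm z)\<^sup>2 \<le> ?q" using kern_denom_pos[OF d, of z] by auto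
  have "\<bar>e \<bullet> z\<bar> \<le> norm z"
    using Cauchy_Schwarz_ineq2[of e z] mult_right_mono[OF e, of "norm z"] by simp
  then have "\<bar>b\<bar> * \<bar>e \<bullet> z\<bar> \<le> norm z * norm z" using ab by (intro mult_mono) auto
  also have "\<dots> \<le> ?q" using q(3) by (simp only: power2_eq_square)
  finally have "2 * (\<bar>b\<bar> * \<bar>e \<bullet> z\<bar>) / ?q\<^sup>2 \<le> 2 * ?q / ?q\<^sup>2"
    by (intro divide_right_mono mult_left_mono) simp_all
  also have "\<dots> = 2 / ?q"
  proof -
    have "2 * c / c\<^sup>2 = 2 / c" if "c > 0" for c :: real using that by (simp add: power2_eq_square)
    then show ?thesis using q(1) by blast
  qed
  finally have 1: "\<bar>2 * b * (e \<bullet> z) / ?q\<^sup>2\<bar> \<le> 2 / ?q" by (simp add: abs_mult mult.assoc)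
  have 2: "\<bar>a / ?q\<bar> \<le> 1 / ?q"
    unfolding abs_divide abs_of_pos[OF q(1)] using ab q(1) by (intro divide_right_mono) simp_all
  have "\<bar>a / ?q - 2 * b * (e \<bullet> z) / ?q\<^sup>2\<bar> \<le> 1 / ?q + 2 / ?q"
    by (rule order_trans[OF abs_triangle_ineq4 add_mono[OF 2 1]])
  also have "\<dots> = 3 / ?q" by (simp flip: add_divide_distrib)
  also have "\<dots> \<le> 3 / d\<^sup>2" using q(2) d by (intro divide_left_mono mult_pos_pos q(1)) simp_all
  finally show ?thesis .
qed

lemma abs_fst_le_norm: "\<bar>fst z\<bar> \<le> norm z" and abs_snd_le_norm: "\<bar>snd z\<bar> \<le> norm z"
  for z :: "real \<times> real"
  by (cases z; simp add: abs_le_norm_pair)+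

lemma dkern_bound:
  assumes "d > 0" "norm e \<le> 1" shows "\<bar>dkern1 e d z\<bar> \<le> 3 / d\<^sup>2" "\<bar>dkern2 e d z\<bar> \<le> 3 / d\<^sup>2"
  unfolding dkern1_def dkern2_def
  by (rule dkern_aux; use assms order_trans[OF abs_fst_le_norm assms(2)]
      order_trans[OF abs_snd_le_norm assms(2)] abs_fst_le_norm abs_snd_le_norm in simp)+

definition dvelo1 :: "real \<times> real \<Rightarrow> real \<Rightarrow> (real \<times> real \<Rightarrow> real) \<Rightarrow> real \<times> real \<Rightarrow> real" where
  "dvelo1 e d v x = (1 / (2 * pi)) * (\<integral>y. dkern1 e d (x - y) * v y \<partial>lborel)"

definition dvelo2 :: "real \<times> real \<Rightarrow> real \<Rightarrow> (real \<times> real \<Rightarrow> real) \<Rightarrow> real \<times> real \<Rightarrow> real" where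
  "dvelo2 e d v x = (1 / (2 * pi)) * (\<integral>y. dkern2 e d (x - y) * v y \<partial>lborel)"

lemma pd1_cmult: "pd1 f f1 \<Longrightarrow> pd1 (\<lambda>x. c * f x) (\<lambda>x. c * f1 x)"
  unfolding pd1_def by (auto intro!: continuous_intros DERIV_cmult)

lemma pd2_cmult: "pd2 f f1 \<Longrightarrow> pd2 (\<lambda>x. c * f x) (\<lambda>x. c * f1 x)"
  unfolding pd2_def by (auto intro!: continuous_intros DERIV_cmult)

lemma pd_velo:
  assumes e: "norm e \<le> 1" "d > 0" and v: "integrable lborel v"
  shows "pd1 (velo e d v) (dvelo1 e d v)" "pd2 (velo e d v) (dvelo2 e d v)"
proof -
  show "pd1 (velo e d v) (dvelo1 e d v)"
    unfolding velo_def[abs_def] dvelo1_def[abs_def]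
    by (rule pd1_cmult[OF pd1_conv[OF pd1_kern[OF e(2)] kern_bound[OF e] dkern_bound(1)[OF e(2,1)] v]])
  show "pd2 (velo e d v) (dvelo2 e d v)"
    unfolding velo_def[abs_def] dvelo2_def[abs_def]
    by (rule pd2_cmult[OF pd2_conv[OF pd2_kern[OF e(2)] kern_bound[OF e] dkern_bound(2)[OF e(2,1)] v]])
qed

text \<open>The singular kernel is unbounded, so \<open>continuous_conv\<close> does not reach it;
  by \<open>velo_diff\<close> the regularised velocities converge uniformly.\<close>

lemma continuous_velo0:
  assumes e: "norm e \<le> 1" and v: "integrable lborel v" "\<And>y. \<bar>v y\<bar> \<le> B"
  shows "continuous_on UNIV (velo e 0 v)"
proof (rule uniform_limit_theorem[where F = sequentially and f = "\<lambda>n. velo e (1 / Suc n) v"])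
  show "\<forall>\<^sub>F n in sequentially. continuous_on UNIV (velo e (1 / real (Suc n)) v)"
    using pd_velo(1)[OF e _ v(1)] by (auto simp: pd1_def)
  have B: "0 \<le> B" using v(2)[of undefined] by linarith
  show "uniform_limit UNIV (\<lambda>n. velo e (1 / real (Suc n)) v) (velo e 0 v) sequentially"
  proof (rule uniform_limitI)
    fix \<epsilon> :: real assume \<epsilon>: "\<epsilon> > 0"
    have "(\<lambda>n. 1 / real (Suc n) * sing_mass * B) \<longlonglongrightarrow> 0 * sing_mass * B"
      by (intro tendsto_intros LIMSEQ_Suc lim_1_over_n)
    then have "\<forall>\<^sub>F n in sequentially. 1 / real (Suc n) * sing_mass * B < \<epsilon>"
      using order_tendstoD(2)[of _ "0 * sing_mass * B" _ \<epsilon>] \<epsilon> by simp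
    then show "\<forall>\<^sub>F n in sequentially. \<forall>x\<in>UNIV. dist (velo e (1 / real (Suc n)) v x) (velo e 0 v x) < \<epsilon>"
    proof eventually_elim
      case (elim n)
      show ?case
      proof
        fix x
        have "\<bar>velo e 0 v x - velo e (1 / real (Suc n)) v x\<bar> \<le> 1 / real (Suc n) * sing_mass * B"
          by (rule velo_diff[OF e _ v]) simp
        then show "dist (velo e (1 / real (Suc n)) v x) (velo e 0 v x) < \<epsilon>"
          using elim by (simp add: dist_real_def abs_minus_commute)
      qed
    qed
  qed
qed simp

abbreviation "dir1 \<equiv> (0, -1) :: real \<times> real"
abbreviation "dir2 \<equiv> (1, 0) :: real \<times> real"

lemma norm_dir [simp]: "norm dir1 \<le> 1" "norm dir2 \<le> 1"
  by (simp_all add: norm_prod_def)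

lemma integrable_dkern:
  assumes e: "norm e \<le> 1" "d > 0" and v: "integrable lborel v"
  shows "integrable lborel (\<lambda>y. dkern1 e d (x - y) * v y)" "integrable lborel (\<lambda>y. dkern2 e d (x - y) * v y)"
proof -
  have [measurable]: "dkern1 e d \<in> borel_measurable borel" "dkern2 e d \<in> borel_measurable borel"
    using pd1_kern[OF e(2), of e] pd2_kern[OF e(2), of e]
    by (auto simp: pd1_def pd2_def intro: borel_measurable_continuous_onI)
  show "integrable lborel (\<lambda>y. dkern1 e d (x - y) * v y)" "integrable lborel (\<lambda>y. dkern2 e d (x - y) * v y)"
    by (rule integrable_bounded_mult[OF v _ dkern_bound(1)[OF e(2,1)]], simp,
        rule integrable_bounded_mult[OF v _ dkern_bound(2)[OF e(2,1)]], simp)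
qed

text \<open>The two kernels form the rotated gradient of ln (|z|^2 + d^2) / 2, so the divergence
  cancels pointwise under the integral.\<close>

lemma velo_div:
  assumes d: "d > 0" and v: "integrable lborel v"
  shows "dvelo1 dir1 d v x + dvelo2 dir2 d v x = 0"
proof -
  have "dkern1 dir1 d z + dkern2 dir2 d z = 0" for z
    by (simp add: dkern1_def dkern2_def inner_prod_def)
  then have "(\<integral>y. dkern1 dir1 d (x - y) * v y + dkern2 dir2 d (x - y) * v y \<partial>lborel) = 0"
    by (simp flip: distrib_right)
  then have "(\<integral>y. dkern1 dir1 d (x - y) * v y \<partial>lborel) + (\<integral>y. dkern2 dir2 d (x - y) * v y \<partial>lborel) = 0"
    using integrable_dkern[OF _ d v] by simp
  then show ?thesis by (simp add: dvelo1_def dvelo2_def flip: distrib_left add_divide_distrib)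
qed

section \<open>The curl of the regularised velocity as an approximate identity\<close>

definition mollifier :: "real \<times> real \<Rightarrow> real" where "mollifier z = 1 / ((norm z)\<^sup>2 + 1)\<^sup>2"

text \<open>Normalising constant of the approximate identity in \<open>velo_curl\<close>, carried as
  a symbol; its positivity allows division by it.\<close>

definition mollifier_mass :: real where "mollifier_mass = (\<integral>z. mollifier z \<partial>lborel)"

lemma mollifier_pos: "0 < mollifier z"
  using kern_denom_pos[of 1 z] by (simp add: mollifier_def)

lemma mollifier_measurable [measurable]: "mollifier \<in> borel_measurable borel"
  unfolding mollifier_def by measurable

lemma integrable_mollifier: "integrable lborel mollifier"
proof (rule Bochner_Integration.integrable_bound[OF integrable_sing1])
  have "AE z in lborel. z \<noteq> (0 :: real \<times> real)"
    by (rule AE_lborel_singleton)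
  then show "AE z in lborel. norm (mollifier z) \<le> norm (sing 1 z)"
  proof eventually_elim
    case (elim z)
    have q: "0 < (norm z)\<^sup>2 + 1" by (simp add: add_nonneg_pos)
    have "norm z \<le> (norm z)\<^sup>2 + 1"
      using sum_squares_bound[of "norm z" 1] norm_ge_zero[of z] by (simp only: power_one)
    then have "norm z * ((norm z)\<^sup>2 + 1) \<le> ((norm z)\<^sup>2 + 1)\<^sup>2"
      unfolding power2_eq_square[of "(norm z)\<^sup>2 + 1"] using q by (intro mult_right_mono) auto
    moreover have "0 < norm z * ((norm z)\<^sup>2 + 1)" using elim q by simp
    ultimately show ?case using q by (simp add: mollifier_def sing_def frac_le)
  qed
qed simp

lemma mollifier_mass_pos: "0 < mollifier_mass"
proof -
  have "0 \<le> mollifier_mass" unfolding mollifier_mass_def by (intro integral_nonneg_AE AE_I2 less_imp_le mollifier_pos)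
  moreover have "mollifier_mass \<noteq> 0"
  proof
    assume "mollifier_mass = 0"
    then have "AE z in lborel. mollifier z = 0"
      unfolding mollifier_mass_def using integrable_mollifier mollifier_pos
      by (subst (asm) integral_nonneg_eq_0_iff_AE) (auto simp only: less_imp_le intro!: AE_I2)
    then have "AE z in (lborel :: (real \<times> real) measure). False"
      using mollifier_pos by (auto elim!: eventually_mono simp: less_le)
    then show False by (simp add: eventually_False ae_filter_eq_bot_iff)
  qed
  ultimately show ?thesis by linarith
qed

text \<open>The curl of the regularised kernel is 2 d^2 / (|z|^2 + d^2)^2, a rescaled
  \<open>mollifier\<close>. The substitution y = x - d z turns the integral into an average of v at
  scale d.\<close>

lemma velo_curl:
  assumes d: "d > 0" and v: "integrable lborel v"
  shows "dvelo1 dir2 d v x - dvelo2 dir1 d v x = (1 / pi) * (\<integral>z. mollifier z * v (x - d *\<^sub>R z) \<partial>lborel)"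
proof -
  have [measurable]: "v \<in> borel_measurable borel" using v by (auto dest: borel_measurable_integrable)
  have k: "dkern1 dir2 d z - dkern2 dir1 d z = 2 * d\<^sup>2 / ((norm z)\<^sup>2 + d\<^sup>2)\<^sup>2" for z
  proof -
    define q where "q = (norm z)\<^sup>2 + d\<^sup>2"
    have q: "q \<noteq> 0" using kern_denom_ne[OF d, of z] by (simp add: q_def)
    have "dkern1 dir2 d z - dkern2 dir1 d z = 2 / q - 2 * ((fst z)\<^sup>2 + (snd z)\<^sup>2) / q\<^sup>2"
      unfolding dkern1_def dkern2_def q_def[symmetric] inner_prod_def
      by (simp add: power2_eq_square add_divide_distrib diff_divide_distrib distrib_left mult_ac)
    also have "\<dots> = 2 / q - 2 * (q - d\<^sup>2) / q\<^sup>2" by (simp add: q_def norm_pair_sq)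
    also have "\<dots> = 2 * d\<^sup>2 / q\<^sup>2" using q by (simp add: power2_eq_square field_simps)
    finally show ?thesis by (simp add: q_def)
  qed
  have "(\<integral>y. dkern1 dir2 d (x - y) * v y \<partial>lborel) - (\<integral>y. dkern2 dir1 d (x - y) * v y \<partial>lborel)
      = (\<integral>y. dkern1 dir2 d (x - y) * v y - dkern2 dir1 d (x - y) * v y \<partial>lborel)"
    using integrable_dkern[OF _ d v] by simp
  also have "\<dots> = (\<integral>y. 2 * d\<^sup>2 / ((norm (x - y))\<^sup>2 + d\<^sup>2)\<^sup>2 * v y \<partial>lborel)"
    by (simp only: k flip: left_diff_distrib)
  also have "\<dots> = (\<integral>z. d\<^sup>2 * (2 * d\<^sup>2 / ((norm (x - (x + (-d) *\<^sub>R z)))\<^sup>2 + d\<^sup>2)\<^sup>2 * v (x + (-d) *\<^sub>R z)) \<partial>lborel)"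
    unfolding Bochner_Integration.integral_mult_right_zero
    by (subst plane_affine(2)[of _ "-d" x]) (use d in auto)
  also have "\<dots> = (\<integral>z. 2 * (mollifier z * v (x - d *\<^sub>R z)) \<partial>lborel)"
  proof (rule Bochner_Integration.integral_cong[OF refl])
    fix z :: "real \<times> real"
    have "(norm (x - (x + (-d) *\<^sub>R z)))\<^sup>2 + d\<^sup>2 = d\<^sup>2 * ((norm z)\<^sup>2 + 1)"
      using d by (simp add: power_mult_distrib distrib_left)
    then show "d\<^sup>2 * (2 * d\<^sup>2 / ((norm (x - (x + (-d) *\<^sub>R z)))\<^sup>2 + d\<^sup>2)\<^sup>2 * v (x + (-d) *\<^sub>R z))
        = 2 * (mollifier z * v (x - d *\<^sub>R z))"
      using d by (simp add: mollifier_def power_mult_distrib power2_eq_square)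
  qed
  finally show ?thesis by (simp add: dvelo1_def dvelo2_def flip: right_diff_distrib diff_divide_distrib)
qed

lemma mollified_vorticity_bound:
  assumes v: "v \<in> borel_measurable borel" "\<And>y. \<bar>v y\<bar> \<le> B"
  shows "\<bar>\<integral>z. mollifier z * v (x - d *\<^sub>R z) \<partial>lborel\<bar> \<le> mollifier_mass * B"
proof -
  have [measurable]: "v \<in> borel_measurable borel" by fact
  have b: "\<bar>mollifier z * v (x - d *\<^sub>R z)\<bar> \<le> mollifier z * B" for z
    using v(2)[of "x - d *\<^sub>R z"] mollifier_pos[of z] by (simp add: abs_mult mult_left_mono)
  have i: "integrable lborel (\<lambda>z. mollifier z * B)" using integrable_mollifier by simp
  have "integrable lborel (\<lambda>z. mollifier z * v (x - d *\<^sub>R z))"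
    by (rule Bochner_Integration.integrable_bound[OF i])
      (use b in \<open>auto intro!: AE_I2 order_trans[OF _ abs_ge_self]\<close>)
  then have "\<bar>\<integral>z. mollifier z * v (x - d *\<^sub>R z) \<partial>lborel\<bar> \<le> (\<integral>z. mollifier z * B \<partial>lborel)"
    by (rule Bochner_Integration.integral_abs_bound_integral[OF _ i]) (use b in simp)
  then show ?thesis using integrable_mollifier by (simp add: mollifier_mass_def)
qed

text \<open>With \<open>velo_curl\<close> this recovers curl u = v in the limit, up to the factor
  \<open>mollifier_mass / pi\<close>, although the limit velocity itself is never
  differentiated.\<close>

lemma mollified_vorticity_tendsto:
  assumes v: "continuous_on UNIV v" "\<And>y. \<bar>v y\<bar> \<le> B" and X: "X \<longlonglongrightarrow> 0"
  shows "(\<lambda>n. \<integral>z. mollifier z * v (x - X n *\<^sub>R z) \<partial>lborel) \<longlonglongrightarrow> mollifier_mass * v x"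
proof -
  have [measurable]: "v \<in> borel_measurable borel" using v(1) by (rule borel_measurable_continuous_onI)
  have "(\<lambda>n. \<integral>z. mollifier z * v (x - X n *\<^sub>R z) \<partial>lborel) \<longlonglongrightarrow> (\<integral>z. mollifier z * v x \<partial>lborel)"
  proof (rule integral_dominated_convergence[where w = "\<lambda>z. mollifier z * B"])
    show "AE z in lborel. (\<lambda>n. mollifier z * v (x - X n *\<^sub>R z)) \<longlonglongrightarrow> mollifier z * v x"
    proof (rule AE_I2)
      fix z
      have "(\<lambda>n. x - X n *\<^sub>R z) \<longlonglongrightarrow> x - 0 *\<^sub>R z" by (intro tendsto_intros X)
      moreover have "isCont v (x - 0 *\<^sub>R z)"
        using v(1) continuous_on_eq_continuous_at[OF open_UNIV] by blast
      ultimately have "(\<lambda>n. v (x - X n *\<^sub>R z)) \<longlonglongrightarrow> v (x - 0 *\<^sub>R z)"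
        by (rule isCont_tendsto_compose[rotated])
      then have "(\<lambda>n. v (x - X n *\<^sub>R z)) \<longlonglongrightarrow> v x" by simp
      then show "(\<lambda>n. mollifier z * v (x - X n *\<^sub>R z)) \<longlonglongrightarrow> mollifier z * v x" by (intro tendsto_intros)
    qed
    show "AE z in lborel. norm (mollifier z * v (x - X n *\<^sub>R z)) \<le> mollifier z * B" for n
      by (intro AE_I2) (use v(2) mollifier_pos in \<open>simp add: abs_mult mult_left_mono less_imp_le\<close>)
  qed (use integrable_mollifier in auto)
  then show ?thesis using integrable_mollifier by (simp add: mollifier_mass_def)
qed

section \<open>Weak identities for the velocity\<close>

lemma velo_bound_pos:
  assumes e: "norm e \<le> 1" "d > 0" and v: "integrable lborel v" "\<And>y. \<bar>v y\<bar> \<le> B"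
    and V: "\<bar>velo e 0 v x\<bar> \<le> V"
  shows "\<bar>velo e d v x\<bar> \<le> V + d * sing_mass * B"
  using velo_diff[OF e v, of x] V by linarith

lemma velo_tendsto:
  assumes e: "norm e \<le> 1" and v: "integrable lborel v" "\<And>y. \<bar>v y\<bar> \<le> B"
  shows "(\<lambda>n. velo e (1 / real (Suc n)) v x) \<longlonglongrightarrow> velo e 0 v x"
proof -
  have "(\<lambda>n. 1 / real (Suc n) * sing_mass * B) \<longlonglongrightarrow> 0 * sing_mass * B"
    by (intro tendsto_intros LIMSEQ_Suc lim_1_over_n)
  then have "(\<lambda>n. 1 / real (Suc n) * sing_mass * B) \<longlonglongrightarrow> 0" by simp
  moreover have "\<forall>\<^sub>F n in sequentially. norm (velo e (1 / real (Suc n)) v x - velo e 0 v x) \<le> 1 / real (Suc n) * sing_mass * B"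
  proof (intro always_eventually allI)
    fix n
    have "\<bar>velo e 0 v x - velo e (1 / real (Suc n)) v x\<bar> \<le> 1 / real (Suc n) * sing_mass * B"
      by (rule velo_diff[OF e _ v]) simp
    then show "norm (velo e (1 / real (Suc n)) v x - velo e 0 v x) \<le> 1 / real (Suc n) * sing_mass * B"
      by (simp only: real_norm_def abs_minus_commute)
  qed
  ultimately have "(\<lambda>n. velo e (1 / real (Suc n)) v x - velo e 0 v x) \<longlonglongrightarrow> 0"
    by (rule Lim_null_comparison[rotated])
  then show ?thesis by (simp add: LIM_zero_iff)
qed

lemma velo_bound_uniform:
  assumes e: "norm e \<le> 1" and v: "integrable lborel v" "\<And>y. \<bar>v y\<bar> \<le> B"
  shows "\<bar>velo e (1 / real (Suc n)) v x\<bar> \<le> 2 * sing_mass * B + (\<integral>y. \<bar>v y\<bar> \<partial>lborel)"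
proof -
  have B: "0 \<le> B" using v(2)[of undefined] by linarith
  have "\<bar>velo e (1 / real (Suc n)) v x\<bar> \<le> (sing_mass * B + (\<integral>y. \<bar>v y\<bar> \<partial>lborel)) + 1 / real (Suc n) * sing_mass * B"
    by (rule velo_bound_pos[OF e _ v velo_bound[OF e v]]) simp
  also have "1 / real (Suc n) * (sing_mass * B) \<le> 1 * (sing_mass * B)"
    using B sing_mass_nonneg by (intro mult_right_mono) auto
  then have "1 / real (Suc n) * sing_mass * B \<le> sing_mass * B" by (simp only: mult.assoc mult_1)
  finally show ?thesis by linarith
qed

lemma integral_velo_tendsto:
  assumes e: "norm e \<le> 1" and v: "integrable lborel v" "\<And>y. \<bar>v y\<bar> \<le> B"
    and f: "continuous_on UNIV f" "\<And>x. norm x > R \<Longrightarrow> f x = 0"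
  shows "(\<lambda>n. \<integral>x. velo e (1 / real (Suc n)) v x * f x \<partial>lborel) \<longlonglongrightarrow> (\<integral>x. velo e 0 v x * f x \<partial>lborel)"
proof (rule integral_dominated_convergence[where w = "\<lambda>x. (2 * sing_mass * B + (\<integral>y. \<bar>v y\<bar> \<partial>lborel)) * \<bar>f x\<bar>"])
  have fi: "integrable lborel f" by (rule integrable_compact_support[OF f])
  have [measurable]: "f \<in> borel_measurable borel" using f(1) by (rule borel_measurable_continuous_onI)
  have [measurable]: "velo e 0 v \<in> borel_measurable borel"
    by (rule borel_measurable_continuous_onI[OF continuous_velo0[OF e v]])
  have [measurable]: "velo e (1 / real (Suc n)) v \<in> borel_measurable borel" for n
    using pd_velo(1)[OF e _ v(1), of "1 / real (Suc n)"] by (auto simp: pd1_def intro: borel_measurable_continuous_onI)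
  show "(\<lambda>x. velo e 0 v x * f x) \<in> borel_measurable lborel" by simp
  show "(\<lambda>x. velo e (1 / real (Suc n)) v x * f x) \<in> borel_measurable lborel" for n by measurable
  show "integrable lborel (\<lambda>x. (2 * sing_mass * B + (\<integral>y. \<bar>v y\<bar> \<partial>lborel)) * \<bar>f x\<bar>)"
    using fi by simp
  show "AE x in lborel. (\<lambda>n. velo e (1 / real (Suc n)) v x * f x) \<longlonglongrightarrow> velo e 0 v x * f x"
    by (intro AE_I2 tendsto_intros velo_tendsto[OF e v])
  show "AE x in lborel. norm (velo e (1 / real (Suc n)) v x * f x) \<le>
      (2 * sing_mass * B + (\<integral>y. \<bar>v y\<bar> \<partial>lborel)) * \<bar>f x\<bar>" for n
    unfolding real_norm_def abs_mult by (intro AE_I2 mult_right_mono velo_bound_uniform[OF e v]) simp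
qed

text \<open>Weak incompressibility: exact for each regularised velocity, and stable under d -> 0
  because the integrals contain the velocity but none of its derivatives.\<close>

lemma velo_div_free:
  assumes v: "integrable lborel v" "\<And>y. \<bar>v y\<bar> \<le> B"
    and f: "pd1 f f1" "pd2 f f2" "\<And>x. norm x > R \<Longrightarrow> f x = 0"
  shows "(\<integral>x. velo dir1 0 v x * f1 x \<partial>lborel) + (\<integral>x. velo dir2 0 v x * f2 x \<partial>lborel) = 0"
proof (rule LIMSEQ_unique)
  have z: "norm x > R \<Longrightarrow> f1 x = 0" "norm x > R \<Longrightarrow> f2 x = 0" for x
    using pd1_support[OF f(1,3)] pd2_support[OF f(2,3)] by blast+
  have c: "continuous_on UNIV f" "continuous_on UNIV f1" "continuous_on UNIV f2"
    using f by (auto simp: pd1_def pd2_def)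
  show "(\<lambda>n. (\<integral>x. velo dir1 (1 / real (Suc n)) v x * f1 x \<partial>lborel)
      + (\<integral>x. velo dir2 (1 / real (Suc n)) v x * f2 x \<partial>lborel))
      \<longlonglongrightarrow> (\<integral>x. velo dir1 0 v x * f1 x \<partial>lborel) + (\<integral>x. velo dir2 0 v x * f2 x \<partial>lborel)"
    by (intro tendsto_add integral_velo_tendsto[OF _ v, of _ _ R]) (use z c in auto)
  have "(\<integral>x. velo dir1 d v x * f1 x \<partial>lborel) + (\<integral>x. velo dir2 d v x * f2 x \<partial>lborel) = 0" if d: "d > 0" for d
  proof -
    have p: "pd1 (velo dir1 d v) (dvelo1 dir1 d v)" "pd2 (velo dir2 d v) (dvelo2 dir2 d v)"
      using pd_velo[OF norm_dir(1) d v(1)] pd_velo[OF norm_dir(2) d v(1)] by blast+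
    have cd: "continuous_on UNIV (dvelo1 dir1 d v)" "continuous_on UNIV (dvelo2 dir2 d v)"
      using p by (auto simp: pd1_def pd2_def)
    have "(\<integral>x. velo dir1 d v x * f1 x \<partial>lborel) + (\<integral>x. velo dir2 d v x * f2 x \<partial>lborel)
        = - ((\<integral>x. dvelo1 dir1 d v x * f x \<partial>lborel) + (\<integral>x. dvelo2 dir2 d v x * f x \<partial>lborel))"
      using ibp1[OF p(1) f(1,3)] ibp2[OF p(2) f(2,3)] by simp
    also have "(\<integral>x. dvelo1 dir1 d v x * f x \<partial>lborel) + (\<integral>x. dvelo2 dir2 d v x * f x \<partial>lborel)
        = (\<integral>x. (dvelo1 dir1 d v x + dvelo2 dir2 d v x) * f x \<partial>lborel)"
      unfolding distrib_right
      by (intro Bochner_Integration.integral_add[symmetric] integrable_compact_support[of _ R] continuous_intros)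
        (use cd c f in auto)
    finally show ?thesis by (simp add: velo_div[OF d v(1)])
  qed
  then show "(\<lambda>n. (\<integral>x. velo dir1 (1 / real (Suc n)) v x * f1 x \<partial>lborel)
      + (\<integral>x. velo dir2 (1 / real (Suc n)) v x * f2 x \<partial>lborel)) \<longlonglongrightarrow> 0"
    by simp
qed

text \<open>With \<open>v = curl u\<close> and \<open>div u = 0\<close>, the product \<open>v u\<close> is a second-order divergence of
  quadratic terms in \<open>u\<close>, so its pairing with a gradient needs no decay of \<open>v\<close>.\<close>

lemma vorticity_flux_bound:
  assumes v: "integrable lborel v" "\<And>y. \<bar>v y\<bar> \<le> B" "continuous_on UNIV v"
    and V: "\<And>x. \<bar>velo dir1 0 v x\<bar> \<le> V" "\<And>x. \<bar>velo dir2 0 v x\<bar> \<le> V"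
    and g: "pd1 g g1" "pd2 g g2" "pd1 g1 g11" "pd2 g1 g12" "pd1 g2 g12" "pd2 g2 g22"
    and z: "\<And>x. norm x > R \<Longrightarrow> g x = 0"
  shows "mollifier_mass / pi * \<bar>\<integral>x. v x * (velo dir1 0 v x * g1 x + velo dir2 0 v x * g2 x) \<partial>lborel\<bar>
    \<le> V\<^sup>2 * (\<integral>x. \<bar>g11 x\<bar> + \<bar>g12 x\<bar> + \<bar>g22 x\<bar> \<partial>lborel)"
proof -
  define D where "D = (\<integral>x. \<bar>g11 x\<bar> + \<bar>g12 x\<bar> + \<bar>g22 x\<bar> \<partial>lborel)"
  define om where "om d x = dvelo1 dir2 d v x - dvelo2 dir1 d v x" for d x
  have c: "continuous_on UNIV g1" "continuous_on UNIV g2" "continuous_on UNIV g11"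
    "continuous_on UNIV g12" "continuous_on UNIV g22"
    using g by (auto simp: pd1_def pd2_def)
  have z1: "norm x > R \<Longrightarrow> g1 x = 0" "norm x > R \<Longrightarrow> g2 x = 0" for x
    using pd1_support[OF g(1) z] pd2_support[OF g(2) z] by blast+
  have z2: "norm x > R \<Longrightarrow> g11 x = 0" "norm x > R \<Longrightarrow> g12 x = 0" "norm x > R \<Longrightarrow> g22 x = 0" for x
    using pd1_support[OF g(3) z1(1)] pd2_support[OF g(4) z1(1)] pd2_support[OF g(6) z1(2)] by blast+
  have B: "0 \<le> B" using v(2)[of undefined] by linarith
  have V0: "0 \<le> V" using V(1)[of undefined] by linarith
  \<comment> \<open>For d > 0 the velocity (a, b) is continuously differentiable with b1 - a2 =
    \<open>om\<close> and b2 = -a1, so the flux can be rewritten classically; the limit d -> 0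
    follows at the end.\<close>
  have reg: "\<bar>\<integral>x. om d x * (velo dir1 d v x * g1 x + velo dir2 d v x * g2 x) \<partial>lborel\<bar>
      \<le> (V + d * sing_mass * B)\<^sup>2 * D" if d: "d > 0" for d
  proof -
    define a where "a = velo dir1 d v"
    define b where "b = velo dir2 d v"
    define a1 where "a1 = dvelo1 dir1 d v"
    define a2 where "a2 = dvelo2 dir1 d v"
    define b1 where "b1 = dvelo1 dir2 d v"
    define b2 where "b2 = dvelo2 dir2 d v"
    have p: "pd1 a a1" "pd2 a a2" "pd1 b b1" "pd2 b b2"
      unfolding a_def b_def a1_def a2_def b1_def b2_def 
      using pd_velo[OF norm_dir(1) d v(1)] pd_velo[OF norm_dir(2) d v(1)] by blast+
    have ca: "continuous_on UNIV a" "continuous_on UNIV b" "continuous_on UNIV a1" "continuous_on UNIV a2"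
        "continuous_on UNIV b1" "continuous_on UNIV b2"
      using p by (auto simp: pd1_def pd2_def)
    have div: "b2 x = - a1 x" for x
      using velo_div[OF d v(1), of x] by (simp add: a1_def b2_def)
    have om: "om d x = b1 x - a2 x" for x by (simp add: om_def b1_def a2_def)
    let ?V = "V + d * sing_mass * B"
    have ab: "\<bar>a x\<bar> \<le> ?V" "\<bar>b x\<bar> \<le> ?V" for x
      unfolding a_def b_def 
      by (rule velo_bound_pos[OF norm_dir(1) d v(1,2) V(1)], rule velo_bound_pos[OF norm_dir(2) d v(1,2) V(2)])
    \<comment> \<open>(X, Y) is the trace-free part of u \<otimes> u contracted with the rotated
      gradient (-g2, g1). Its divergence is the flux \<open>?L\<close> minus \<open>?Q\<close>, and
      \<open>?Q\<close> holds the second derivatives of g but no derivative of u.\<close>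
    let ?X = "\<lambda>x. a x * b x * g1 x + 1/2 * ((b x)\<^sup>2 - (a x)\<^sup>2) * g2 x"
    let ?X1 = "\<lambda>x. (a1 x * b x + a x * b1 x) * g1 x + a x * b x * g11 x
        + (b x * b1 x - a x * a1 x) * g2 x + 1/2 * ((b x)\<^sup>2 - (a x)\<^sup>2) * g12 x"
    let ?Y = "\<lambda>x. 1/2 * ((b x)\<^sup>2 - (a x)\<^sup>2) * g1 x - a x * b x * g2 x"
    let ?Y2 = "\<lambda>x. (b x * b2 x - a x * a2 x) * g1 x + 1/2 * ((b x)\<^sup>2 - (a x)\<^sup>2) * g12 x
        - (a2 x * b x + a x * b2 x) * g2 x - a x * b x * g22 x"
    let ?Q = "\<lambda>x. ((a x)\<^sup>2 - (b x)\<^sup>2) * g12 x + a x * b x * (g22 x - g11 x)"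
    let ?L = "\<lambda>x. om d x * (a x * g1 x + b x * g2 x)"
    have "pd1 ?X ?X1"
      unfolding pd1_def
    proof (intro conjI allI)
      show "continuous_on UNIV ?X" "continuous_on UNIV ?X1" using ca c by (auto intro!: continuous_intros)
      fix x1 x2
      have "((\<lambda>s. a (s, x2)) has_real_derivative a1 (x1, x2)) (at x1)"
        "((\<lambda>s. b (s, x2)) has_real_derivative b1 (x1, x2)) (at x1)"
        "((\<lambda>s. g1 (s, x2)) has_real_derivative g11 (x1, x2)) (at x1)"
        "((\<lambda>s. g2 (s, x2)) has_real_derivative g12 (x1, x2)) (at x1)"
        using p g by (auto simp: pd1_def)
      note [derivative_intros] = this
      show "((\<lambda>s. ?X (s, x2)) has_real_derivative ?X1 (x1, x2)) (at x1)"
        by (rule derivative_eq_intros refl)+ (simp add: algebra_simps)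
    qed
    then have X: "(\<integral>x. ?X1 x \<partial>lborel) = 0" by (rule integral_pd1_zero[of _ _ R]) (simp add: z1)
    have "pd2 ?Y ?Y2"
      unfolding pd2_def
    proof (intro conjI allI)
      show "continuous_on UNIV ?Y" "continuous_on UNIV ?Y2" using ca c by (auto intro!: continuous_intros)
      fix x1 x2
      have "((\<lambda>s. a (x1, s)) has_real_derivative a2 (x1, x2)) (at x2)"
        "((\<lambda>s. b (x1, s)) has_real_derivative b2 (x1, x2)) (at x2)"
        "((\<lambda>s. g1 (x1, s)) has_real_derivative g12 (x1, x2)) (at x2)"
        "((\<lambda>s. g2 (x1, s)) has_real_derivative g22 (x1, x2)) (at x2)"
        using p g by (auto simp: pd2_def)
      note [derivative_intros] = this
      show "((\<lambda>s. ?Y (x1, s)) has_real_derivative ?Y2 (x1, x2)) (at x2)"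
        by (rule derivative_eq_intros refl)+ (simp add: algebra_simps)
    qed
    then have Y: "(\<integral>x. ?Y2 x \<partial>lborel) = 0" by (rule integral_pd2_zero[of _ _ R]) (simp add: z1)
    have iX: "integrable lborel ?X1" and iY: "integrable lborel ?Y2" and iQ: "integrable lborel ?Q"
      by (rule integrable_compact_support[of _ R]; use ca c z1 z2 in \<open>auto intro!: continuous_intros\<close>)+
    have "?L x = ?Q x + (?X1 x + ?Y2 x)" for x
      unfolding om div by (simp add: algebra_simps power2_eq_square)
    then have "(\<integral>x. ?L x \<partial>lborel) = (\<integral>x. ?Q x + (?X1 x + ?Y2 x) \<partial>lborel)" by presburger
    also have "\<dots> = (\<integral>x. ?Q x \<partial>lborel) + ((\<integral>x. ?X1 x \<partial>lborel) + (\<integral>x. ?Y2 x \<partial>lborel))"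
      unfolding Bochner_Integration.integral_add[OF iQ Bochner_Integration.integrable_add[OF iX iY]]
        Bochner_Integration.integral_add[OF iX iY] ..
    also have "\<dots> = (\<integral>x. ?Q x \<partial>lborel)" unfolding X Y by simp
    finally have LQ: "(\<integral>x. ?L x \<partial>lborel) = (\<integral>x. ?Q x \<partial>lborel)" .
    have "\<bar>\<integral>x. ?Q x \<partial>lborel\<bar> \<le> (\<integral>x. ?V\<^sup>2 * (\<bar>g11 x\<bar> + \<bar>g12 x\<bar> + \<bar>g22 x\<bar>) \<partial>lborel)"
    proof (rule Bochner_Integration.integral_abs_bound_integral[OF iQ])
      show "integrable lborel (\<lambda>x. ?V\<^sup>2 * (\<bar>g11 x\<bar> + \<bar>g12 x\<bar> + \<bar>g22 x\<bar>))"
        by (rule integrable_compact_support[of _ R]; use c z2 in \<open>auto intro!: continuous_intros\<close>)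
      fix x
      have "(a x)\<^sup>2 \<le> ?V\<^sup>2" "(b x)\<^sup>2 \<le> ?V\<^sup>2" 
        by (rule power_mono[OF ab(1)[of x], of 2, simplified power2_abs], simp,
            rule power_mono[OF ab(2)[of x], of 2, simplified power2_abs], simp)
      then have "\<bar>(a x)\<^sup>2 - (b x)\<^sup>2\<bar> \<le> ?V\<^sup>2" using zero_le_power2[of "a x"] zero_le_power2[of "b x"] by linarith
      then have 1: "\<bar>((a x)\<^sup>2 - (b x)\<^sup>2) * g12 x\<bar> \<le> ?V\<^sup>2 * \<bar>g12 x\<bar>"
        unfolding abs_mult by (rule mult_right_mono) simp
      have "\<bar>a x\<bar> * \<bar>b x\<bar> \<le> ?V * ?V" using ab[of x] by (intro mult_mono) auto
      then have "\<bar>a x * b x * (g22 x - g11 x)\<bar> \<le> ?V\<^sup>2 * \<bar>g22 x - g11 x\<bar>"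
        unfolding abs_mult power2_eq_square by (rule mult_right_mono) simp
      also have "\<dots> \<le> ?V\<^sup>2 * (\<bar>g11 x\<bar> + \<bar>g22 x\<bar>)"
        by (intro mult_left_mono) auto
      finally have 2: "\<bar>a x * b x * (g22 x - g11 x)\<bar> \<le> ?V\<^sup>2 * (\<bar>g11 x\<bar> + \<bar>g22 x\<bar>)" .
      have "\<bar>?Q x\<bar> \<le> ?V\<^sup>2 * \<bar>g12 x\<bar> + ?V\<^sup>2 * (\<bar>g11 x\<bar> + \<bar>g22 x\<bar>)"
        by (rule order_trans[OF abs_triangle_ineq add_mono[OF 1 2]])
      then show "\<bar>?Q x\<bar> \<le> ?V\<^sup>2 * (\<bar>g11 x\<bar> + \<bar>g12 x\<bar> + \<bar>g22 x\<bar>)"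
        by (simp add: distrib_left)
    qed
    then have "\<bar>\<integral>x. ?L x \<partial>lborel\<bar> \<le> (\<integral>x. ?V\<^sup>2 * (\<bar>g11 x\<bar> + \<bar>g12 x\<bar> + \<bar>g22 x\<bar>) \<partial>lborel)"
      unfolding LQ .
    then show ?thesis unfolding Bochner_Integration.integral_mult_right_zero D_def a_def b_def .
  qed
  have [measurable]: "v \<in> borel_measurable borel" using v(3) by (rule borel_measurable_continuous_onI)
  let ?r = "\<lambda>n. 1 / real (Suc n)"
  define K where "K = 2 * sing_mass * B + (\<integral>y. \<bar>v y\<bar> \<partial>lborel)"
  let ?F = "\<lambda>n x. om (?r n) x * (velo dir1 (?r n) v x * g1 x + velo dir2 (?r n) v x * g2 x)"
  let ?H = "\<lambda>x. mollifier_mass / pi * (v x * (velo dir1 0 v x * g1 x + velo dir2 0 v x * g2 x))"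
  have c0: "continuous_on UNIV (velo dir1 0 v)" "continuous_on UNIV (velo dir2 0 v)"
    by (intro continuous_velo0[OF _ v(1,2)]; simp)+
  have F: "(\<lambda>n. \<integral>x. ?F n x \<partial>lborel) \<longlonglongrightarrow> (\<integral>x. ?H x \<partial>lborel)"
  proof (rule integral_dominated_convergence[where w = "\<lambda>x. mollifier_mass * B * (K * (\<bar>g1 x\<bar> + \<bar>g2 x\<bar>))"])
    show "?H \<in> borel_measurable lborel"
      unfolding measurable_lborel2 by (intro borel_measurable_continuous_onI) (auto intro!: continuous_intros v c0 c)
    have "continuous_on UNIV (velo dir1 (?r n) v)" "continuous_on UNIV (velo dir2 (?r n) v)"
      "continuous_on UNIV (dvelo1 dir2 (?r n) v)" "continuous_on UNIV (dvelo2 dir1 (?r n) v)" for n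
      using pd_velo[OF _ _ v(1), of dir1 "?r n"] pd_velo[OF _ _ v(1), of dir2 "?r n"]
      by (auto simp: pd1_def pd2_def)
    then show "?F n \<in> borel_measurable lborel" for n
      unfolding om_def measurable_lborel2 by (intro borel_measurable_continuous_onI) (auto intro!: continuous_intros v c)
    show "integrable lborel (\<lambda>x. mollifier_mass * B * (K * (\<bar>g1 x\<bar> + \<bar>g2 x\<bar>)))"
      by (rule integrable_compact_support[of _ R]; use c z1 in \<open>auto intro!: continuous_intros\<close>)
    show "AE x in lborel. (\<lambda>n. ?F n x) \<longlonglongrightarrow> ?H x"
    proof (rule AE_I2)
      fix x
      have "?r \<longlonglongrightarrow> 0" by (intro LIMSEQ_Suc lim_1_over_n)
      then have "(\<lambda>n. (1 / pi) * (\<integral>z. mollifier z * v (x - ?r n *\<^sub>R z) \<partial>lborel)) \<longlonglongrightarrow> (1 / pi) * (mollifier_mass * v x)"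
        by (intro tendsto_mult_left mollified_vorticity_tendsto[OF v(3,2)])
      then have "(\<lambda>n. om (?r n) x) \<longlonglongrightarrow> (1 / pi) * (mollifier_mass * v x)"
        unfolding om_def using velo_curl[OF _ v(1)] by simp
      then have "(\<lambda>n. ?F n x) \<longlonglongrightarrow> (1 / pi) * (mollifier_mass * v x) * (velo dir1 0 v x * g1 x + velo dir2 0 v x * g2 x)"
        by (intro tendsto_intros velo_tendsto[OF _ v(1,2)]) auto
      then show "(\<lambda>n. ?F n x) \<longlonglongrightarrow> ?H x" by (simp add: mult_ac)
    qed
    show "AE x in lborel. norm (?F n x) \<le> mollifier_mass * B * (K * (\<bar>g1 x\<bar> + \<bar>g2 x\<bar>))" for n
    proof (rule AE_I2)
      fix x
      have mb: "\<bar>\<integral>z. mollifier z * v (x - ?r n *\<^sub>R z) \<partial>lborel\<bar> \<le> mollifier_mass * B"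
        using v(2) by (intro mollified_vorticity_bound) auto
      have pi_le: "\<bar>(1 / pi) * c\<bar> \<le> \<bar>c\<bar>" for c :: real
      proof -
        have "\<bar>(1 / pi) * c\<bar> = (1 / pi) * \<bar>c\<bar>" by (simp add: abs_mult)
        also have "\<dots> \<le> 1 * \<bar>c\<bar>" using pi_gt3 by (intro mult_right_mono) auto
        finally show ?thesis by simp
      qed
      have 1: "\<bar>om (?r n) x\<bar> \<le> mollifier_mass * B"
      proof -
        have "om (?r n) x = (1 / pi) * (\<integral>z. mollifier z * v (x - ?r n *\<^sub>R z) \<partial>lborel)"
          unfolding om_def by (rule velo_curl[OF _ v(1)]) simp
        then show ?thesis using order_trans[OF pi_le mb] by presburger
      qed
      have "\<bar>velo dir1 (?r n) v x * g1 x\<bar> \<le> K * \<bar>g1 x\<bar>" "\<bar>velo dir2 (?r n) v x * g2 x\<bar> \<le> K * \<bar>g2 x\<bar>"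
        unfolding abs_mult K_def by (intro mult_right_mono velo_bound_uniform[OF _ v(1,2)]; simp)+
      then have 2: "\<bar>velo dir1 (?r n) v x * g1 x + velo dir2 (?r n) v x * g2 x\<bar> \<le> K * (\<bar>g1 x\<bar> + \<bar>g2 x\<bar>)"
        unfolding distrib_left by (rule order_trans[OF abs_triangle_ineq add_mono])
      show "norm (?F n x) \<le> mollifier_mass * B * (K * (\<bar>g1 x\<bar> + \<bar>g2 x\<bar>))"
        unfolding real_norm_def abs_mult[of "om _ _"]
        by (rule mult_mono[OF 1 2]) (use B mollifier_mass_pos in auto)
    qed
  qed
  have lim: "(\<lambda>n. (V + ?r n * sing_mass * B)\<^sup>2 * D) \<longlonglongrightarrow> (V + 0 * sing_mass * B)\<^sup>2 * D"
    by (intro tendsto_intros LIMSEQ_Suc lim_1_over_n)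
  have "(\<lambda>n. \<bar>\<integral>x. ?F n x \<partial>lborel\<bar>) \<longlonglongrightarrow> \<bar>\<integral>x. ?H x \<partial>lborel\<bar>"
    using F by (intro tendsto_intros)
  then have "\<bar>\<integral>x. ?H x \<partial>lborel\<bar> \<le> (V + 0 * sing_mass * B)\<^sup>2 * D"
    by (rule LIMSEQ_le[OF _ lim]) (intro exI[of _ 0] allI impI reg, simp)
  then show ?thesis using mollifier_mass_pos by (simp add: D_def abs_mult)
qed

section \<open>Compactly supported test functions\<close>

text \<open>A cutoff in the variable \<rho> = |x|^2. The third power is the least integer power
  giving two continuous derivatives; \<open>bump1\<close> and \<open>bump2\<close> are
  these.\<close>

definition bump :: "real \<Rightarrow> real \<Rightarrow> real" where "bump R \<rho> = (max 0 (1 - \<rho> / R\<^sup>2)) ^ 3"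
definition bump1 :: "real \<Rightarrow> real \<Rightarrow> real" where "bump1 R \<rho> = - (3 / R\<^sup>2) * (max 0 (1 - \<rho> / R\<^sup>2))\<^sup>2"
definition bump2 :: "real \<Rightarrow> real \<Rightarrow> real" where "bump2 R \<rho> = 6 / (R\<^sup>2)\<^sup>2 * max 0 (1 - \<rho> / R\<^sup>2)"

lemma has_real_derivative_max_power:
  assumes "n > 0"
  shows "((\<lambda>y::real. (max 0 y) ^ Suc n) has_real_derivative real (Suc n) * (max 0 y) ^ n) (at y)"
proof -
  consider "y > 0" | "y < 0" | "y = 0" by linarith
  then show ?thesis
  proof cases
    case 1
    have "((\<lambda>y. y ^ Suc n) has_real_derivative real (Suc n) * y ^ n) (at y)"
      using DERIV_pow[of "Suc n" y] by simp
    then have "((\<lambda>y. (max 0 y) ^ Suc n) has_real_derivative real (Suc n) * y ^ n) (at y)"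
      by (rule has_field_derivative_transform_within_open[where S = "{0<..}"]) (use 1 in auto)
    then show ?thesis using 1 by simp
  next
    case 2
    have "((\<lambda>y. (max 0 y) ^ Suc n) has_real_derivative 0) (at y)"
      by (rule has_field_derivative_transform_within_open[where f = "\<lambda>_. 0" and S = "{..<0}"]) (use 2 in auto)
    then show ?thesis using 2 assms by (simp add: zero_power)
  next
    case 3
    \<comment> \<open>At the kink the difference quotient is at most the n-th power of max 0 h,
      which tends to 0 as n > 0.\<close>
    have "((\<lambda>h::real. (max 0 h) ^ n) \<longlongrightarrow> (max 0 0) ^ n) (at 0)"
      by (intro tendsto_intros)
    then have "((\<lambda>h::real. (max 0 h) ^ n) \<longlongrightarrow> 0) (at 0)" using assms by (simp add: power_0_left)
    moreover have "\<forall>\<^sub>F h in at (0::real). norm ((max 0 h) ^ Suc n / h) \<le> (max 0 h) ^ n"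
      by (intro always_eventually allI) (auto simp: max_def power_0_left)
    ultimately have "((\<lambda>h::real. (max 0 h) ^ Suc n / h) \<longlongrightarrow> 0) (at 0)"
      by (rule Lim_null_comparison[rotated])
    then show ?thesis using 3 assms by (simp add: DERIV_def zero_power)
  qed
qed

lemma has_real_derivative_bump:
  "(bump R has_real_derivative bump1 R \<rho>) (at \<rho>)" "(bump1 R has_real_derivative bump2 R \<rho>) (at \<rho>)"
proof -
  have l: "((\<lambda>\<rho>. 1 - \<rho> / R\<^sup>2) has_real_derivative - (1 / R\<^sup>2)) (at \<rho>)"
    using DERIV_diff[OF DERIV_const DERIV_cdivide[OF DERIV_ident]] by simp
  have "((\<lambda>\<rho>. (max 0 (1 - \<rho> / R\<^sup>2)) ^ 3) has_real_derivative 3 * (max 0 (1 - \<rho> / R\<^sup>2))\<^sup>2 * - (1 / R\<^sup>2)) (at \<rho>)"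
    using DERIV_chain2[OF has_real_derivative_max_power[of 2] l] by (simp add: numeral_3_eq_3)
  then show "(bump R has_real_derivative bump1 R \<rho>) (at \<rho>)"
    unfolding bump_def[abs_def] bump1_def by (rule DERIV_cong) simp
  have "((\<lambda>\<rho>. (max 0 (1 - \<rho> / R\<^sup>2)) ^ 2) has_real_derivative 2 * (max 0 (1 - \<rho> / R\<^sup>2)) * - (1 / R\<^sup>2)) (at \<rho>)"
    using DERIV_chain2[OF has_real_derivative_max_power[of 1] l] by (simp add: numeral_2_eq_2)
  from DERIV_cmult[OF this, of "- (3 / R\<^sup>2)"]
  show "(bump1 R has_real_derivative bump2 R \<rho>) (at \<rho>)"
    unfolding bump1_def[abs_def] bump2_def by (rule DERIV_cong) (simp add: power2_eq_square[of "R\<^sup>2"])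
qed

lemma continuous_on_bump: "continuous_on A (bump R)" "continuous_on A (bump1 R)" "continuous_on A (bump2 R)"
  unfolding bump_def[abs_def] bump1_def[abs_def] bump2_def[abs_def] divide_inverse
  by (intro continuous_intros)+

lemma bump_zero:
  assumes "R > 0" "\<rho> \<ge> R\<^sup>2" shows "bump R \<rho> = 0" "bump1 R \<rho> = 0" "bump2 R \<rho> = 0"
  using assms by (simp_all add: bump_def bump1_def bump2_def max_def divide_simps)

lemma bump_bounds:
  assumes "R > 0" "\<rho> \<ge> 0"
  shows "0 \<le> bump R \<rho>" "bump R \<rho> \<le> 1" "\<bar>bump1 R \<rho>\<bar> \<le> 3 / R\<^sup>2" "\<bar>bump2 R \<rho>\<bar> \<le> 6 / (R\<^sup>2)\<^sup>2"
proof -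
  have m: "0 \<le> max 0 (1 - \<rho> / R\<^sup>2)" "max 0 (1 - \<rho> / R\<^sup>2) \<le> 1" using assms by auto
  show "0 \<le> bump R \<rho>" "bump R \<rho> \<le> 1" unfolding bump_def using m by (auto intro: power_le_one simp del: max.bounded_iff)
  have "\<bar>bump1 R \<rho>\<bar> = 3 / R\<^sup>2 * (max 0 (1 - \<rho> / R\<^sup>2))\<^sup>2" by (simp add: bump1_def abs_mult)
  also have "\<dots> \<le> 3 / R\<^sup>2 * 1" by (intro mult_left_mono power_le_one m) auto
  finally show "\<bar>bump1 R \<rho>\<bar> \<le> 3 / R\<^sup>2" by simp
  have "\<bar>bump2 R \<rho>\<bar> = 6 / (R\<^sup>2)\<^sup>2 * max 0 (1 - \<rho> / R\<^sup>2)" by (simp add: bump2_def abs_mult)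
  also have "\<dots> \<le> 6 / (R\<^sup>2)\<^sup>2 * 1" by (intro mult_left_mono m) auto
  finally show "\<bar>bump2 R \<rho>\<bar> \<le> 6 / (R\<^sup>2)\<^sup>2" by simp
qed

lemma bump_tendsto: "(\<lambda>n. bump (real (Suc n)) \<rho>) \<longlonglongrightarrow> 1"
proof -
  have "(\<lambda>n. 1 - \<rho> * (1 / real (Suc n))\<^sup>2) \<longlonglongrightarrow> 1 - \<rho> * 0\<^sup>2"
    by (intro tendsto_intros LIMSEQ_Suc lim_1_over_n)
  then have "(\<lambda>n. (max 0 (1 - \<rho> * (1 / real (Suc n))\<^sup>2)) ^ 3) \<longlonglongrightarrow> (max 0 (1 - \<rho> * 0\<^sup>2)) ^ 3"
    by (rule tendsto_power[OF tendsto_max[OF tendsto_const]])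
  then show ?thesis by (simp add: bump_def power_divide)
qed

section \<open>Translates, radial functions and their partial derivatives\<close>

lemma pd_shift:
  "pd1 f f1 \<Longrightarrow> pd1 (\<lambda>y. f (y - x)) (\<lambda>y. f1 (y - x))"
  "pd2 f f2 \<Longrightarrow> pd2 (\<lambda>y. f (y - x)) (\<lambda>y. f2 (y - x))"
proof -
  have c: "continuous_on UNIV h \<Longrightarrow> continuous_on UNIV (\<lambda>y. h (y - x))" for h :: "real \<times> real \<Rightarrow> real"
    by (rule continuous_on_compose2[of UNIV h]) (auto intro!: continuous_intros)
  have s: "((\<lambda>s. s - a) has_real_derivative 1) (at b)" for a b :: real
    by (auto intro!: derivative_eq_intros)
  show "pd1 (\<lambda>y. f (y - x)) (\<lambda>y. f1 (y - x))" if "pd1 f f1"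
    unfolding pd1_def
  proof (intro conjI allI)
    fix x1 x2
    have "((\<lambda>s. f (s, x2 - snd x)) has_real_derivative f1 (x1 - fst x, x2 - snd x)) (at (x1 - fst x))"
      using that by (simp add: pd1_def)
    from DERIV_chain2[OF this s]
    show "((\<lambda>s. f ((s, x2) - x)) has_real_derivative f1 ((x1, x2) - x)) (at x1)"
      by (simp add: minus_prod_def)
  qed (use that c in \<open>auto simp: pd1_def\<close>)
  show "pd2 (\<lambda>y. f (y - x)) (\<lambda>y. f2 (y - x))" if "pd2 f f2"
    unfolding pd2_def
  proof (intro conjI allI)
    fix x1 x2
    have "((\<lambda>s. f (x1 - fst x, s)) has_real_derivative f2 (x1 - fst x, x2 - snd x)) (at (x2 - snd x))"
      using that by (simp add: pd2_def)
    from DERIV_chain2[OF this s]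
    show "((\<lambda>s. f ((x1, s) - x)) has_real_derivative f2 ((x1, x2) - x)) (at x2)"
      by (simp add: minus_prod_def)
  qed (use that c in \<open>auto simp: pd2_def\<close>)
qed

text \<open>With |z|^2 instead of |z| as variable the chain rule produces only polynomial factors,
  and the origin is not exceptional.\<close>

lemma pd_radial:
  assumes "\<And>\<rho>. \<rho> \<ge> 0 \<Longrightarrow> (h has_real_derivative h1 \<rho>) (at \<rho>)" "continuous_on {0..} h1"
  shows "pd1 (\<lambda>z. h ((norm z)\<^sup>2)) (\<lambda>z. 2 * fst z * h1 ((norm z)\<^sup>2))"
    "pd2 (\<lambda>z. h ((norm z)\<^sup>2)) (\<lambda>z. 2 * snd z * h1 ((norm z)\<^sup>2))"
proof -
  have c: "continuous_on {0..} h"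
    using assms(1) by (intro continuous_at_imp_continuous_on ballI DERIV_isCont) auto
  have cc: "continuous_on {0..} k \<Longrightarrow> continuous_on UNIV (\<lambda>z::real\<times>real. k ((norm z)\<^sup>2))" for k :: "real \<Rightarrow> real"
    by (rule continuous_on_compose2[of "{0..}" k]) (auto intro!: continuous_intros)
  have s: "((\<lambda>s. s\<^sup>2 + b\<^sup>2) has_real_derivative 2 * a) (at a)"
    "((\<lambda>s. b\<^sup>2 + s\<^sup>2) has_real_derivative 2 * a) (at a)" for a b :: real
    by (auto intro!: derivative_eq_intros)
  show "pd1 (\<lambda>z. h ((norm z)\<^sup>2)) (\<lambda>z. 2 * fst z * h1 ((norm z)\<^sup>2))"
    unfolding pd1_def
  proof (intro conjI allI)
    fix x1 x2 :: real
    show "((\<lambda>s. h ((norm (s, x2))\<^sup>2)) has_real_derivative 2 * fst (x1, x2) * h1 ((norm (x1, x2))\<^sup>2)) (at x1)"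
      unfolding norm_pair_sq fst_conv snd_conv
      by (rule DERIV_cong[OF DERIV_chain2[OF assms(1) s(1)]]) auto
  qed (intro continuous_intros cc c assms(2))+
  show "pd2 (\<lambda>z. h ((norm z)\<^sup>2)) (\<lambda>z. 2 * snd z * h1 ((norm z)\<^sup>2))"
    unfolding pd2_def
  proof (intro conjI allI)
    fix x1 x2 :: real
    show "((\<lambda>s. h ((norm (x1, s))\<^sup>2)) has_real_derivative 2 * snd (x1, x2) * h1 ((norm (x1, x2))\<^sup>2)) (at x2)"
      unfolding norm_pair_sq fst_conv snd_conv
      by (rule DERIV_cong[OF DERIV_chain2[OF assms(1) s(2)]]) auto
  qed (intro continuous_intros cc c assms(2))+
qed

lemma pd_linear: "pd1 (\<lambda>z. e \<bullet> z) (\<lambda>z. fst e)" "pd2 (\<lambda>z. e \<bullet> z) (\<lambda>z. snd e)"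
  "pd1 fst (\<lambda>z. 1)" "pd1 snd (\<lambda>z. 0)" "pd2 fst (\<lambda>z. 0)" "pd2 snd (\<lambda>z. 1)"
  "pd1 (\<lambda>z. c) (\<lambda>z. 0)" "pd2 (\<lambda>z. c) (\<lambda>z. 0)"
  by (auto simp: pd1_def pd2_def inner_prod_def intro!: continuous_intros derivative_eq_intros)

lemma pd1_add: "pd1 f f1 \<Longrightarrow> pd1 g g1 \<Longrightarrow> pd1 (\<lambda>x. f x + g x) (\<lambda>x. f1 x + g1 x)"
  unfolding pd1_def by (auto intro!: continuous_intros derivative_eq_intros)

lemma pd2_add: "pd2 f f1 \<Longrightarrow> pd2 g g1 \<Longrightarrow> pd2 (\<lambda>x. f x + g x) (\<lambda>x. f1 x + g1 x)"
  unfolding pd2_def by (auto intro!: continuous_intros derivative_eq_intros)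

lemma pd1_cong: "pd1 f f1 \<Longrightarrow> (\<And>x. f1 x = g1 x) \<Longrightarrow> pd1 f g1"
  using ext[of f1 g1] by simp

lemma pd2_cong: "pd2 f f1 \<Longrightarrow> (\<And>x. f1 x = g1 x) \<Longrightarrow> pd2 f g1"
  using ext[of f1 g1] by simp

lemma pd_radial2:
  assumes h: "\<And>\<rho>. \<rho> \<ge> 0 \<Longrightarrow> (h has_real_derivative h1 \<rho>) (at \<rho>)"
    "\<And>\<rho>. \<rho> \<ge> 0 \<Longrightarrow> (h1 has_real_derivative h2 \<rho>) (at \<rho>)" "continuous_on {0..} h2"
  shows "pd1 (\<lambda>z. 2 * fst z * h1 ((norm z)\<^sup>2)) (\<lambda>z. 2 * h1 ((norm z)\<^sup>2) + 4 * (fst z)\<^sup>2 * h2 ((norm z)\<^sup>2))"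
    "pd2 (\<lambda>z. 2 * snd z * h1 ((norm z)\<^sup>2)) (\<lambda>z. 2 * h1 ((norm z)\<^sup>2) + 4 * (snd z)\<^sup>2 * h2 ((norm z)\<^sup>2))"
  by (rule pd1_cong[OF pd1_mult[OF pd1_cmult[OF pd_linear(3)] pd_radial(1)[OF h(2,3)]]],
      simp, simp add: power2_eq_square,
      rule pd2_cong[OF pd2_mult[OF pd2_cmult[OF pd_linear(6)] pd_radial(2)[OF h(2,3)]]],
      simp, simp add: power2_eq_square)

text \<open>Meant for h(\<rho>) = \<open>bump R\<close> \<rho> / (\<rho> + \<epsilon>^2), which
  yields the truncated kernel. The mixed derivative is one and the same function in both orders, as
  \<open>vorticity_flux_bound\<close> demands.\<close>

lemma pd_linear_radial:
  fixes e :: "real \<times> real"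
  assumes h: "\<And>\<rho>. \<rho> \<ge> 0 \<Longrightarrow> (h has_real_derivative h1 \<rho>) (at \<rho>)"
    "\<And>\<rho>. \<rho> \<ge> 0 \<Longrightarrow> (h1 has_real_derivative h2 \<rho>) (at \<rho>)" "continuous_on {0..} h2"
  defines "g1 \<equiv> \<lambda>z. fst e * h ((norm z)\<^sup>2) + (e \<bullet> z) * (2 * fst z * h1 ((norm z)\<^sup>2))"
    and "g2 \<equiv> \<lambda>z. snd e * h ((norm z)\<^sup>2) + (e \<bullet> z) * (2 * snd z * h1 ((norm z)\<^sup>2))"
    and "g11 \<equiv> \<lambda>z. (4 * (fst e * fst z) + 2 * (e \<bullet> z)) * h1 ((norm z)\<^sup>2) + 4 * ((e \<bullet> z) * (fst z * fst z)) * h2 ((norm z)\<^sup>2)"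
    and "g12 \<equiv> \<lambda>z. (2 * (fst e * snd z) + 2 * (snd e * fst z)) * h1 ((norm z)\<^sup>2) + 4 * ((e \<bullet> z) * (fst z * snd z)) * h2 ((norm z)\<^sup>2)"
    and "g22 \<equiv> \<lambda>z. (4 * (snd e * snd z) + 2 * (e \<bullet> z)) * h1 ((norm z)\<^sup>2) + 4 * ((e \<bullet> z) * (snd z * snd z)) * h2 ((norm z)\<^sup>2)"
  shows "pd1 (\<lambda>z. (e \<bullet> z) * h ((norm z)\<^sup>2)) g1" "pd2 (\<lambda>z. (e \<bullet> z) * h ((norm z)\<^sup>2)) g2"
    "pd1 g1 g11" "pd2 g1 g12" "pd1 g2 g12" "pd2 g2 g22"
proof -
  have c1: "continuous_on {0..} h1"
    using h(2) by (intro continuous_at_imp_continuous_on ballI DERIV_isCont) auto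
  note r = pd_radial[of h h1, OF h(1) c1] and r1 = pd_radial[of h1 h2, OF h(2,3)] and r2 = pd_radial2[of h h1 h2, OF h]
  show "pd1 (\<lambda>z. (e \<bullet> z) * h ((norm z)\<^sup>2)) g1" "pd2 (\<lambda>z. (e \<bullet> z) * h ((norm z)\<^sup>2)) g2"
    unfolding g1_def g2_def by (rule pd1_mult[OF pd_linear(1) r(1)] pd2_mult[OF pd_linear(2) r(2)]; simp)+
  show "pd1 g1 g11" unfolding g1_def g11_def
    by (rule pd1_cong[OF pd1_add[OF pd1_cmult[OF r(1)] pd1_mult[OF pd_linear(1) r2(1)]]])
      (simp_all add: algebra_simps power2_eq_square)
  show "pd2 g2 g22" unfolding g2_def g22_def
    by (rule pd2_cong[OF pd2_add[OF pd2_cmult[OF r(2)] pd2_mult[OF pd_linear(2) r2(2)]]])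
      (simp_all add: algebra_simps power2_eq_square)
  show "pd2 g1 g12" unfolding g1_def g12_def
    by (rule pd2_cong[OF pd2_add[OF pd2_cmult[OF r(2)] pd2_mult[OF pd_linear(2) pd2_mult[OF pd2_cmult[OF pd_linear(5)] r1(2)]]]])
      (simp_all add: algebra_simps power2_eq_square)
  show "pd1 g2 g12" unfolding g2_def g12_def
    by (rule pd1_cong[OF pd1_add[OF pd1_cmult[OF r(1)] pd1_mult[OF pd_linear(1) pd1_mult[OF pd1_cmult[OF pd_linear(4)] r1(1)]]]])
      (simp_all add: algebra_simps power2_eq_square)
qed

section \<open>Second derivatives of the truncated kernel\<close>

lemma regularized_profile_bounds:
  assumes r: "0 < r" "r < R" and eps: "0 < \<epsilon>" "\<epsilon> \<le> R"
  defines "q \<equiv> r\<^sup>2 + \<epsilon>\<^sup>2" and "m \<equiv> bump R (r\<^sup>2)" and "m1 \<equiv> bump1 R (r\<^sup>2)" and "m2 \<equiv> bump2 R (r\<^sup>2)"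
  shows "r * \<bar>- (1 / q\<^sup>2) * m + 1 / q * m1\<bar> \<le> 7 / (r * q)"
    and "r ^ 3 * \<bar>2 / q ^ 3 * m - 2 * (1 / q\<^sup>2 * m1) + 1 / q * m2\<bar> \<le> 38 / (r * q)"
proof -
  have R: "R > 0" using r by simp
  have q: "0 < q" "r\<^sup>2 \<le> q" unfolding q_def using r eps by (auto simp: add_pos_pos)
  have rR: "r\<^sup>2 \<le> R\<^sup>2" "\<epsilon>\<^sup>2 \<le> R\<^sup>2" using r eps by (auto intro: power_mono)
  \<comment> \<open>Consequence of \<epsilon> <= R and r < R: inverse powers of R from the cutoff
    can be traded for inverse powers of q, and R disappears from the bounds.\<close>
  then have q2: "q \<le> 2 * R\<^sup>2" by (simp add: q_def)
  have iR: "1 / R\<^sup>2 \<le> 2 / q" using q q2 R by (simp add: divide_simps)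
  have iR': "1 / (R\<^sup>2)\<^sup>2 \<le> 4 / q\<^sup>2"
    using power_mono[OF iR, of 2] by (simp add: power_divide)
  note cb = bump_bounds[OF R zero_le_power2, of r, folded m_def m1_def m2_def]
  have m: "\<bar>m\<bar> \<le> 1" using cb by simp
  have m1: "\<bar>m1\<bar> \<le> 6 / q" using cb(3) iR by simp
  have m2: "\<bar>m2\<bar> \<le> 24 / q\<^sup>2" using cb(4) iR' by simp
  have "\<bar>- (1 / q\<^sup>2) * m + 1 / q * m1\<bar> \<le> \<bar>- (1 / q\<^sup>2) * m\<bar> + \<bar>1 / q * m1\<bar>"
    by (rule abs_triangle_ineq)
  also have "\<dots> = 1 / q\<^sup>2 * \<bar>m\<bar> + 1 / q * \<bar>m1\<bar>" using q by (simp add: abs_mult)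
  also have "\<dots> \<le> 1 / q\<^sup>2 * 1 + 1 / q * (6 / q)"
    using q by (intro add_mono mult_left_mono m m1) auto
  \<comment> \<open>1 from differentiating 1/q, 6 from differentiating the cutoff.\<close>
  also have "\<dots> = 7 / q\<^sup>2" by (simp add: power2_eq_square)
  finally have 1: "\<bar>- (1 / q\<^sup>2) * m + 1 / q * m1\<bar> \<le> 7 / q\<^sup>2" .
  have "\<bar>2 / q ^ 3 * m - 2 * (1 / q\<^sup>2 * m1) + 1 / q * m2\<bar>
      \<le> \<bar>2 / q ^ 3 * m\<bar> + \<bar>2 * (1 / q\<^sup>2 * m1)\<bar> + \<bar>1 / q * m2\<bar>"
    by linarith
  also have "\<dots> = 2 / q ^ 3 * \<bar>m\<bar> + 2 * (1 / q\<^sup>2 * \<bar>m1\<bar>) + 1 / q * \<bar>m2\<bar>" using q by (simp add: abs_mult)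
  also have "\<dots> \<le> 2 / q ^ 3 * 1 + 2 * (1 / q\<^sup>2 * (6 / q)) + 1 / q * (24 / q\<^sup>2)"
    using q by (intro add_mono mult_left_mono m m1 m2) auto
  \<comment> \<open>2 + 12 + 24: both derivatives on 1/q, one on each factor, both on the
    cutoff.\<close>
  also have "\<dots> = 38 / q ^ 3" by (simp add: power2_eq_square power3_eq_cube)
  finally have 2: "\<bar>2 / q ^ 3 * m - 2 * (1 / q\<^sup>2 * m1) + 1 / q * m2\<bar> \<le> 38 / q ^ 3" .
  have a1: "r / q\<^sup>2 \<le> 1 / (r * q)"
  proof -
    have "r * (r * q) \<le> q * q" using q by (simp add: power2_eq_square mult_right_mono flip: mult.assoc)
    then show ?thesis using q r by (simp add: divide_simps power2_eq_square)
  qed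
  have a2: "r ^ 3 / q ^ 3 \<le> 1 / (r * q)"
  proof -
    have "r\<^sup>2 * r\<^sup>2 \<le> q * q" using q by (intro mult_mono) auto
    then have "r ^ 3 * (r * q) \<le> q ^ 3"
      using q mult_right_mono[of "r\<^sup>2 * r\<^sup>2" "q * q" q] by (simp add: power2_eq_square power3_eq_cube mult_ac)
    then show ?thesis using q r by (simp add: divide_simps)
  qed
  have "r * \<bar>- (1 / q\<^sup>2) * m + 1 / q * m1\<bar> \<le> r * (7 / q\<^sup>2)" using r 1 by (intro mult_left_mono) auto
  then show "r * \<bar>- (1 / q\<^sup>2) * m + 1 / q * m1\<bar> \<le> 7 / (r * q)" using mult_left_mono[OF a1, of 7] by (simp add: mult.commute[of r 7])
  have "r ^ 3 * \<bar>2 / q ^ 3 * m - 2 * (1 / q\<^sup>2 * m1) + 1 / q * m2\<bar> \<le> r ^ 3 * (38 / q ^ 3)"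
    using r 2 by (intro mult_left_mono) auto
  then show "r ^ 3 * \<bar>2 / q ^ 3 * m - 2 * (1 / q\<^sup>2 * m1) + 1 / q * m2\<bar> \<le> 38 / (r * q)" using mult_left_mono[OF a2, of 38] by (simp add: mult.commute[of "r ^ 3" 38])
qed

text \<open>194 = 6 * 7 + 4 * 38. Here l is linear in z and comes from the factor multiplying the
  radial profile, p is a cubic monomial, and s stands for \<open>sing \<epsilon> z\<close>.\<close>

lemma second_derivative_bound:
  fixes z e :: "real \<times> real"
  assumes e: "norm e \<le> 1"
    and h: "norm z * \<bar>h1\<bar> \<le> 7 * s" "norm z ^ 3 * \<bar>h2\<bar> \<le> 38 * s"
    and l: "\<bar>l\<bar> \<le> 6 * norm z" and p: "\<bar>p\<bar> \<le> norm z ^ 3"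
  shows "\<bar>l * h1 + 4 * p * h2\<bar> \<le> 194 * s"
proof -
  have "\<bar>l\<bar> * \<bar>h1\<bar> \<le> 6 * norm z * \<bar>h1\<bar>" "\<bar>p\<bar> * \<bar>h2\<bar> \<le> norm z ^ 3 * \<bar>h2\<bar>"
    by (intro mult_right_mono l p; simp)+
  moreover have "\<bar>l * h1 + 4 * p * h2\<bar> \<le> \<bar>l\<bar> * \<bar>h1\<bar> + 4 * (\<bar>p\<bar> * \<bar>h2\<bar>)"
    by (rule order_trans[OF abs_triangle_ineq]) (simp add: abs_mult mult.assoc)
  ultimately show ?thesis using h by simp
qed

text \<open>The bounds do not involve R, so the truncation can be removed afterwards, and by
  \<open>integral_sing\<close> they have mass of order 1/\<epsilon>.\<close>

lemma truncated_kernel: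
  fixes e :: "real \<times> real"
  assumes e: "norm e \<le> 1" and eps: "0 < \<epsilon>" "\<epsilon> \<le> R"
  obtains g1 g2 g11 g12 g22 where
    "pd1 (\<lambda>z. kern e \<epsilon> z * bump R ((norm z)\<^sup>2)) g1" "pd2 (\<lambda>z. kern e \<epsilon> z * bump R ((norm z)\<^sup>2)) g2"
    "pd1 g1 g11" "pd2 g1 g12" "pd1 g2 g12" "pd2 g2 g22"
    "\<And>z. \<bar>g11 z\<bar> \<le> 194 * sing \<epsilon> z" "\<And>z. \<bar>g12 z\<bar> \<le> 194 * sing \<epsilon> z" "\<And>z. \<bar>g22 z\<bar> \<le> 194 * sing \<epsilon> z"
proof -
  have R: "R > 0" using eps by simp
  define h where "h \<rho> = 1 / (\<rho> + \<epsilon>\<^sup>2) * bump R \<rho>" for \<rho>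
  define h1 where "h1 \<rho> = - (1 / (\<rho> + \<epsilon>\<^sup>2)\<^sup>2) * bump R \<rho> + 1 / (\<rho> + \<epsilon>\<^sup>2) * bump1 R \<rho>" for \<rho>
  define h2 where "h2 \<rho> = 2 / (\<rho> + \<epsilon>\<^sup>2) ^ 3 * bump R \<rho> - 2 * (1 / (\<rho> + \<epsilon>\<^sup>2)\<^sup>2 * bump1 R \<rho>)
      + 1 / (\<rho> + \<epsilon>\<^sup>2) * bump2 R \<rho>" for \<rho>
  have d1: "(h has_real_derivative h1 \<rho>) (at \<rho>)" if "\<rho> \<ge> 0" for \<rho>
  proof -
    have ne: "\<rho> + \<epsilon>\<^sup>2 \<noteq> 0" using that eps by (simp add: add_nonneg_pos less_imp_neq[symmetric])
    have "((\<lambda>\<rho>. 1 / (\<rho> + \<epsilon>\<^sup>2)) has_real_derivative - (1 / (\<rho> + \<epsilon>\<^sup>2)\<^sup>2)) (at \<rho>)"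
      using ne by (auto intro!: derivative_eq_intros simp: power2_eq_square)
    from DERIV_mult[OF this has_real_derivative_bump(1)[of R \<rho>]] show ?thesis
      unfolding h_def[abs_def] h1_def by (rule DERIV_cong) simp
  qed
  have d2: "(h1 has_real_derivative h2 \<rho>) (at \<rho>)" if "\<rho> \<ge> 0" for \<rho>
  proof -
    have ne: "\<rho> + \<epsilon>\<^sup>2 \<noteq> 0" using that eps by (simp add: add_nonneg_pos less_imp_neq[symmetric])
    have A: "((\<lambda>\<rho>. 1 / (\<rho> + \<epsilon>\<^sup>2)) has_real_derivative - (1 / (\<rho> + \<epsilon>\<^sup>2)\<^sup>2)) (at \<rho>)"
      using ne by (auto intro!: derivative_eq_intros simp: power2_eq_square)
    have "((\<lambda>\<rho>. - ((1 / (\<rho> + \<epsilon>\<^sup>2))\<^sup>2)) has_real_derivative - (2 * (1 / (\<rho> + \<epsilon>\<^sup>2)) * - (1 / (\<rho> + \<epsilon>\<^sup>2)\<^sup>2))) (at \<rho>)"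
      using DERIV_minus[OF DERIV_power[OF A, of 2]] by (rule DERIV_cong) simp
    then have B: "((\<lambda>\<rho>. - (1 / (\<rho> + \<epsilon>\<^sup>2)\<^sup>2)) has_real_derivative 2 / (\<rho> + \<epsilon>\<^sup>2) ^ 3) (at \<rho>)"
      unfolding power_divide power_one by (rule DERIV_cong) (simp add: power2_eq_square power3_eq_cube)
    from DERIV_add[OF DERIV_mult[OF B has_real_derivative_bump(1)[of R \<rho>]]
        DERIV_mult[OF A has_real_derivative_bump(2)[of R \<rho>]]] show ?thesis
      unfolding h1_def[abs_def] h2_def by (rule DERIV_cong) simp
  qed
  have c2: "continuous_on {0..} h2"
    unfolding h2_def[abs_def] using eps
    by (intro continuous_intros continuous_on_bump ballI power_not_zero) (auto simp: add_nonneg_pos less_imp_neq[symmetric])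
  have g: "kern e \<epsilon> z * bump R ((norm z)\<^sup>2) = (e \<bullet> z) * h ((norm z)\<^sup>2)" for z
    by (simp add: kern_def h_def)
  note pd = pd_linear_radial[of h h1 h2 e, OF d1 d2 c2]
  have b: "norm z * \<bar>h1 ((norm z)\<^sup>2)\<bar> \<le> 7 * sing \<epsilon> z" "norm z ^ 3 * \<bar>h2 ((norm z)\<^sup>2)\<bar> \<le> 38 * sing \<epsilon> z" for z :: "real \<times> real"
  proof -
    consider "z = 0" | "norm z \<ge> R" | "0 < norm z" "norm z < R" by force
    then have "norm z * \<bar>h1 ((norm z)\<^sup>2)\<bar> \<le> 7 * sing \<epsilon> z \<and> norm z ^ 3 * \<bar>h2 ((norm z)\<^sup>2)\<bar> \<le> 38 * sing \<epsilon> z"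
    proof cases
      case 2
      then have "(norm z)\<^sup>2 \<ge> R\<^sup>2" using R by (intro power_mono) auto
      then show ?thesis using bump_zero[OF R] sing_nonneg by (simp add: h1_def h2_def)
    next
      case 3
      show ?thesis using regularized_profile_bounds[OF 3 eps]
        by (simp add: h1_def h2_def sing_def)
    qed auto
    then show "norm z * \<bar>h1 ((norm z)\<^sup>2)\<bar> \<le> 7 * sing \<epsilon> z" "norm z ^ 3 * \<bar>h2 ((norm z)\<^sup>2)\<bar> \<le> 38 * sing \<epsilon> z"
      by auto
  qed
  have ez: "\<bar>e \<bullet> z\<bar> \<le> norm z" for z
    using Cauchy_Schwarz_ineq2[of e z] mult_right_mono[OF e, of "norm z"] by simp
  have e1: "\<bar>a * b\<bar> \<le> norm z" if "\<bar>a\<bar> \<le> 1" "\<bar>b\<bar> \<le> norm z" for a b :: real and z :: "real \<times> real"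
    using mult_mono[OF that] by (simp add: abs_mult)
  have ec: "\<bar>fst e\<bar> \<le> 1" "\<bar>snd e\<bar> \<le> 1"
    using order_trans[OF abs_fst_le_norm e] order_trans[OF abs_snd_le_norm e] by auto
  have p3: "\<bar>a * (b * c)\<bar> \<le> norm z ^ 3" if "\<bar>a\<bar> \<le> norm z" "\<bar>b\<bar> \<le> norm z" "\<bar>c\<bar> \<le> norm z" for a b c :: real and z :: "real \<times> real"
    unfolding abs_mult power3_eq_cube mult.assoc using that by (intro mult_mono) auto
  note el = e1[OF ec(1) abs_fst_le_norm] e1[OF ec(1) abs_snd_le_norm] e1[OF ec(2) abs_fst_le_norm] e1[OF ec(2) abs_snd_le_norm]
  have B1: "\<bar>(4 * (fst e * fst z) + 2 * (e \<bullet> z)) * h1 ((norm z)\<^sup>2) + 4 * ((e \<bullet> z) * (fst z * fst z)) * h2 ((norm z)\<^sup>2)\<bar> \<le> 194 * sing \<epsilon> z" for z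
    by (rule second_derivative_bound[OF e b _ p3[OF ez abs_fst_le_norm abs_fst_le_norm]]) (use el[of z] ez[of z] in linarith)
  have B2: "\<bar>(2 * (fst e * snd z) + 2 * (snd e * fst z)) * h1 ((norm z)\<^sup>2) + 4 * ((e \<bullet> z) * (fst z * snd z)) * h2 ((norm z)\<^sup>2)\<bar> \<le> 194 * sing \<epsilon> z" for z
    by (rule second_derivative_bound[OF e b _ p3[OF ez abs_fst_le_norm abs_snd_le_norm]]) (use el[of z] ez[of z] in linarith)
  have B3: "\<bar>(4 * (snd e * snd z) + 2 * (e \<bullet> z)) * h1 ((norm z)\<^sup>2) + 4 * ((e \<bullet> z) * (snd z * snd z)) * h2 ((norm z)\<^sup>2)\<bar> \<le> 194 * sing \<epsilon> z" for z
    by (rule second_derivative_bound[OF e b _ p3[OF ez abs_snd_le_norm abs_snd_le_norm]]) (use el[of z] ez[of z] in linarith)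
  show thesis by (rule that[unfolded g, OF pd B1 B2 B3])
qed

section \<open>The vorticity equation\<close>

lemma continuous_slice:
  fixes F :: "real \<times> real \<Rightarrow> real \<Rightarrow> real"
  assumes "continuous_on (UNIV \<times> {0<..}) (\<lambda>p. F (fst p) (snd p))" "t > 0"
  shows "continuous_on UNIV (\<lambda>x. F x t)"
proof -
  have "continuous_on UNIV (\<lambda>x::real\<times>real. (x, t))" by (intro continuous_intros)
  then show ?thesis using continuous_on_compose2[OF assms(1), of UNIV "\<lambda>x. (x, t)"] assms(2) by auto
qed

text \<open>The common compact support and continuity of the time derivative give a constant
  dominating function for times between t/2 and 2t.\<close>

lemma has_real_derivative_integral_time:
  fixes F Ft :: "real \<times> real \<Rightarrow> real \<Rightarrow> real"
  assumes c: "continuous_on (UNIV \<times> {0<..}) (\<lambda>p. F (fst p) (snd p))"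
      "continuous_on (UNIV \<times> {0<..}) (\<lambda>p. Ft (fst p) (snd p))"
    and d: "\<And>x t. t > 0 \<Longrightarrow> ((\<lambda>s. F x s) has_real_derivative Ft x t) (at t)"
    and z: "\<And>x t. t > 0 \<Longrightarrow> norm x > R \<Longrightarrow> F x t = 0" and t: "t > 0"
  shows "((\<lambda>s. \<integral>x. F x s \<partial>lborel) has_real_derivative (\<integral>x. Ft x t \<partial>lborel)) (at t)"
proof -
  have z': "Ft x s = 0" if s: "s > 0" and x: "norm x > R" for x s
  proof -
    have "((\<lambda>s. F x s) has_real_derivative 0) (at s)"
      by (rule has_field_derivative_transform_within_open[where f = "\<lambda>_. 0" and S = "{0<..}"])
        (use s x z in auto)
    then show ?thesis using d[OF s, of x] DERIV_unique by blast
  qed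
  have "compact (cball (0 :: real \<times> real) R \<times> {t/2..2*t})" by (intro compact_Times) auto
  then have "compact ((\<lambda>p. Ft (fst p) (snd p)) ` (cball 0 R \<times> {t/2..2*t}))"
    by (rule compact_continuous_image[rotated]) (rule continuous_on_subset[OF c(2)], use t in auto)
  from compact_imp_bounded[OF this]
  obtain K where K: "\<And>p. p \<in> cball 0 R \<times> {t/2..2*t} \<Longrightarrow> \<bar>Ft (fst p) (snd p)\<bar> \<le> K"
    unfolding bounded_iff real_norm_def by blast
  show ?thesis
  proof (rule has_real_derivative_integral[where a = "t/2" and b = "2*t" and f = "\<lambda>s x. F x s" and f' = "\<lambda>s x. Ft x s"
        and g = "\<lambda>x. K * indicator (cball 0 R) x"])
    show "integrable lborel (\<lambda>x. F x s)" if "t/2 < s" "s < 2*t" for s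
      using t that by (intro integrable_compact_support[of _ R] continuous_slice[OF c(1)] z) auto
    show "\<bar>Ft x s\<bar> \<le> K * indicator (cball 0 R) x" if "t/2 < s" "s < 2*t" for s x
      using K[of "(x, s)"] z'[of s x] that t by (auto simp: indicator_def not_le)
    show "integrable lborel (\<lambda>x::real\<times>real. K * indicator (cball 0 R) x)"
      by (intro integrable_mult_right integrable_real_indicator) (use emeasure_bounded_finite[OF bounded_cball] in simp_all)
    show "(\<lambda>x. Ft x t) \<in> borel_measurable lborel"
      unfolding measurable_lborel2 by (rule borel_measurable_continuous_onI[OF continuous_slice[OF c(2) t]])
  qed (use t d in auto)
qed

text \<open>A classical solution for all positive times whose sup bound \<open>B\<close> is only
  claimed up to \<open>T\<close>. No bound on the velocity is assumed, and the L^1 norm is finite at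
  each time without any uniformity.\<close>

locale vorticity_flow =
  fixes nu B T :: real and w w1 w2 w11 w22 wt :: "real \<times> real \<Rightarrow> real \<Rightarrow> real"
  assumes nu: "nu > 0"
    and integrable_w: "\<And>t. t > 0 \<Longrightarrow> integrable lborel (\<lambda>x. w x t)"
    and bounded_w: "\<And>t x. 0 < t \<Longrightarrow> t \<le> T \<Longrightarrow> \<bar>w x t\<bar> \<le> B"
    and cont: "continuous_on (UNIV \<times> {0<..}) (\<lambda>p. w (fst p) (snd p))"
      "continuous_on (UNIV \<times> {0<..}) (\<lambda>p. w1 (fst p) (snd p))"
      "continuous_on (UNIV \<times> {0<..}) (\<lambda>p. w2 (fst p) (snd p))"
      "continuous_on (UNIV \<times> {0<..}) (\<lambda>p. w11 (fst p) (snd p))"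
      "continuous_on (UNIV \<times> {0<..}) (\<lambda>p. w22 (fst p) (snd p))"
      "continuous_on (UNIV \<times> {0<..}) (\<lambda>p. wt (fst p) (snd p))"
    and deriv: "\<And>x1 x2 t. t > 0 \<Longrightarrow> ((\<lambda>s. w (s, x2) t) has_real_derivative w1 (x1, x2) t) (at x1)"
      "\<And>x1 x2 t. t > 0 \<Longrightarrow> ((\<lambda>s. w (x1, s) t) has_real_derivative w2 (x1, x2) t) (at x2)"
      "\<And>x1 x2 t. t > 0 \<Longrightarrow> ((\<lambda>s. w1 (s, x2) t) has_real_derivative w11 (x1, x2) t) (at x1)"
      "\<And>x1 x2 t. t > 0 \<Longrightarrow> ((\<lambda>s. w2 (x1, s) t) has_real_derivative w22 (x1, x2) t) (at x2)"
      "\<And>x t. t > 0 \<Longrightarrow> ((\<lambda>s. w x s) has_real_derivative wt x t) (at t)"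
    and pde: "\<And>x t. t > 0 \<Longrightarrow> wt x t = nu * (w11 x t + w22 x t)
        - (velo dir1 0 (\<lambda>y. w y t) x * w1 x t + velo dir2 0 (\<lambda>y. w y t) x * w2 x t)"
begin

abbreviation u :: "real \<times> real \<Rightarrow> real \<Rightarrow> real \<times> real \<Rightarrow> real" where
  "u e t x \<equiv> velo e 0 (\<lambda>y. w y t) x"

lemma pd_w:
  assumes "t > 0"
  shows "pd1 (\<lambda>x. w x t) (\<lambda>x. w1 x t)" "pd2 (\<lambda>x. w x t) (\<lambda>x. w2 x t)"
    "pd1 (\<lambda>x. w1 x t) (\<lambda>x. w11 x t)" "pd2 (\<lambda>x. w2 x t) (\<lambda>x. w22 x t)"
  using cont[THEN continuous_slice, OF assms] deriv[OF assms] by (simp_all add: pd1_def pd2_def)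

lemma continuous_w: "t > 0 \<Longrightarrow> continuous_on UNIV (\<lambda>x. w x t)"
  using cont(1) by (rule continuous_slice)

lemma continuous_u:
  assumes "norm e \<le> 1" "0 < t" "t \<le> T" shows "continuous_on UNIV (u e t)"
  by (rule continuous_velo0[OF assms(1) integrable_w[OF assms(2)] bounded_w[OF assms(2,3)]])

lemma B_nonneg: "0 < T \<Longrightarrow> 0 \<le> B"
  using bounded_w[of T undefined] by linarith

text \<open>Two integrations by parts move the Laplacian onto g. As u has no derivatives at hand,
  transport is moved by \<open>velo_div_free\<close> applied to the product w g.\<close>

lemma weak_vorticity_equation:
  assumes g: "pd1 g g1" "pd2 g g2" "pd1 g1 g11" "pd2 g2 g22"
    and z: "\<And>x. norm x > R \<Longrightarrow> g x = 0" and t: "0 < t" "t \<le> T"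
  shows "((\<lambda>s. \<integral>x. g x * w x s \<partial>lborel) has_real_derivative
      nu * (\<integral>x. w x t * (g11 x + g22 x) \<partial>lborel)
      + (\<integral>x. w x t * (u dir1 t x * g1 x + u dir2 t x * g2 x) \<partial>lborel)) (at t)"
proof -
  note p = pd_w[OF t(1)]
  have c: "continuous_on UNIV g" "continuous_on UNIV g1" "continuous_on UNIV g2" "continuous_on UNIV g11" "continuous_on UNIV g22"
    using g by (auto simp: pd1_def pd2_def)
  have cw: "continuous_on UNIV (\<lambda>x. w x t)" "continuous_on UNIV (\<lambda>x. w1 x t)" "continuous_on UNIV (\<lambda>x. w2 x t)"
    "continuous_on UNIV (\<lambda>x. w11 x t)" "continuous_on UNIV (\<lambda>x. w22 x t)"
    using p by (auto simp: pd1_def pd2_def)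
  have cu: "continuous_on UNIV (u dir1 t)" "continuous_on UNIV (u dir2 t)"
    by (intro continuous_u t; simp)+
  have z1: "norm x > R \<Longrightarrow> g1 x = 0" "norm x > R \<Longrightarrow> g2 x = 0" for x
    using pd1_support[OF g(1) z] pd2_support[OF g(2) z] by blast+
  have z2: "norm x > R \<Longrightarrow> g11 x = 0" "norm x > R \<Longrightarrow> g22 x = 0" for x
    using pd1_support[OF g(3) z1(1)] pd2_support[OF g(4) z1(2)] by blast+
  have cg: "continuous_on (UNIV \<times> {0<..}) (\<lambda>p::(real\<times>real)\<times>real. g (fst p))"
    by (rule continuous_on_compose2[OF c(1)]) (auto intro!: continuous_intros)
  have D: "((\<lambda>s. \<integral>x. g x * w x s \<partial>lborel) has_real_derivative (\<integral>x. g x * wt x t \<partial>lborel)) (at t)"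
    by (rule has_real_derivative_integral_time[of "\<lambda>x s. g x * w x s" "\<lambda>x s. g x * wt x s" R])
      (use cont cg deriv(5) z t in \<open>auto intro!: continuous_intros derivative_eq_intros\<close>)
  have i: "integrable lborel (\<lambda>x. h x * k x)"
    if "continuous_on UNIV h" "continuous_on UNIV k" "\<And>x. norm x > R \<Longrightarrow> k x = 0" for h k :: "real \<times> real \<Rightarrow> real"
    using that by (intro integrable_compact_support[of _ R] continuous_intros) auto
  have d1: "(\<integral>x. w11 x t * g x \<partial>lborel) = (\<integral>x. w x t * g11 x \<partial>lborel)"
    using ibp1[OF p(3) g(1) z] ibp1[OF p(1) g(3) z1(1)] by simp
  have d2: "(\<integral>x. w22 x t * g x \<partial>lborel) = (\<integral>x. w x t * g22 x \<partial>lborel)"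
    using ibp2[OF p(4) g(2) z] ibp2[OF p(2) g(4) z1(2)] by simp
  have E1: "(\<integral>x. u dir1 t x * (w1 x t * g x + w x t * g1 x) \<partial>lborel)
      + (\<integral>x. u dir2 t x * (w2 x t * g x + w x t * g2 x) \<partial>lborel) = 0"
    by (rule velo_div_free[OF integrable_w[OF t(1)] bounded_w[OF t] pd1_mult[OF p(1) g(1)] pd2_mult[OF p(2) g(2)], of R])
      (use z in auto)
  have E2: "(\<integral>x. u dir1 t x * (w1 x t * g x + w x t * g1 x) \<partial>lborel)
      = (\<integral>x. (u dir1 t x * w1 x t) * g x \<partial>lborel) + (\<integral>x. (w x t * u dir1 t x) * g1 x \<partial>lborel)"
    by (subst Bochner_Integration.integral_add[symmetric])
      ((intro i continuous_intros cu cw c; simp add: z z1)+, simp add: algebra_simps)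
  have E3: "(\<integral>x. u dir2 t x * (w2 x t * g x + w x t * g2 x) \<partial>lborel)
      = (\<integral>x. (u dir2 t x * w2 x t) * g x \<partial>lborel) + (\<integral>x. (w x t * u dir2 t x) * g2 x \<partial>lborel)"
    by (subst Bochner_Integration.integral_add[symmetric])
      ((intro i continuous_intros cu cw c; simp add: z z1)+, simp add: algebra_simps)
  have E4: "(\<integral>x. g x * wt x t \<partial>lborel) = nu * ((\<integral>x. w11 x t * g x \<partial>lborel) + (\<integral>x. w22 x t * g x \<partial>lborel))
      - ((\<integral>x. (u dir1 t x * w1 x t) * g x \<partial>lborel) + (\<integral>x. (u dir2 t x * w2 x t) * g x \<partial>lborel))"
  proof -
    have "(\<integral>x. g x * wt x t \<partial>lborel) = (\<integral>x. nu * (w11 x t * g x + w22 x t * g x)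
        - ((u dir1 t x * w1 x t) * g x + (u dir2 t x * w2 x t) * g x) \<partial>lborel)"
      by (simp add: pde[OF t(1)] algebra_simps)
    also have "\<dots> = nu * ((\<integral>x. w11 x t * g x \<partial>lborel) + (\<integral>x. w22 x t * g x \<partial>lborel))
      - ((\<integral>x. (u dir1 t x * w1 x t) * g x \<partial>lborel) + (\<integral>x. (u dir2 t x * w2 x t) * g x \<partial>lborel))"
    proof -
      have I: "integrable lborel (\<lambda>x. w11 x t * g x)" "integrable lborel (\<lambda>x. w22 x t * g x)"
        "integrable lborel (\<lambda>x. (u dir1 t x * w1 x t) * g x)" "integrable lborel (\<lambda>x. (u dir2 t x * w2 x t) * g x)"
        by (intro i continuous_intros cu cw c z; simp)+
      show ?thesis
        unfolding Bochner_Integration.integral_diff[OF integrable_mult_right[OF Bochner_Integration.integrable_add[OF I(1,2)]]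
            Bochner_Integration.integrable_add[OF I(3,4)]] Bochner_Integration.integral_mult_right_zero
          Bochner_Integration.integral_add[OF I(1,2)] Bochner_Integration.integral_add[OF I(3,4)] ..
    qed
    finally show ?thesis .
  qed
  have E5: "(\<integral>x. w x t * (g11 x + g22 x) \<partial>lborel) = (\<integral>x. w x t * g11 x \<partial>lborel) + (\<integral>x. w x t * g22 x \<partial>lborel)"
    unfolding distrib_left by (intro Bochner_Integration.integral_add i cw c z2)
  have E6: "(\<integral>x. w x t * (u dir1 t x * g1 x + u dir2 t x * g2 x) \<partial>lborel)
      = (\<integral>x. (w x t * u dir1 t x) * g1 x \<partial>lborel) + (\<integral>x. (w x t * u dir2 t x) * g2 x \<partial>lborel)"
    unfolding distrib_left mult.assoc[symmetric]
    by (intro Bochner_Integration.integral_add i continuous_intros cu cw c z1)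
  have "(\<integral>x. g x * wt x t \<partial>lborel) = nu * (\<integral>x. w x t * (g11 x + g22 x) \<partial>lborel)
      + (\<integral>x. w x t * (u dir1 t x * g1 x + u dir2 t x * g2 x) \<partial>lborel)"
    unfolding E4 E5 E6 d1 d2 using E1 E2 E3 by linarith
  with D show ?thesis by simp
qed

end

text \<open>582 = 3 * 194, for the three second derivatives of the truncated kernel. The summand 1
  pays for diffusion, the other one for the factor that \<open>vorticity_flux_bound\<close> carries
  on its left side.\<close>

definition flux_const :: real where "flux_const = 582 * sing_mass * (1 + pi / mollifier_mass)"

lemma flux_const_nonneg: "0 \<le> flux_const"
  using sing_mass_nonneg mollifier_mass_pos by (simp add: flux_const_def)

lemma kern_odd: "kern e d (x - y) = - kern e d (y - x)"
proof -
  have "e \<bullet> (x - y) = - (e \<bullet> (y - x))" by (simp add: inner_diff_right)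
  then show ?thesis unfolding kern_def norm_minus_commute[of x y] by simp
qed

text \<open>As a function of y - x the kernel, once truncated, becomes a test function in y centred
  at x, as \<open>weak_vorticity_equation\<close> requires.\<close>

lemma velo_reflected: "velo e d v x = - (1 / (2 * pi)) * (\<integral>y. kern e d (y - x) * v y \<partial>lborel)"
  unfolding velo_def kern_odd[of e d x] by simp

section \<open>Time increments of the velocity\<close>

context vorticity_flow
begin

text \<open>The pairing of w with the truncated kernel is differentiable in time. Diffusion
  contributes \<nu> B and the flux V^2, each times the O(1/\<epsilon>) mass of the second
  derivatives; neither R, x nor the L^1 norm of w enters the bound.\<close>

lemma truncated_velocity_increment:
  fixes x :: "real \<times> real"
  assumes st: "0 < s" "s \<le> t" "t \<le> T"
    and V: "\<And>\<tau> x. s \<le> \<tau> \<Longrightarrow> \<tau> \<le> t \<Longrightarrow> \<bar>u dir1 \<tau> x\<bar> \<le> V \<and> \<bar>u dir2 \<tau> x\<bar> \<le> V"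
    and e: "norm e \<le> 1" and eps: "0 < \<epsilon>" "\<epsilon> \<le> R"
  defines "f \<equiv> \<lambda>\<tau>. \<integral>y. (kern e \<epsilon> (y - x) * bump R ((norm (y - x))\<^sup>2)) * w y \<tau> \<partial>lborel"
  shows "\<bar>f t - f s\<bar> \<le> (t - s) * (flux_const / \<epsilon> * (nu * B + V\<^sup>2))"
proof -
  have R: "R > 0" using eps by simp
  have B: "0 \<le> B" using B_nonneg st by linarith
  obtain g1 g2 g11 g12 g22 where
    g: "pd1 (\<lambda>z. kern e \<epsilon> z * bump R ((norm z)\<^sup>2)) g1" "pd2 (\<lambda>z. kern e \<epsilon> z * bump R ((norm z)\<^sup>2)) g2"
      "pd1 g1 g11" "pd2 g1 g12" "pd1 g2 g12" "pd2 g2 g22"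
    and gb: "\<And>z. \<bar>g11 z\<bar> \<le> 194 * sing \<epsilon> z" "\<And>z. \<bar>g12 z\<bar> \<le> 194 * sing \<epsilon> z" "\<And>z. \<bar>g22 z\<bar> \<le> 194 * sing \<epsilon> z"
    using truncated_kernel[OF e eps] by blast
  note G = pd_shift(1)[OF g(1), of x] pd_shift(2)[OF g(2), of x] pd_shift(1)[OF g(3), of x]
    pd_shift(2)[OF g(4), of x] pd_shift(1)[OF g(5), of x] pd_shift(2)[OF g(6), of x]
  let ?g = "\<lambda>y. kern e \<epsilon> (y - x) * bump R ((norm (y - x))\<^sup>2)"
  have z: "?g y = 0" if "norm y > R + norm x" for y
  proof -
    have "R \<le> norm (y - x)" using norm_triangle_ineq2[of y x] that by linarith
    then have "R\<^sup>2 \<le> (norm (y - x))\<^sup>2" using R by (intro power_mono) auto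
    then show ?thesis using bump_zero(1)[OF R] by simp
  qed
  have z1: "norm y > R + norm x \<Longrightarrow> g1 (y - x) = 0" "norm y > R + norm x \<Longrightarrow> g2 (y - x) = 0" for y
    using pd1_support[OF G(1) z] pd2_support[OF G(2) z] by blast+
  have z2: "norm y > R + norm x \<Longrightarrow> g11 (y - x) = 0" "norm y > R + norm x \<Longrightarrow> g12 (y - x) = 0"
      "norm y > R + norm x \<Longrightarrow> g22 (y - x) = 0" for y
    using pd1_support[OF G(3) z1(1)] pd2_support[OF G(4) z1(1)] pd2_support[OF G(6) z1(2)] by blast+
  have c: "continuous_on UNIV (\<lambda>y. g11 (y - x))" "continuous_on UNIV (\<lambda>y. g12 (y - x))" "continuous_on UNIV (\<lambda>y. g22 (y - x))"
    using G by (auto simp: pd1_def pd2_def)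
  have Si: "integrable lborel (\<lambda>y. sing \<epsilon> (y - x))" "(\<integral>y. sing \<epsilon> (y - x) \<partial>lborel) = sing_mass / \<epsilon>"
    using integrable_sing_reflect[OF eps(1), of x] integral_sing_reflect[OF eps(1), of x]
    by (simp_all add: sing_def norm_minus_commute)
  define D where "D = (\<integral>y. \<bar>g11 (y - x)\<bar> + \<bar>g12 (y - x)\<bar> + \<bar>g22 (y - x)\<bar> \<partial>lborel)"
  have D: "D \<le> 582 * sing_mass / \<epsilon>"
  proof -
    have "D \<le> (\<integral>y. 582 * sing \<epsilon> (y - x) \<partial>lborel)"
      unfolding D_def
    proof (rule integral_mono)
      show "integrable lborel (\<lambda>y. \<bar>g11 (y - x)\<bar> + \<bar>g12 (y - x)\<bar> + \<bar>g22 (y - x)\<bar>)"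
        by (rule integrable_compact_support[of _ "R + norm x"]) (use c z2 in \<open>auto intro!: continuous_intros\<close>)
      show "\<bar>g11 (y - x)\<bar> + \<bar>g12 (y - x)\<bar> + \<bar>g22 (y - x)\<bar> \<le> 582 * sing \<epsilon> (y - x)" for y
        using gb[of "y - x"] by linarith
    qed (use Si in simp)
    then show ?thesis using Si by simp
  qed
  define F' where "F' \<tau> = nu * (\<integral>y. w y \<tau> * (g11 (y - x) + g22 (y - x)) \<partial>lborel)
      + (\<integral>y. w y \<tau> * (u dir1 \<tau> y * g1 (y - x) + u dir2 \<tau> y * g2 (y - x)) \<partial>lborel)" for \<tau>
  have d: "(f has_real_derivative F' \<tau>) (at \<tau>)" if "s \<le> \<tau>" "\<tau> \<le> t" for \<tau>
    unfolding f_def F'_def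
    by (rule weak_vorticity_equation[OF G(1,2,3,6) z]) (use that st in auto)
  have b: "\<bar>F' \<tau>\<bar> \<le> flux_const / \<epsilon> * (nu * B + V\<^sup>2)" if \<tau>: "s \<le> \<tau>" "\<tau> \<le> t" for \<tau>
  proof -
    have \<tau>': "0 < \<tau>" "\<tau> \<le> T" using st \<tau> by auto
    have "mollifier_mass / pi * \<bar>\<integral>y. w y \<tau> * (u dir1 \<tau> y * g1 (y - x) + u dir2 \<tau> y * g2 (y - x)) \<partial>lborel\<bar> \<le> V\<^sup>2 * D"
      unfolding D_def
      by (rule vorticity_flux_bound[OF integrable_w[OF \<tau>'(1)] bounded_w[OF \<tau>'] continuous_w[OF \<tau>'(1)] _ _ G z])
        (use V[OF \<tau>] in auto)
    also have "\<dots> \<le> V\<^sup>2 * (582 * sing_mass / \<epsilon>)" using D by (intro mult_left_mono) auto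
    finally have "(pi / mollifier_mass) * (mollifier_mass / pi * \<bar>\<integral>y. w y \<tau> * (u dir1 \<tau> y * g1 (y - x) + u dir2 \<tau> y * g2 (y - x)) \<partial>lborel\<bar>)
        \<le> (pi / mollifier_mass) * (V\<^sup>2 * (582 * sing_mass / \<epsilon>))"
      using mollifier_mass_pos by (intro mult_left_mono) auto
    then have 1: "\<bar>\<integral>y. w y \<tau> * (u dir1 \<tau> y * g1 (y - x) + u dir2 \<tau> y * g2 (y - x)) \<partial>lborel\<bar>
        \<le> (pi / mollifier_mass) * (582 * sing_mass / \<epsilon>) * V\<^sup>2"
      using mollifier_mass_pos by (simp add: mult_ac)
    have "\<bar>\<integral>y. w y \<tau> * (g11 (y - x) + g22 (y - x)) \<partial>lborel\<bar> \<le> (\<integral>y. B * (388 * sing \<epsilon> (y - x)) \<partial>lborel)"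
    proof (rule Bochner_Integration.integral_abs_bound_integral)
      show "integrable lborel (\<lambda>y. w y \<tau> * (g11 (y - x) + g22 (y - x)))"
        by (rule integrable_compact_support[of _ "R + norm x"])
          (use c z2 continuous_w[OF \<tau>'(1)] in \<open>auto intro!: continuous_intros\<close>)
      fix y
      have "\<bar>g11 (y - x) + g22 (y - x)\<bar> \<le> 388 * sing \<epsilon> (y - x)" using gb[of "y - x"] by linarith
      then show "\<bar>w y \<tau> * (g11 (y - x) + g22 (y - x))\<bar> \<le> B * (388 * sing \<epsilon> (y - x))"
        unfolding abs_mult by (intro mult_mono bounded_w[OF \<tau>'] B) auto
    qed (use Si in simp)
    also have "\<dots> = 388 * (B * sing_mass / \<epsilon>)" using Si by simp
    \<comment> \<open>388 = 2 * 194 is enlarged so that one constant serves diffusion and flux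
      alike.\<close>
    also have "\<dots> \<le> 582 * (B * sing_mass / \<epsilon>)" using B sing_mass_nonneg eps by (intro mult_right_mono) auto
    finally have "nu * \<bar>\<integral>y. w y \<tau> * (g11 (y - x) + g22 (y - x)) \<partial>lborel\<bar> \<le> nu * (582 * (B * sing_mass / \<epsilon>))"
      using nu by (intro mult_left_mono) auto
    moreover have "\<bar>F' \<tau>\<bar> \<le> nu * \<bar>\<integral>y. w y \<tau> * (g11 (y - x) + g22 (y - x)) \<partial>lborel\<bar>
        + \<bar>\<integral>y. w y \<tau> * (u dir1 \<tau> y * g1 (y - x) + u dir2 \<tau> y * g2 (y - x)) \<partial>lborel\<bar>"
      unfolding F'_def by (rule order_trans[OF abs_triangle_ineq]) (use nu in \<open>simp add: abs_mult\<close>)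
    ultimately have "\<bar>F' \<tau>\<bar> \<le> nu * (582 * (B * sing_mass / \<epsilon>)) + (pi / mollifier_mass) * (582 * sing_mass / \<epsilon>) * V\<^sup>2"
      using 1 by linarith
    \<comment> \<open>The two nonnegative cross terms are added to complete the product of (1 +
      \<pi> / \<open>mollifier_mass\<close>) and (\<nu> B + V^2).\<close>
    also have "\<dots> \<le> nu * (582 * (B * sing_mass / \<epsilon>)) + (pi / mollifier_mass) * (582 * sing_mass / \<epsilon>) * V\<^sup>2
        + ((pi / mollifier_mass) * (582 * sing_mass / \<epsilon>) * (nu * B) + (582 * sing_mass / \<epsilon>) * V\<^sup>2)"
    proof -
      have "0 \<le> (pi / mollifier_mass) * (582 * sing_mass / \<epsilon>) * (nu * B)" "0 \<le> (582 * sing_mass / \<epsilon>) * V\<^sup>2"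
        using mollifier_mass_pos sing_mass_nonneg eps nu B by auto
      then show ?thesis by linarith
    qed
    also have "\<dots> = flux_const / \<epsilon> * (nu * B + V\<^sup>2)"
      by (simp add: flux_const_def add_divide_distrib algebra_simps)
    finally show ?thesis .
  qed
  have "norm (f t - f s) \<le> flux_const / \<epsilon> * (nu * B + V\<^sup>2) * norm (t - s)"
  proof (rule field_differentiable_bound[where S = "{s..t}" and f' = F'])
    show "(f has_real_derivative F' z) (at z within {s..t})" if "z \<in> {s..t}" for z
      using d[of z] that by (auto intro: has_field_derivative_at_within)
  qed (use b st in auto)
  then show ?thesis using st by (simp add: mult.commute)
qed

text \<open>The truncation is removed by dominated convergence; then the singular kernel is
  exchanged for the regularised one at both end times, each exchange costing \<epsilon>
  \<open>sing_mass\<close> B.\<close>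

lemma velocity_increment:
  assumes st: "0 < s" "s \<le> t" "t \<le> T"
    and V: "\<And>\<tau> x. s \<le> \<tau> \<Longrightarrow> \<tau> \<le> t \<Longrightarrow> \<bar>u dir1 \<tau> x\<bar> \<le> V \<and> \<bar>u dir2 \<tau> x\<bar> \<le> V"
    and e: "norm e \<le> 1" and eps: "0 < \<epsilon>"
  shows "\<bar>u e t x - u e s x\<bar> \<le> 2 * (\<epsilon> * sing_mass * B) + (t - s) * (flux_const / \<epsilon> * (nu * B + V\<^sup>2))"
proof -
  define K where "K = (t - s) * (flux_const / \<epsilon> * (nu * B + V\<^sup>2))"
  define f where "f n \<tau> = (\<integral>y. (kern e \<epsilon> (y - x) * bump (real (Suc n)) ((norm (y - x))\<^sup>2)) * w y \<tau> \<partial>lborel)" for n \<tau>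
  define F where "F \<tau> = (\<integral>y. kern e \<epsilon> (y - x) * w y \<tau> \<partial>lborel)" for \<tau>
  have lim: "(\<lambda>n. f n \<tau>) \<longlonglongrightarrow> F \<tau>" if "0 < \<tau>" for \<tau>
    unfolding f_def F_def
  proof (rule integral_dominated_convergence[where w = "\<lambda>y. (1 / \<epsilon>) * \<bar>w y \<tau>\<bar>"])
    have [measurable]: "(\<lambda>y. w y \<tau>) \<in> borel_measurable borel"
      using integrable_w[OF that] by (auto dest: borel_measurable_integrable)
    have [measurable]: "bump r \<in> borel_measurable borel" for r
      by (rule borel_measurable_continuous_onI[OF continuous_on_bump(1)])
    show "(\<lambda>y. kern e \<epsilon> (y - x) * w y \<tau>) \<in> borel_measurable lborel" by measurable
    show "(\<lambda>y. kern e \<epsilon> (y - x) * bump (real (Suc n)) ((norm (y - x))\<^sup>2) * w y \<tau>) \<in> borel_measurable lborel" for n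
      by measurable
    show "integrable lborel (\<lambda>y. (1 / \<epsilon>) * \<bar>w y \<tau>\<bar>)" using integrable_w[OF that] by simp
    show "AE y in lborel. (\<lambda>n. kern e \<epsilon> (y - x) * bump (real (Suc n)) ((norm (y - x))\<^sup>2) * w y \<tau>)
        \<longlonglongrightarrow> kern e \<epsilon> (y - x) * w y \<tau>"
    proof (rule AE_I2)
      fix y
      have "(\<lambda>n. kern e \<epsilon> (y - x) * bump (real (Suc n)) ((norm (y - x))\<^sup>2) * w y \<tau>)
          \<longlonglongrightarrow> kern e \<epsilon> (y - x) * 1 * w y \<tau>"
        by (intro tendsto_mult tendsto_const bump_tendsto)
      then show "(\<lambda>n. kern e \<epsilon> (y - x) * bump (real (Suc n)) ((norm (y - x))\<^sup>2) * w y \<tau>)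
          \<longlonglongrightarrow> kern e \<epsilon> (y - x) * w y \<tau>" by simp
    qed
    show "AE y in lborel. norm (kern e \<epsilon> (y - x) * bump (real (Suc n)) ((norm (y - x))\<^sup>2) * w y \<tau>) \<le> (1 / \<epsilon>) * \<bar>w y \<tau>\<bar>" for n
    proof (rule AE_I2)
      fix y
      have "\<bar>kern e \<epsilon> (y - x)\<bar> * \<bar>bump (real (Suc n)) ((norm (y - x))\<^sup>2)\<bar> \<le> (1 / \<epsilon>) * 1"
        using bump_bounds(1,2)[of "real (Suc n)" "(norm (y - x))\<^sup>2"] eps
        by (intro mult_mono kern_bound e) auto
      then show "norm (kern e \<epsilon> (y - x) * bump (real (Suc n)) ((norm (y - x))\<^sup>2) * w y \<tau>) \<le> (1 / \<epsilon>) * \<bar>w y \<tau>\<bar>"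
        unfolding real_norm_def abs_mult by (intro mult_right_mono) auto
    qed
  qed
  have "(\<lambda>n. \<bar>f n t - f n s\<bar>) \<longlonglongrightarrow> \<bar>F t - F s\<bar>"
    by (intro tendsto_intros lim) (use st in auto)
  \<comment> \<open>The truncated estimate asks for \<epsilon> <= R, which holds from some index
    on.\<close>
  moreover obtain N where "\<epsilon> \<le> real N" using real_arch_simple by blast
  then have "\<exists>N. \<forall>n\<ge>N. \<bar>f n t - f n s\<bar> \<le> K"
    unfolding f_def K_def
    by (intro exI[of _ N] allI impI truncated_velocity_increment[OF st V e eps]) auto
  ultimately have FF: "\<bar>F t - F s\<bar> \<le> K" by (rule LIMSEQ_le_const2)
  have "\<bar>velo e \<epsilon> (\<lambda>y. w y t) x - velo e \<epsilon> (\<lambda>y. w y s) x\<bar> = \<bar>(1 / (2 * pi)) * (F t - F s)\<bar>"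
    unfolding velo_reflected F_def[symmetric] by (simp add: right_diff_distrib abs_minus_commute)
  also have "\<dots> \<le> K" by (rule two_pi_scale[OF FF])
  finally have 1: "\<bar>velo e \<epsilon> (\<lambda>y. w y t) x - velo e \<epsilon> (\<lambda>y. w y s) x\<bar> \<le> K" .
  have "\<bar>u e \<tau> x - velo e \<epsilon> (\<lambda>y. w y \<tau>) x\<bar> \<le> \<epsilon> * sing_mass * B" if "\<tau> \<in> {s, t}" for \<tau>
    by (rule velo_diff[OF e eps integrable_w bounded_w]) (use that st in auto)
  from 1 this[of s] this[of t] show ?thesis unfolding K_def[symmetric] by fastforce
qed

end

section \<open>Boundedness of the velocity\<close>

text \<open>Baire's argument with nested intervals: were M unbounded on every portion of F, each
  interval would contain a smaller one, centred in F, on all of which M exceeds n. Since M > n holds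
  on whole intervals and not just on F, the common point is contradictory even when it lies outside
  F.\<close>

lemma bounded_on_portion:
  fixes M :: "real \<Rightarrow> real" and F :: "real set"
  assumes lsc: "\<And>t c. a < t \<Longrightarrow> t < b \<Longrightarrow> M t > c \<Longrightarrow> \<exists>\<delta>>0. \<forall>s. \<bar>s - t\<bar> < \<delta> \<longrightarrow> M s > c"
    and p: "p \<in> F" "a < p" "p < b"
  obtains a' b' q N where "a \<le> a'" "b' \<le> b" "q \<in> F" "a' < q" "q < b'"
    "\<And>t. t \<in> F \<Longrightarrow> a' < t \<Longrightarrow> t < b' \<Longrightarrow> M t \<le> N"
proof (rule ccontr)
  note witness = that
  assume "\<not> thesis"
  then have ex: "\<exists>t\<in>F. x < t \<and> t < y \<and> M t > N" if "a \<le> x" "y \<le> b" "q \<in> F" "x < q" "q < y" for x y q N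
    using witness[OF that, of N] by (meson not_le)
  define P where "P n I \<longleftrightarrow> a \<le> fst I \<and> snd I \<le> b \<and> (\<exists>q\<in>F. fst I < q \<and> q < snd I)"
    for n :: nat and I :: "real \<times> real"
  define Q where "Q n I I' \<longleftrightarrow> fst I \<le> fst I' \<and> snd I' \<le> snd I \<and> fst I' \<le> snd I' \<and>
      (\<forall>s\<in>{fst I'..snd I'}. M s > real n)"
    for n :: nat and I I' :: "real \<times> real"
  have "\<exists>f. \<forall>n. P n (f n) \<and> Q n (f n) (f (Suc n))"
  proof (rule dependent_nat_choice)
    show "\<exists>I. P 0 I" using p by (intro exI[of _ "(a, b)"]) (auto simp: P_def)
    fix I n assume "P n I"
    then obtain q where q: "a \<le> fst I" "snd I \<le> b" "q \<in> F" "fst I < q" "q < snd I"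
      by (auto simp: P_def)
    obtain t where t: "t \<in> F" "fst I < t" "t < snd I" "M t > real n"
      using ex[OF q] by blast
    obtain \<delta> where d: "\<delta> > 0" "\<And>s. \<bar>s - t\<bar> < \<delta> \<Longrightarrow> M s > real n"
      using lsc[of t "real n"] t q by auto
    \<comment> \<open>Half of \<delta>, so that the closed interval around t lies in the open
      neighbourhood.\<close>
    define r where "r = min (\<delta> / 2) (min (t - fst I) (snd I - t))"
    have r: "r > 0" "r < \<delta>" "r \<le> t - fst I" "r \<le> snd I - t" using d t by (auto simp: r_def min_def)
    show "\<exists>I'. P (Suc n) I' \<and> Q n I I'"
    proof (intro exI[of _ "(t - r, t + r)"] conjI)
      show "P (Suc n) (t - r, t + r)" using r t q by (auto simp: P_def intro!: bexI[of _ t])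
      show "Q n I (t - r, t + r)" using r d(2) by (auto simp: Q_def)
    qed
  qed
  then obtain f where f: "\<And>n. P n (f n)" "\<And>n. Q n (f n) (f (Suc n))" by blast
  have mono: "incseq (\<lambda>n. fst (f n))" "decseq (\<lambda>n. snd (f n))"
    using f(2) by (auto intro!: incseq_SucI decseq_SucI simp: Q_def)
  have ord: "fst (f n) \<le> snd (f n)" for n using f(1)[of n] by (auto simp: P_def)
  have cross: "fst (f n) \<le> snd (f m)" for n m
    using incseqD[OF mono(1), of n "max n m"] decseqD[OF mono(2), of m "max n m"] ord[of "max n m"] by linarith
  define c where "c = (SUP n. fst (f n))"
  have bdd: "bdd_above (range (\<lambda>n. fst (f n)))" using cross[of _ 0] by (auto intro!: bdd_aboveI)
  have "fst (f n) \<le> c" "c \<le> snd (f n)" for n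
    unfolding c_def by (rule cSUP_upper[OF UNIV_I bdd], rule cSUP_least) (use cross in auto)
  then have "M c > real n" for n using f(2)[of n] by (auto simp: Q_def)
  then show False using reals_Archimedean2[of "M c"] less_asym by blast
qed

context vorticity_flow
begin

definition vel_le :: "real \<Rightarrow> real \<Rightarrow> bool" where
  "vel_le V t \<longleftrightarrow> (\<forall>x. \<bar>u dir1 t x\<bar> \<le> V \<and> \<bar>u dir2 t x\<bar> \<le> V)"

lemma vel_le_mono: "vel_le V t \<Longrightarrow> V \<le> V' \<Longrightarrow> vel_le V' t"
  unfolding vel_le_def by (meson order_trans)

lemma vel_le_mass:
  assumes "0 < t" "t \<le> T" shows "vel_le (sing_mass * B + (\<integral>x. \<bar>w x t\<bar> \<partial>lborel)) t"
  unfolding vel_le_def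
  using velo_bound[OF norm_dir(1) integrable_w[OF assms(1)] bounded_w[OF assms]]
    velo_bound[OF norm_dir(2) integrable_w[OF assms(1)] bounded_w[OF assms]] by blast

text \<open>32 = 4 * 8, the 8 matching the length V / (8 (\<open>sing_mass\<close> B + 1)) used in
  \<open>velocity_increment_half\<close>. The added ones keep the denominator positive. No velocity
  bound occurs, so the step is the same however large the velocity is.\<close>

definition time_step :: real where "time_step = 1 / (32 * (flux_const + 1) * (sing_mass * B + 1))"

lemma time_step_pos: "0 < T \<Longrightarrow> 0 < time_step"
  using B_nonneg flux_const_nonneg sing_mass_nonneg by (simp add: time_step_def add_nonneg_pos)

text \<open>Choosing the regularisation length proportional to the velocity bound \<open>V\<close> makes the
  increment at most \<open>V / 2\<close> plus a constant, which is absorbed.\<close>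

lemma velocity_increment_half:
  assumes st: "0 < s" "s \<le> t" "t \<le> T" "t - s \<le> time_step"
    and V: "\<And>\<tau>. s \<le> \<tau> \<Longrightarrow> \<tau> \<le> t \<Longrightarrow> vel_le V \<tau>" "1 \<le> V" and e: "norm e \<le> 1"
  shows "\<bar>u e t x - u e s x\<bar> \<le> V / 2 + nu * B / 4"
proof -
  have T: "0 < T" using st by linarith
  define b where "b = sing_mass * B"
  define A where "A = flux_const"
  have b: "0 \<le> b" "0 \<le> A" "0 \<le> B" using B_nonneg[OF T] sing_mass_nonneg flux_const_nonneg by (auto simp: b_def A_def)
  \<comment> \<open>The two regularisation errors together are at most V / 4, and dividing by
    \<epsilon> turns the V^2 of the flux into a term linear in V.\<close>
  define \<epsilon> where "\<epsilon> = V / (8 * (b + 1))"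
  have eps: "\<epsilon> > 0" using V b by (simp add: \<epsilon>_def)
  have "\<bar>u e t x - u e s x\<bar> \<le> 2 * (\<epsilon> * sing_mass * B) + (t - s) * (flux_const / \<epsilon> * (nu * B + V\<^sup>2))"
    by (rule velocity_increment[OF st(1-3) _ e eps]) (use V(1)[unfolded vel_le_def] in blast)
  also have "\<epsilon> * sing_mass * B \<le> V / 8"
  proof -
    have "\<epsilon> * sing_mass * B = V / 8 * (b / (b + 1))" using b by (simp add: \<epsilon>_def b_def)
    also have "\<dots> \<le> V / 8 * 1" using V b by (intro mult_left_mono) auto
    finally show ?thesis by simp
  qed
  also have "(t - s) * (flux_const / \<epsilon> * (nu * B + V\<^sup>2)) \<le> time_step * (flux_const / \<epsilon> * (nu * B + V\<^sup>2))"
    using st b nu eps by (intro mult_right_mono) (auto simp: A_def intro!: mult_nonneg_nonneg divide_nonneg_nonneg add_nonneg_nonneg)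
  also have "\<dots> = (A / (A + 1)) * ((nu * B + V\<^sup>2) / V) / 4"
  proof -
    have "1 / (32 * a * c) * (A / (V / (8 * c)) * X) = A / a * (X / V) / 4" if "a \<noteq> 0" "c \<noteq> 0" "V \<noteq> 0" for a c X :: real
      using that by (simp add: field_simps)
    from this[of "A + 1" "b + 1" "nu * B + V\<^sup>2"] show ?thesis
      using b V unfolding time_step_def \<epsilon>_def A_def[symmetric] b_def[symmetric] by simp
  qed
  also have "\<dots> \<le> 1 * ((nu * B + V\<^sup>2) / V) / 4"
    using b V nu by (intro divide_right_mono mult_right_mono) (auto intro!: divide_nonneg_nonneg add_nonneg_nonneg)
  also have "(nu * B + V\<^sup>2) / V = nu * B / V + V" using V by (simp add: add_divide_distrib power2_eq_square)
  \<comment> \<open>This is where 1 <= V enters.\<close>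
  also have "nu * B / V \<le> nu * B / 1" using V nu b by (intro divide_left_mono) auto
  finally show ?thesis by (simp add: field_simps)
qed

text \<open>The bound V is qualitative: it only makes the supremum M over [s, t] finite. Comparison
  with time r gives M <= U + M/2 + \<nu> B/4 when M > 1, and finiteness allows M/2 to be absorbed.
  The outcome is free of V and works in both time directions.\<close>

lemma velocity_propagation:
  assumes st: "0 < s" "t \<le> T" "t - s \<le> time_step"
    and V: "\<And>\<tau>. s \<le> \<tau> \<Longrightarrow> \<tau> \<le> t \<Longrightarrow> vel_le V \<tau>"
    and r: "s \<le> r" "r \<le> t" "vel_le U r" and \<tau>: "s \<le> \<tau>" "\<tau> \<le> t"
  shows "vel_le (2 * U + nu * B / 2 + 1) \<tau>"
proof -
  define A where "A = {\<bar>u e \<sigma> x\<bar> | e \<sigma> x. e \<in> {dir1, dir2} \<and> s \<le> \<sigma> \<and> \<sigma> \<le> t}"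
  have bdd: "bdd_above A" using V by (intro bdd_aboveI[of _ V]) (auto simp: A_def vel_le_def)
  have inA: "\<bar>u e \<sigma> x\<bar> \<in> A" if "e \<in> {dir1, dir2}" "s \<le> \<sigma>" "\<sigma> \<le> t" for e \<sigma> x
    unfolding A_def using that by blast
  then have ne: "A \<noteq> {}" using \<tau> by blast
  \<comment> \<open>The floor 1 meets the requirement 1 <= V of
    \<open>velocity_increment_half\<close>.\<close>
  define M where "M = max 1 (Sup A)"
  have M: "vel_le M \<sigma>" if "s \<le> \<sigma>" "\<sigma> \<le> t" for \<sigma>
    unfolding vel_le_def M_def using that
    by (intro allI conjI max.coboundedI2 cSup_upper bdd inA) auto
  have T: "0 < T" using st r by linarith
  have U: "0 \<le> U" using r(3) abs_ge_zero[of "u dir1 r undefined"] unfolding vel_le_def by (meson order_trans)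
  have nB: "0 \<le> nu * B" using nu B_nonneg[OF T] by simp
  have "Sup A \<le> U + (M / 2 + nu * B / 4)"
  proof (rule cSup_least[OF ne])
    fix a assume "a \<in> A"
    then obtain e \<sigma> x where a: "a = \<bar>u e \<sigma> x\<bar>" "e \<in> {dir1, dir2}" "s \<le> \<sigma>" "\<sigma> \<le> t" by (auto simp: A_def)
    have e: "norm e \<le> 1" using a(2) norm_dir by blast
    have "\<bar>u e \<sigma> x - u e r x\<bar> \<le> M / 2 + nu * B / 4"
    proof (cases "r \<le> \<sigma>")
      case True
      show ?thesis
        by (rule velocity_increment_half[OF _ True _ _ _ _ e]) (use st r a M in \<open>auto simp: M_def\<close>)
    next
      case False
      have "\<bar>u e r x - u e \<sigma> x\<bar> \<le> M / 2 + nu * B / 4"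
        by (rule velocity_increment_half[OF _ _ _ _ _ _ e]) (use st r a M False in \<open>auto simp: M_def\<close>)
      then show ?thesis by (simp only: abs_minus_commute)
    qed
    moreover have "\<bar>u e r x\<bar> \<le> U" using r(3) a(2) unfolding vel_le_def by blast
    ultimately show "a \<le> U + (M / 2 + nu * B / 4)" unfolding a(1) by linarith
  qed
  then have "M \<le> 2 * U + nu * B / 2 + 1" using U nB unfolding M_def max_def by (auto split: if_splits)
  then show ?thesis using vel_le_mono[OF M[OF \<tau>]] by blast
qed

section \<open>Local boundedness of the velocity in time\<close>

definition good :: "real \<Rightarrow> bool" where
  "good t \<longleftrightarrow> (\<exists>\<delta>>0. \<exists>V. \<forall>s. \<bar>s - t\<bar> < \<delta> \<longrightarrow> 0 < s \<longrightarrow> s < T \<longrightarrow> vel_le V s)"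

lemma goodI: "0 < \<delta> \<Longrightarrow> (\<And>s. \<bar>s - t\<bar> < \<delta> \<Longrightarrow> 0 < s \<Longrightarrow> s < T \<Longrightarrow> vel_le V s) \<Longrightarrow> good t"
  unfolding good_def by blast

lemma open_good: "open {t. good t}"
  unfolding open_dist
proof safe
  fix t assume "good t"
  then obtain \<delta> V where d: "\<delta> > 0" "\<And>s. \<bar>s - t\<bar> < \<delta> \<Longrightarrow> 0 < s \<Longrightarrow> s < T \<Longrightarrow> vel_le V s"
    unfolding good_def by blast
  have "good t'" if "\<bar>t' - t\<bar> < \<delta> / 2" for t'
  proof (rule goodI[of "\<delta> / 2" _ V])
    fix s assume s: "\<bar>s - t'\<bar> < \<delta> / 2" "0 < s" "s < T"
    have "\<bar>s - t\<bar> < \<delta>" using s(1) that by linarith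
    then show "vel_le V s" using d(2) s by blast
  qed (use d in simp)
  then show "\<exists>e>0. \<forall>y. dist y t < e \<longrightarrow> y \<in> {t. good t}"
    using d(1) by (intro exI[of _ "\<delta> / 2"]) (auto simp: dist_real_def)
qed

text \<open>Compactness in the form of bisection: local bounds exist near each time, and adjacent
  intervals are joined by taking the maximum.\<close>

lemma good_interval:
  assumes "0 < s" "s \<le> t" "t < T" "\<And>\<tau>. s \<le> \<tau> \<Longrightarrow> \<tau> \<le> t \<Longrightarrow> good \<tau>"
  obtains V where "\<And>\<tau>. s \<le> \<tau> \<Longrightarrow> \<tau> \<le> t \<Longrightarrow> vel_le V \<tau>"
proof -
  have "\<exists>V. \<forall>\<tau>. s \<le> \<tau> \<longrightarrow> \<tau> \<le> t \<longrightarrow> vel_le V \<tau>"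
    using assms(2)
  proof (rule Bolzano[where P = "\<lambda>a b. \<exists>V. \<forall>\<tau>. a \<le> \<tau> \<longrightarrow> \<tau> \<le> b \<longrightarrow> vel_le V \<tau>"])
    fix a b c :: real
    assume "\<exists>V. \<forall>\<tau>. a \<le> \<tau> \<longrightarrow> \<tau> \<le> b \<longrightarrow> vel_le V \<tau>" "\<exists>V. \<forall>\<tau>. b \<le> \<tau> \<longrightarrow> \<tau> \<le> c \<longrightarrow> vel_le V \<tau>"
    then obtain V1 V2 where V: "\<And>\<tau>. a \<le> \<tau> \<Longrightarrow> \<tau> \<le> b \<Longrightarrow> vel_le V1 \<tau>" "\<And>\<tau>. b \<le> \<tau> \<Longrightarrow> \<tau> \<le> c \<Longrightarrow> vel_le V2 \<tau>"
      by blast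
    have "vel_le (max V1 V2) \<tau>" if "a \<le> \<tau>" "\<tau> \<le> c" for \<tau>
      using V[of \<tau>] that vel_le_mono[of V1 \<tau> "max V1 V2"] vel_le_mono[of V2 \<tau> "max V1 V2"] by (cases "\<tau> \<le> b") auto
    then show "\<exists>V. \<forall>\<tau>. a \<le> \<tau> \<longrightarrow> \<tau> \<le> c \<longrightarrow> vel_le V \<tau>" by blast
  next
    fix x assume x: "s \<le> x" "x \<le> t"
    obtain \<delta> V where d: "\<delta> > 0" "\<And>s. \<bar>s - x\<bar> < \<delta> \<Longrightarrow> 0 < s \<Longrightarrow> s < T \<Longrightarrow> vel_le V s"
      using assms(4)[OF x] unfolding good_def by blast
    \<comment> \<open>\<open>good\<close> speaks only of times in (0, T), so the radius is cut down
      to stay there.\<close>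
    have "0 < min \<delta> (min x (T - x))" using d x assms by auto
    moreover have "\<exists>V. \<forall>\<tau>. a \<le> \<tau> \<longrightarrow> \<tau> \<le> b \<longrightarrow> vel_le V \<tau>"
      if "a \<le> x \<and> x \<le> b \<and> b - a < min \<delta> (min x (T - x))" for a b
      using that by (intro exI[of _ V] allI impI d(2)) auto
    ultimately show "\<exists>d>0. \<forall>a b. a \<le> x \<and> x \<le> b \<and> b - a < d \<longrightarrow> (\<exists>V. \<forall>\<tau>. a \<le> \<tau> \<longrightarrow> \<tau> \<le> b \<longrightarrow> vel_le V \<tau>)"
      by blast
  qed
  then show thesis using that by blast
qed

text \<open>Fatou's lemma along times converging to t; pointwise convergence comes from
  differentiability of w in time.\<close>

lemma mass_lsc:
  assumes t: "0 < t" "(\<integral>x. \<bar>w x t\<bar> \<partial>lborel) > c"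
  shows "\<exists>\<delta>>0. \<forall>s. \<bar>s - t\<bar> < \<delta> \<longrightarrow> (\<integral>x. \<bar>w x s\<bar> \<partial>lborel) > c"
proof (rule ccontr)
  assume "\<not> ?thesis"
  then have ex: "\<exists>s. \<bar>s - t\<bar> < \<delta> \<and> (\<integral>x. \<bar>w x s\<bar> \<partial>lborel) \<le> c" if "\<delta> > 0" for \<delta>
    using that by (meson not_le)
  \<comment> \<open>The minimum with t keeps the approximating times positive, where w is
    integrable.\<close>
  have "\<forall>n. \<exists>s. \<bar>s - t\<bar> < min t (1 / real (Suc n)) \<and> (\<integral>x. \<bar>w x s\<bar> \<partial>lborel) \<le> c"
    using t by (intro allI ex) simp
  then obtain s where s: "\<And>n. \<bar>s n - t\<bar> < min t (1 / real (Suc n))" "\<And>n. (\<integral>x. \<bar>w x (s n)\<bar> \<partial>lborel) \<le> c"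
    by metis
  have s0: "0 < s n" for n using s(1)[of n] by (auto simp: min_def split: if_splits)
  have "(\<lambda>n. s n - t) \<longlonglongrightarrow> 0"
  proof (rule Lim_null_comparison)
    show "\<forall>\<^sub>F n in sequentially. norm (s n - t) \<le> 1 / real (Suc n)"
      using s(1) by (intro always_eventually) (auto intro: less_imp_le)
    show "(\<lambda>n. 1 / real (Suc n)) \<longlonglongrightarrow> 0" by (intro LIMSEQ_Suc lim_1_over_n)
  qed
  then have st: "s \<longlonglongrightarrow> t" by (simp add: LIM_zero_iff)
  have lim: "(\<lambda>n. w x (s n)) \<longlonglongrightarrow> w x t" for x
    using deriv(5)[OF t(1), of x] by (intro isCont_tendsto_compose[OF _ st] DERIV_isCont)
  have [measurable]: "(\<lambda>x. w x r) \<in> borel_measurable borel" if "0 < r" for r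
    using integrable_w[OF that] by (auto dest: borel_measurable_integrable)
  have eq: "(\<integral>\<^sup>+x. ennreal \<bar>w x r\<bar> \<partial>lborel) = ennreal (\<integral>x. \<bar>w x r\<bar> \<partial>lborel)" if "0 < r" for r
    using integrable_w[OF that] by (intro nn_integral_eq_integral) auto
  have c: "0 \<le> c" using s(2)[of 0] by (rule order_trans[rotated]) simp
  have "(\<integral>\<^sup>+x. ennreal \<bar>w x t\<bar> \<partial>lborel) = (\<integral>\<^sup>+x. liminf (\<lambda>n. ennreal \<bar>w x (s n)\<bar>) \<partial>lborel)"
  proof (rule nn_integral_cong)
    fix x
    have "(\<lambda>n. ennreal \<bar>w x (s n)\<bar>) \<longlonglongrightarrow> ennreal \<bar>w x t\<bar>"
      by (intro tendsto_ennrealI tendsto_rabs lim)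
    then show "ennreal \<bar>w x t\<bar> = liminf (\<lambda>n. ennreal \<bar>w x (s n)\<bar>)"
      by (rule lim_imp_Liminf[OF sequentially_bot, symmetric])
  qed
  also have "\<dots> \<le> liminf (\<lambda>n. \<integral>\<^sup>+x. ennreal \<bar>w x (s n)\<bar> \<partial>lborel)"
    by (rule nn_integral_liminf) (use s0 in measurable)
  also have "\<dots> \<le> ennreal c"
    by (rule Liminf_le) (use s s0 in \<open>auto simp: eq intro!: always_eventually ennreal_leI\<close>)
  finally show False using t c by (simp add: eq)
qed

lemma all_good:
  assumes "0 < t" "t < T" shows "good t"
proof (rule ccontr)
  assume nt: "\<not> good t"
  have T: "0 < T" using assms by linarith
  define F where "F = - {t. good t}"
  have F: "closed F" unfolding F_def using open_good by (rule closed_Compl)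
  \<comment> \<open>The window of radius r around t lies in (0, T) and has length at most
    \<open>time_step\<close>, so one propagation crosses any part of it.\<close>
  define r where "r = min (time_step / 2) (min t (T - t))"
  have r: "0 < r" "r \<le> t" "r \<le> T - t" "2 * r \<le> time_step" using assms time_step_pos[OF T] by (auto simp: r_def min_def)
  let ?M = "\<lambda>s. \<integral>x. \<bar>w x s\<bar> \<partial>lborel"
  obtain a b q N where ab: "t - r \<le> a" "b \<le> t + r" "q \<in> F" "a < q" "q < b"
    "\<And>s. s \<in> F \<Longrightarrow> a < s \<Longrightarrow> s < b \<Longrightarrow> ?M s \<le> N"
  proof (rule bounded_on_portion[of "t - r" "t + r" ?M t F])
    show "\<exists>\<delta>>0. \<forall>s. \<bar>s - t'\<bar> < \<delta> \<longrightarrow> c < ?M s" if "t - r < t'" "c < ?M t'" for t' c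
      by (rule mass_lsc[OF _ that(2)]) (use that r in linarith)
  qed (use nt r in \<open>auto simp: F_def\<close>)
  have range: "0 < s" "s < T" if "a < s" "s < b" for s using that ab r by auto
  \<comment> \<open>U bounds the velocity on the portion of F through the L^1 norm; K is what one
    propagation makes of U.\<close>
  define U where "U = sing_mass * B + N"
  define K where "K = 2 * U + nu * B / 2 + 1"
  have FU: "vel_le U s" if "s \<in> F" "a < s" "s < b" for s
    using vel_le_mono[OF vel_le_mass[of s], of U] range[OF that(2,3)] ab(6)[OF that] by (simp add: U_def)
  have "vel_le K s" if s: "a < s" "s < b" for s
  proof -
    obtain Us where Us: "vel_le Us s" using vel_le_mass[of s] range[OF s] by force
    \<comment> \<open>K' depends on s. It serves only as the qualitative bound between s and the
      nearest point of F.\<close>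
    define K' where "K' = max U (2 * Us + nu * B / 2 + 1)"
    consider "q \<le> s" | "s < q" by linarith
    then show ?thesis
    proof cases
      case 1
      have "compact (F \<inter> {q..s})" "F \<inter> {q..s} \<noteq> {}"
        using F ab(3) 1 by (auto intro: closed_Int_compact)
      from compact_attains_sup[OF this]
      \<comment> \<open>The last point of F up to s: every time in (c, s] is good.\<close>
      obtain c where c: "c \<in> F" "q \<le> c" "c \<le> s" "\<And>d. d \<in> F \<Longrightarrow> q \<le> d \<Longrightarrow> d \<le> s \<Longrightarrow> d \<le> c"
        by (metis IntD1 IntD2 IntI atLeastAtMost_iff)
      have ac: "a < c" "c < b" using c ab s by auto
      \<comment> \<open>For \<sigma> > c the interval [\<sigma>, s] is compact and good, hence some
        bound V holds on it. This V may blow up as \<sigma> -> c, but backward propagation from s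
        replaces it by a bound independent of \<sigma>.\<close>
      have "vel_le K' \<sigma>" if \<sigma>: "c \<le> \<sigma>" "\<sigma> \<le> s" for \<sigma>
      proof (cases "\<sigma> = c")
        case True
        then show ?thesis using vel_le_mono[OF FU[OF c(1) ac]] by (simp add: K'_def)
      next
        case False
        have "good \<tau>" if "\<sigma> \<le> \<tau>" "\<tau> \<le> s" for \<tau>
          using c(4)[of \<tau>] that \<sigma> c(2) False by (force simp: F_def)
        then obtain V where "\<And>\<tau>. \<sigma> \<le> \<tau> \<Longrightarrow> \<tau> \<le> s \<Longrightarrow> vel_le V \<tau>"
          using good_interval[of \<sigma> s] range[of \<sigma>] range[OF s] \<sigma> ac s by auto
        then have "vel_le (2 * Us + nu * B / 2 + 1) \<sigma>"
          by (rule velocity_propagation[rotated 3, where r = s and s = \<sigma> and t = s]) (use range[of \<sigma>] range[OF s] \<sigma> ac s ab r Us in auto)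
        then show ?thesis by (rule vel_le_mono) (simp add: K'_def)
      qed
      \<comment> \<open>Now that the velocity is bounded on [c, s], forward propagation from c,
        where U holds, gives a bound independent of s.\<close>
      then show ?thesis unfolding K_def
        by (rule velocity_propagation[rotated 3, where r = c and s = c and t = s])
          (use range[OF ac] range[OF s] s c ac ab r FU[OF c(1) ac] in auto)
    next
      case 2
      \<comment> \<open>Mirror image: c is the first point of F from s on, and the directions of
        propagation are exchanged.\<close>
      have "compact (F \<inter> {s..q})" "F \<inter> {s..q} \<noteq> {}"
        using F ab(3) 2 by (auto intro: closed_Int_compact)
      from compact_attains_inf[OF this]
      obtain c where c: "c \<in> F" "s \<le> c" "c \<le> q" "\<And>d. d \<in> F \<Longrightarrow> s \<le> d \<Longrightarrow> d \<le> q \<Longrightarrow> c \<le> d"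
        by (metis IntD1 IntD2 IntI atLeastAtMost_iff)
      have ac: "a < c" "c < b" using c ab s by auto
      have "vel_le K' \<sigma>" if \<sigma>: "s \<le> \<sigma>" "\<sigma> \<le> c" for \<sigma>
      proof (cases "\<sigma> = c")
        case True
        then show ?thesis using vel_le_mono[OF FU[OF c(1) ac]] by (simp add: K'_def)
      next
        case False
        have "good \<tau>" if "s \<le> \<tau>" "\<tau> \<le> \<sigma>" for \<tau>
          using c(4)[of \<tau>] that \<sigma> c(3) False by (force simp: F_def)
        then obtain V where "\<And>\<tau>. s \<le> \<tau> \<Longrightarrow> \<tau> \<le> \<sigma> \<Longrightarrow> vel_le V \<tau>"
          using good_interval[of s \<sigma>] range[of \<sigma>] range[OF s] \<sigma> ac s by auto
        then have "vel_le (2 * Us + nu * B / 2 + 1) \<sigma>"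
          by (rule velocity_propagation[rotated 3, where r = s and s = s and t = \<sigma>]) (use range[of \<sigma>] range[OF s] \<sigma> ac s ab r Us in auto)
        then show ?thesis by (rule vel_le_mono) (simp add: K'_def)
      qed
      then show ?thesis unfolding K_def
        by (rule velocity_propagation[rotated 3, where r = c and s = s and t = c])
          (use range[OF ac] range[OF s] s c ac ab r FU[OF c(1) ac] in auto)
    qed
  qed
  then have "good q" by (intro goodI[of "min (q - a) (b - q)" q K]) (use ab in auto)
  then show False using ab(3) by (simp add: F_def)
qed

text \<open>Near time 0 the L^1 bound acts directly; the remaining times form a compact interval
  inside (0, T), all of them good.\<close>

lemma velocity_bounded:
  assumes \<delta>: "0 < \<delta>" "\<And>t. 0 < t \<Longrightarrow> t < \<delta> \<Longrightarrow> (\<integral>x. \<bar>w x t\<bar> \<partial>lborel) \<le> N" and T': "T' < T"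
  obtains V where "\<And>t. 0 < t \<Longrightarrow> t \<le> T' \<Longrightarrow> vel_le V t"
proof -
  define s where "s = \<delta> / 2"
  have s: "0 < s" "s < \<delta>" using \<delta> by (auto simp: s_def)
  obtain V where V: "\<And>\<tau>. s \<le> \<tau> \<Longrightarrow> \<tau> \<le> T' \<Longrightarrow> vel_le V \<tau>"
  proof (cases "s \<le> T'")
    case True
    show thesis by (rule good_interval[OF s(1) True T']) (use s T' all_good that in auto)
  qed (use that in force)
  have "vel_le (max V (sing_mass * B + N)) t" if t: "0 < t" "t \<le> T'" for t
  proof (cases "s \<le> t")
    case True
    then show ?thesis by (intro vel_le_mono[OF V[OF _ t(2)]]) auto
  next
    case False
    then show ?thesis using vel_le_mono[OF vel_le_mass[of t]] t T' \<delta>(2)[of t] s by (simp add: max.coboundedI2)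
  qed
  then show thesis by (rule that)
qed

end

section \<open>The weight\<close>

text \<open>Equals exp (\<rho> / (L + \<epsilon> \<rho>)) / (1 + \<epsilon> \<rho>)^2 for the
  relevant parameters: a bounded numerator and a denominator that makes it integrable over the plane
  in \<rho> = |x|^2.\<close>

definition Yexp :: "real \<Rightarrow> real \<Rightarrow> real \<Rightarrow> real" where
  "Yexp \<epsilon> L \<rho> = exp (\<rho> / (L + \<epsilon> * \<rho>) - 2 * ln (1 + \<epsilon> * \<rho>))"

text \<open>The \<rho>-derivative of the exponent in \<open>Yexp\<close>; \<open>Ya1\<close> is the
  second one.\<close>

definition Ya :: "real \<Rightarrow> real \<Rightarrow> real \<Rightarrow> real" where
  "Ya \<epsilon> L \<rho> = L / (L + \<epsilon> * \<rho>)\<^sup>2 - 2 * \<epsilon> / (1 + \<epsilon> * \<rho>)"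

definition Ya1 :: "real \<Rightarrow> real \<Rightarrow> real \<Rightarrow> real" where
  "Ya1 \<epsilon> L \<rho> = 2 * \<epsilon>\<^sup>2 / (1 + \<epsilon> * \<rho>)\<^sup>2 - 2 * \<epsilon> * L / (L + \<epsilon> * \<rho>) ^ 3"

lemma Y_denoms:
  fixes \<epsilon> L \<rho> :: real
  assumes "\<epsilon> > 0" "L > 0" "\<rho> \<ge> 0" shows "0 < L + \<epsilon> * \<rho>" "0 < 1 + \<epsilon> * \<rho>"
  using assms by (auto intro!: add_pos_nonneg mult_nonneg_nonneg)

lemma has_real_derivative_Yexp:
  assumes e: "\<epsilon> > 0" "L > 0" "\<rho> \<ge> 0"
  shows "((\<lambda>\<rho>. Yexp \<epsilon> L \<rho>) has_real_derivative Yexp \<epsilon> L \<rho> * Ya \<epsilon> L \<rho>) (at \<rho>)"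
    and "((\<lambda>\<rho>. Ya \<epsilon> L \<rho>) has_real_derivative Ya1 \<epsilon> L \<rho>) (at \<rho>)"
    and "((\<lambda>L. Yexp \<epsilon> L \<rho>) has_real_derivative Yexp \<epsilon> L \<rho> * - (\<rho> / (L + \<epsilon> * \<rho>)\<^sup>2)) (at L)"
proof -
  note p = Y_denoms[OF e]
  define c where "c = L + \<epsilon> * \<rho>"
  define d where "d = 1 + \<epsilon> * \<rho>"
  have cd: "c > 0" "d > 0" using p by (auto simp: c_def d_def)
  have lc: "((\<lambda>\<rho>. L + \<epsilon> * \<rho>) has_real_derivative \<epsilon>) (at \<rho>)"
    and ld: "((\<lambda>\<rho>. 1 + \<epsilon> * \<rho>) has_real_derivative \<epsilon>) (at \<rho>)"
    and lL: "((\<lambda>L. L + \<epsilon> * \<rho>) has_real_derivative 1) (at L)"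
    by (auto intro!: derivative_eq_intros)
  have 1: "((\<lambda>\<rho>. \<rho> / (L + \<epsilon> * \<rho>)) has_real_derivative L / c\<^sup>2) (at \<rho>)"
    by (rule DERIV_cong[OF DERIV_divide[OF DERIV_ident lc]])
      (use p in \<open>auto simp: c_def power2_eq_square algebra_simps\<close>)
  have 2: "((\<lambda>\<rho>. ln (1 + \<epsilon> * \<rho>)) has_real_derivative \<epsilon> / d) (at \<rho>)"
    by (rule DERIV_cong[OF DERIV_chain2[OF DERIV_ln ld]]) (use p in \<open>auto simp: d_def divide_inverse mult.commute\<close>)
  have 3: "((\<lambda>\<rho>. \<rho> / (L + \<epsilon> * \<rho>) - 2 * ln (1 + \<epsilon> * \<rho>)) has_real_derivative Ya \<epsilon> L \<rho>) (at \<rho>)"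
    by (rule DERIV_cong[OF DERIV_diff[OF 1 DERIV_cmult[OF 2]]]) (simp add: Ya_def c_def d_def)
  show "((\<lambda>\<rho>. Yexp \<epsilon> L \<rho>) has_real_derivative Yexp \<epsilon> L \<rho> * Ya \<epsilon> L \<rho>) (at \<rho>)"
    unfolding Yexp_def by (rule DERIV_chain2[OF DERIV_exp 3])
  have 4: "((\<lambda>\<rho>. (L + \<epsilon> * \<rho>)\<^sup>2) has_real_derivative 2 * c * \<epsilon>) (at \<rho>)"
    by (rule DERIV_cong[OF DERIV_power[OF lc]]) (simp add: c_def)
  have 5: "((\<lambda>\<rho>. L / (L + \<epsilon> * \<rho>)\<^sup>2) has_real_derivative - (2 * \<epsilon> * L / c ^ 3)) (at \<rho>)"
    by (rule DERIV_cong[OF DERIV_divide[OF DERIV_const 4]])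
      (use cd in \<open>simp_all add: c_def[symmetric] divide_simps power2_eq_square power3_eq_cube\<close>)
  have 6: "((\<lambda>\<rho>. 2 * \<epsilon> / (1 + \<epsilon> * \<rho>)) has_real_derivative - (2 * \<epsilon>\<^sup>2 / d\<^sup>2)) (at \<rho>)"
    by (rule DERIV_cong[OF DERIV_divide[OF DERIV_const ld]])
      (use cd in \<open>simp_all add: d_def[symmetric] divide_simps power2_eq_square\<close>)
  show "((\<lambda>\<rho>. Ya \<epsilon> L \<rho>) has_real_derivative Ya1 \<epsilon> L \<rho>) (at \<rho>)"
    unfolding Ya_def by (rule DERIV_cong[OF DERIV_diff[OF 5 6]]) (simp add: Ya1_def c_def d_def)
  have 7: "((\<lambda>L. \<rho> / (L + \<epsilon> * \<rho>) - 2 * ln (1 + \<epsilon> * \<rho>)) has_real_derivative - (\<rho> / (L + \<epsilon> * \<rho>)\<^sup>2)) (at L)"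
    by (rule DERIV_cong[OF DERIV_diff[OF DERIV_divide[OF DERIV_const lL] DERIV_const]])
      (use p in \<open>auto simp: power2_eq_square\<close>)
  show "((\<lambda>L. Yexp \<epsilon> L \<rho>) has_real_derivative Yexp \<epsilon> L \<rho> * - (\<rho> / (L + \<epsilon> * \<rho>)\<^sup>2)) (at L)"
    unfolding Yexp_def by (rule DERIV_chain2[OF DERIV_exp 7])
qed

lemma Yexp_pos: "0 < Yexp \<epsilon> L \<rho>" by (simp add: Yexp_def)

lemma Yexp_eq:
  assumes "\<epsilon> > 0" "L > 0" "\<rho> \<ge> 0"
  shows "Yexp \<epsilon> L \<rho> = exp (\<rho> / (L + \<epsilon> * \<rho>)) / (1 + \<epsilon> * \<rho>)\<^sup>2"
  using Y_denoms[OF assms] by (simp add: Yexp_def exp_diff exp_double)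

lemma exp_quotient_le:
  fixes \<epsilon> L \<rho> :: real
  assumes "\<epsilon> > 0" "L > 0" "\<rho> \<ge> 0" shows "exp (\<rho> / (L + \<epsilon> * \<rho>)) \<le> exp (1 / \<epsilon>)"
proof -
  have "\<rho> / (L + \<epsilon> * \<rho>) \<le> 1 / \<epsilon>"
    using Y_denoms[OF assms] assms by (simp add: divide_simps mult.commute)
  then show ?thesis by simp
qed

text \<open>\<epsilon> <= 1 gives 1 + \<epsilon> \<rho> >= \<epsilon> (1 + \<rho>). The majorant
  does not depend on L, hence not on time.\<close>

lemma Yexp_le_mollifier:
  assumes "0 < \<epsilon>" "\<epsilon> \<le> 1" "L > 0"
  shows "Yexp \<epsilon> L ((norm x)\<^sup>2) \<le> exp (1 / \<epsilon>) / \<epsilon>\<^sup>2 * mollifier x"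
proof -
  have p: "0 < 1 + \<epsilon> * (norm x)\<^sup>2" using Y_denoms[OF assms(1,3)] by simp
  have q: "0 < (norm x)\<^sup>2 + 1" by (simp add: add_nonneg_pos)
  have "\<epsilon> * ((norm x)\<^sup>2 + 1) \<le> 1 + \<epsilon> * (norm x)\<^sup>2" using assms by (simp add: distrib_left)
  then have "(\<epsilon> * ((norm x)\<^sup>2 + 1))\<^sup>2 \<le> (1 + \<epsilon> * (norm x)\<^sup>2)\<^sup>2" using assms q by (intro power_mono) auto
  then have "exp ((norm x)\<^sup>2 / (L + \<epsilon> * (norm x)\<^sup>2)) / (1 + \<epsilon> * (norm x)\<^sup>2)\<^sup>2
      \<le> exp (1 / \<epsilon>) / (\<epsilon> * ((norm x)\<^sup>2 + 1))\<^sup>2"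
    using assms q by (intro frac_le exp_quotient_le) auto
  then show ?thesis using assms by (simp add: Yexp_eq mollifier_def power_mult_distrib)
qed

text \<open>The first estimate is the exact Gaussian cancellation in tamed form. Split
  \<open>Ya\<close> as P - Q with the main part P = L / (L + \<epsilon> \<rho>)^2: the
  time-derivative term absorbs \<rho> P^2 because L <= L + \<epsilon> \<rho>. What remains is P <=
  1/L0, \<rho> Q^2 <= 4 and \<rho> \<open>Ya1\<close> <= 2, which gives 1/L0 + 6.\<close>

lemma Ya_bounds:
  assumes e: "0 < \<epsilon>" "\<epsilon> \<le> 1" "0 < L0" "L0 \<le> L" "\<rho> \<ge> 0"
  shows "- (\<rho> / (L + \<epsilon> * \<rho>)\<^sup>2) + Ya \<epsilon> L \<rho> + \<rho> * ((Ya \<epsilon> L \<rho>)\<^sup>2 + Ya1 \<epsilon> L \<rho>) \<le> 1 / L0 + 6"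
    and "\<rho> * \<bar>Ya \<epsilon> L \<rho>\<bar> \<le> 3 / \<epsilon>"
proof -
  have L: "L > 0" using e by simp
  define c where "c = L + \<epsilon> * \<rho>"
  define d where "d = 1 + \<epsilon> * \<rho>"
  have cd: "c > 0" "d > 0" "L \<le> c" "\<epsilon> * \<rho> \<le> c" "1 \<le> d" "\<epsilon> * \<rho> \<le> d"
    using Y_denoms[OF e(1) L e(5)] e L by (auto simp: c_def d_def)
  define P where "P = L / c\<^sup>2"
  define Q where "Q = 2 * \<epsilon> / d"
  have a: "Ya \<epsilon> L \<rho> = P - Q" by (simp add: Ya_def P_def Q_def c_def d_def)
  have PQ: "0 \<le> P" "0 \<le> Q" using L e cd by (auto simp: P_def Q_def)
  have P1: "P \<le> 1 / L0"
  proof -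
    have "L * L0 \<le> c * c" using cd e L by (intro mult_mono) auto
    then show ?thesis using cd e by (simp add: P_def divide_simps power2_eq_square)
  qed
  have P2: "\<rho> * P\<^sup>2 \<le> \<rho> / c\<^sup>2"
  proof -
    have "L\<^sup>2 \<le> c\<^sup>2" using cd L by (intro power_mono) auto
    then have "P\<^sup>2 \<le> 1 / c\<^sup>2" using cd by (simp add: P_def divide_simps power2_eq_square)
    then have "\<rho> * P\<^sup>2 \<le> \<rho> * (1 / c\<^sup>2)" using e by (intro mult_left_mono)
    then show ?thesis by simp
  qed
  have q: "\<rho> * (\<epsilon>\<^sup>2 / d\<^sup>2) \<le> 1"
  proof -
    have "(\<epsilon> * \<rho>) * \<epsilon> \<le> d * d" using cd e by (intro mult_mono) auto
    then show ?thesis using cd by (simp add: divide_simps power2_eq_square mult_ac)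
  qed
  have Q2: "\<rho> * Q\<^sup>2 \<le> 4" 
  proof -
    have "\<rho> * Q\<^sup>2 = 4 * (\<rho> * (\<epsilon>\<^sup>2 / d\<^sup>2))" by (simp add: Q_def power_divide power_mult_distrib)
    then show ?thesis using q by linarith
  qed
  have A1: "\<rho> * Ya1 \<epsilon> L \<rho> \<le> 2"
  proof -
    have "0 \<le> \<rho> * (2 * \<epsilon> * L / c ^ 3)" using e L cd by simp
    moreover have "\<rho> * Ya1 \<epsilon> L \<rho> = 2 * (\<rho> * (\<epsilon>\<^sup>2 / d\<^sup>2)) - \<rho> * (2 * \<epsilon> * L / c ^ 3)"
      by (simp add: Ya1_def c_def[symmetric] d_def[symmetric] right_diff_distrib)
    ultimately show ?thesis using q by linarith
  qed
  have "\<rho> * (P - Q)\<^sup>2 = \<rho> * P\<^sup>2 + \<rho> * Q\<^sup>2 - 2 * (\<rho> * (P * Q))" by (simp add: power2_eq_square algebra_simps)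
  \<comment> \<open>The cross term of the square has the favourable sign.\<close>
  moreover have "0 \<le> \<rho> * (P * Q)" using PQ e by simp
  ultimately have "\<rho> * (P - Q)\<^sup>2 \<le> \<rho> / c\<^sup>2 + 4" using P2 Q2 by linarith
  then show "- (\<rho> / (L + \<epsilon> * \<rho>)\<^sup>2) + Ya \<epsilon> L \<rho> + \<rho> * ((Ya \<epsilon> L \<rho>)\<^sup>2 + Ya1 \<epsilon> L \<rho>) \<le> 1 / L0 + 6"
    unfolding c_def[symmetric] distrib_left using A1 P1 PQ unfolding a by linarith
  have "\<epsilon> * \<rho> * L \<le> c * c" using cd e L by (intro mult_mono) auto
  then have rP: "\<rho> * P \<le> 1 / \<epsilon>" using e cd by (simp add: P_def divide_simps power2_eq_square mult_ac)
  have "\<epsilon> * (\<epsilon> * \<rho>) \<le> 1 * d" using cd e by (intro mult_mono) auto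
  then have rQ: "\<rho> * Q \<le> 2 / \<epsilon>" using e cd by (simp add: Q_def divide_simps mult_ac)
  have "\<rho> * \<bar>P - Q\<bar> \<le> \<rho> * (P + Q)" using PQ e by (intro mult_left_mono) auto
  then show "\<rho> * \<bar>Ya \<epsilon> L \<rho>\<bar> \<le> 3 / \<epsilon>" unfolding a using rP rQ by (simp add: distrib_left add_divide_distrib)
qed

text \<open>The Gaussian weight \<open>exp (\<rho> / L)\<close>, \<open>\<rho> = |x|\<^sup>2\<close>, tamed at infinity and truncated at radius \<open>R\<close>.
  \<open>weightL\<close> is the derivative in \<open>L\<close>; \<open>4 (weight1 + \<rho> weight2)\<close> is the Laplacian in \<open>x\<close>.\<close>

definition weight :: "real \<Rightarrow> real \<Rightarrow> real \<Rightarrow> real \<Rightarrow> real" where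
  "weight \<epsilon> R L \<rho> = Yexp \<epsilon> L \<rho> * bump R \<rho>"

definition weight1 :: "real \<Rightarrow> real \<Rightarrow> real \<Rightarrow> real \<Rightarrow> real" where
  "weight1 \<epsilon> R L \<rho> = Yexp \<epsilon> L \<rho> * (Ya \<epsilon> L \<rho> * bump R \<rho> + bump1 R \<rho>)"

definition weight2 :: "real \<Rightarrow> real \<Rightarrow> real \<Rightarrow> real \<Rightarrow> real" where
  "weight2 \<epsilon> R L \<rho> = Yexp \<epsilon> L \<rho> * (((Ya \<epsilon> L \<rho>)\<^sup>2 + Ya1 \<epsilon> L \<rho>) * bump R \<rho> + 2 * Ya \<epsilon> L \<rho> * bump1 R \<rho> + bump2 R \<rho>)"

definition weightL :: "real \<Rightarrow> real \<Rightarrow> real \<Rightarrow> real \<Rightarrow> real" where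
  "weightL \<epsilon> R L \<rho> = Yexp \<epsilon> L \<rho> * - (\<rho> / (L + \<epsilon> * \<rho>)\<^sup>2) * bump R \<rho>"

lemma has_real_derivative_weight:
  assumes e: "\<epsilon> > 0" "L > 0" "\<rho> \<ge> 0"
  shows "((\<lambda>\<rho>. weight \<epsilon> R L \<rho>) has_real_derivative weight1 \<epsilon> R L \<rho>) (at \<rho>)"
    and "((\<lambda>\<rho>. weight1 \<epsilon> R L \<rho>) has_real_derivative weight2 \<epsilon> R L \<rho>) (at \<rho>)"
    and "((\<lambda>L. weight \<epsilon> R L \<rho>) has_real_derivative weightL \<epsilon> R L \<rho>) (at L)"
proof -
  note y = has_real_derivative_Yexp[OF e] and b = has_real_derivative_bump[of R \<rho>]
  show "((\<lambda>\<rho>. weight \<epsilon> R L \<rho>) has_real_derivative weight1 \<epsilon> R L \<rho>) (at \<rho>)"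
    unfolding weight_def by (rule DERIV_cong[OF DERIV_mult[OF y(1) b(1)]]) (simp add: weight1_def algebra_simps)
  show "((\<lambda>\<rho>. weight1 \<epsilon> R L \<rho>) has_real_derivative weight2 \<epsilon> R L \<rho>) (at \<rho>)"
    unfolding weight1_def by (rule DERIV_cong[OF DERIV_mult[OF y(1) DERIV_add[OF DERIV_mult[OF y(2) b(1)] b(2)]]])
      (simp add: weight2_def algebra_simps power2_eq_square)
  show "((\<lambda>L. weight \<epsilon> R L \<rho>) has_real_derivative weightL \<epsilon> R L \<rho>) (at L)"
    unfolding weight_def by (rule DERIV_cong[OF DERIV_mult[OF y(3) DERIV_const]]) (simp add: weightL_def)
qed

text \<open>Times 4\<nu>, the left side is the time derivative plus \<nu> times the Laplacian of the
  weight. Terms with no derivative on the cutoff obey \<open>Ya_bounds\<close>; the others amount to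
  3 + 6 + 18 = 27 over \<epsilon> R^2, using \<epsilon> <= 1.\<close>

lemma weight_supersolution:
  assumes e: "0 < \<epsilon>" "\<epsilon> \<le> 1" "0 < L0" "L0 \<le> L" "\<rho> \<ge> 0" and R: "R > 0"
  shows "weightL \<epsilon> R L \<rho> + weight1 \<epsilon> R L \<rho> + \<rho> * weight2 \<epsilon> R L \<rho>
    \<le> (1 / L0 + 6) * weight \<epsilon> R L \<rho> + 27 / (\<epsilon> * R\<^sup>2) * Yexp \<epsilon> L \<rho>"
proof -
  let ?Y = "Yexp \<epsilon> L \<rho>" and ?a = "Ya \<epsilon> L \<rho>"
  note b = bump_bounds[OF R e(5)]
  have "(- (\<rho> / (L + \<epsilon> * \<rho>)\<^sup>2) + ?a + \<rho> * (?a\<^sup>2 + Ya1 \<epsilon> L \<rho>)) * bump R \<rho> \<le> (1 / L0 + 6) * bump R \<rho>"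
    by (rule mult_right_mono[OF Ya_bounds(1)[OF e] b(1)])
  moreover have "bump1 R \<rho> + \<rho> * (2 * ?a * bump1 R \<rho> + bump2 R \<rho>) \<le> 27 / (\<epsilon> * R\<^sup>2)"
  proof -
    have 1: "\<bar>\<rho> * bump2 R \<rho>\<bar> \<le> 6 / R\<^sup>2"
    proof (cases "\<rho> \<le> R\<^sup>2")
      case True
      have "\<bar>\<rho> * bump2 R \<rho>\<bar> = \<rho> * \<bar>bump2 R \<rho>\<bar>" using e by (simp add: abs_mult)
      also have "\<dots> \<le> R\<^sup>2 * (6 / (R\<^sup>2)\<^sup>2)" using True b e by (intro mult_mono) auto
      also have "\<dots> = 6 / R\<^sup>2" using R by (simp add: power2_eq_square)
      finally show ?thesis .
    next
      case False
      then show ?thesis using bump_zero(3)[OF R, of \<rho>] by simp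
    qed
    have "\<bar>2 * (\<rho> * ?a * bump1 R \<rho>)\<bar> = 2 * ((\<rho> * \<bar>?a\<bar>) * \<bar>bump1 R \<rho>\<bar>)" using e by (simp add: abs_mult)
    also have "\<dots> \<le> 2 * (3 / \<epsilon> * (3 / R\<^sup>2))"
      using e by (intro mult_left_mono mult_mono Ya_bounds(2)[OF e] b) auto
    finally have 2: "\<bar>2 * (\<rho> * ?a * bump1 R \<rho>)\<bar> \<le> 18 / (\<epsilon> * R\<^sup>2)" by simp
    have 3: "9 / R\<^sup>2 \<le> 9 / (\<epsilon> * R\<^sup>2)"
      using e R mult_right_mono[OF e(2), of "R\<^sup>2"] by (intro divide_left_mono) auto
    have "bump1 R \<rho> + \<rho> * (2 * ?a * bump1 R \<rho> + bump2 R \<rho>)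
        = bump1 R \<rho> + 2 * (\<rho> * ?a * bump1 R \<rho>) + \<rho> * bump2 R \<rho>" by (simp add: algebra_simps)
    also have "\<dots> \<le> 3 / R\<^sup>2 + 18 / (\<epsilon> * R\<^sup>2) + 6 / R\<^sup>2" using 1 2 b(3) by linarith
    also have "\<dots> = 9 / R\<^sup>2 + 18 / (\<epsilon> * R\<^sup>2)" by (simp flip: add_divide_distrib)
    also have "\<dots> \<le> 9 / (\<epsilon> * R\<^sup>2) + 18 / (\<epsilon> * R\<^sup>2)" using 3 by simp
    also have "\<dots> = 27 / (\<epsilon> * R\<^sup>2)" by (simp flip: add_divide_distrib)
    finally show ?thesis .
  qed
  ultimately have "?Y * ((- (\<rho> / (L + \<epsilon> * \<rho>)\<^sup>2) + ?a + \<rho> * (?a\<^sup>2 + Ya1 \<epsilon> L \<rho>)) * bump R \<rho>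
      + (bump1 R \<rho> + \<rho> * (2 * ?a * bump1 R \<rho> + bump2 R \<rho>)))
      \<le> ?Y * ((1 / L0 + 6) * bump R \<rho> + 27 / (\<epsilon> * R\<^sup>2))"
    using Yexp_pos[of \<epsilon> L \<rho>] by (intro mult_left_mono add_mono) auto
  then show ?thesis by (simp add: weightL_def weight1_def weight2_def weight_def algebra_simps)
qed

section \<open>The weighted energy inequality\<close>

lemma weight_nonneg: "0 < R \<Longrightarrow> 0 \<le> \<rho> \<Longrightarrow> 0 \<le> weight \<epsilon> R L \<rho>"
  unfolding weight_def by (intro mult_nonneg_nonneg less_imp_le[OF Yexp_pos] bump_bounds(1))

text \<open>exp (-C (\<tau> - s)) f(\<tau>) - K (\<tau> - s) is nonincreasing. The derivative is an
  existential witness with its bound, the form in which \<open>energy_derivative\<close> delivers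
  it.\<close>

lemma gronwall_affine:
  fixes f D :: "real \<Rightarrow> real"
  assumes st: "s \<le> t" and C: "0 \<le> C" "0 \<le> K"
    and f: "\<And>\<tau>. s \<le> \<tau> \<Longrightarrow> \<tau> \<le> t \<Longrightarrow> \<exists>D. (f has_real_derivative D) (at \<tau>) \<and> D \<le> C * f \<tau> + K"
  shows "f t \<le> exp (C * (t - s)) * (f s + K * (t - s))"
proof -
  define \<phi> where "\<phi> \<tau> = exp (- C * (\<tau> - s)) * f \<tau> - K * (\<tau> - s)" for \<tau>
  have "\<phi> t \<le> \<phi> s"
  proof (rule DERIV_nonpos_imp_nonincreasing[OF st])
    fix \<tau> assume \<tau>: "s \<le> \<tau>" "\<tau> \<le> t"
    obtain D where D: "(f has_real_derivative D) (at \<tau>)" "D \<le> C * f \<tau> + K" using f[OF \<tau>] by blast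
    let ?e = "exp (- C * (\<tau> - s))"
    have e: "((\<lambda>\<tau>. exp (- C * (\<tau> - s))) has_real_derivative ?e * (- C)) (at \<tau>)"
      by (auto intro!: derivative_eq_intros)
    have k: "((\<lambda>\<tau>. K * (\<tau> - s)) has_real_derivative K) (at \<tau>)"
      by (auto intro!: derivative_eq_intros)
    have "(\<phi> has_real_derivative ?e * (- C) * f \<tau> + D * ?e - K) (at \<tau>)"
      unfolding \<phi>_def by (rule DERIV_diff[OF DERIV_mult[OF e D(1)] k])
    moreover have "?e * (- C) * f \<tau> + D * ?e - K \<le> 0"
    proof -
      have "?e \<le> 1" using C \<tau> by simp
      have "?e * (D - C * f \<tau>) \<le> ?e * K" using D(2) by (intro mult_left_mono) auto
      also have "\<dots> \<le> 1 * K" using \<open>?e \<le> 1\<close> C by (intro mult_right_mono)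
      finally show ?thesis by (simp add: algebra_simps)
    qed
    ultimately show "\<exists>y. (\<phi> has_real_derivative y) (at \<tau>) \<and> y \<le> 0" by blast
  qed
  then have "exp (- C * (t - s)) * f t \<le> f s + K * (t - s)" by (simp add: \<phi>_def)
  then have "exp (C * (t - s)) * (exp (- C * (t - s)) * f t) \<le> exp (C * (t - s)) * (f s + K * (t - s))"
    by (intro mult_left_mono) auto
  moreover have "exp (C * (t - s)) * (exp (- C * (t - s)) * f t) = f t"
    by (simp add: exp_minus)
  ultimately show ?thesis by (simp only:)
qed

context vorticity_flow
begin

text \<open>Transport is not integrated by parts: that would put u on the gradient of W, which for
  the Gaussian weight has size |x| W / L and is not controlled by W. Kept on w and absorbed by the
  dissipation, it costs only V^2 / \<nu> times W.\<close>

lemma energy_derivative: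
  fixes W Wt W1 W2 W11 W22 :: "real \<times> real \<Rightarrow> real \<Rightarrow> real"
  assumes cW: "continuous_on (UNIV \<times> {0<..}) (\<lambda>p. W (fst p) (snd p))"
      "continuous_on (UNIV \<times> {0<..}) (\<lambda>p. Wt (fst p) (snd p))"
    and dW: "\<And>x t. 0 < t \<Longrightarrow> ((\<lambda>s. W x s) has_real_derivative Wt x t) (at t)"
    and pW: "pd1 (\<lambda>x. W x t) (\<lambda>x. W1 x t)" "pd2 (\<lambda>x. W x t) (\<lambda>x. W2 x t)"
      "pd1 (\<lambda>x. W1 x t) (\<lambda>x. W11 x t)" "pd2 (\<lambda>x. W2 x t) (\<lambda>x. W22 x t)"
    and W0: "\<And>x. 0 \<le> W x t" and z: "\<And>x t. 0 < t \<Longrightarrow> norm x > R \<Longrightarrow> W x t = 0"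
    and t: "0 < t" "t \<le> T" and V: "vel_le V t"
  shows "\<exists>D. ((\<lambda>s. \<integral>x. W x s * (w x s)\<^sup>2 \<partial>lborel) has_real_derivative D) (at t) \<and>
    D \<le> (\<integral>x. (Wt x t + nu * (W11 x t + W22 x t) + V\<^sup>2 / nu * W x t) * (w x t)\<^sup>2 \<partial>lborel)"
proof -
  note p = pd_w[OF t(1)]
  have zW: "norm x > R \<Longrightarrow> W x t = 0" for x using z t by blast
  have z1: "norm x > R \<Longrightarrow> W1 x t = 0" "norm x > R \<Longrightarrow> W2 x t = 0" for x
    using pd1_support[OF pW(1) zW] pd2_support[OF pW(2) zW] by blast+
  have z2: "norm x > R \<Longrightarrow> W11 x t = 0" "norm x > R \<Longrightarrow> W22 x t = 0" for x
    using pd1_support[OF pW(3) z1(1)] pd2_support[OF pW(4) z1(2)] by blast+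
  have zt: "Wt x t = 0" if x: "norm x > R" for x
  proof -
    have "((\<lambda>s. W x s) has_real_derivative 0) (at t)"
      by (rule has_field_derivative_transform_within_open[where f = "\<lambda>_. 0" and S = "{0<..}"])
        (use t x z in auto)
    then show ?thesis using dW[OF t(1), of x] DERIV_unique by blast
  qed
  have c: "continuous_on UNIV (\<lambda>x. W x t)" "continuous_on UNIV (\<lambda>x. W1 x t)" "continuous_on UNIV (\<lambda>x. W2 x t)"
    "continuous_on UNIV (\<lambda>x. W11 x t)" "continuous_on UNIV (\<lambda>x. W22 x t)" "continuous_on UNIV (\<lambda>x. Wt x t)"
    using pW continuous_slice[OF cW(2) t(1)] by (auto simp: pd1_def pd2_def)
  have cw: "continuous_on UNIV (\<lambda>x. w x t)" "continuous_on UNIV (\<lambda>x. w1 x t)" "continuous_on UNIV (\<lambda>x. w2 x t)"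
    "continuous_on UNIV (\<lambda>x. w11 x t)" "continuous_on UNIV (\<lambda>x. w22 x t)"
    using p by (auto simp: pd1_def pd2_def)
  have cu: "continuous_on UNIV (u dir1 t)" "continuous_on UNIV (u dir2 t)"
    by (intro continuous_u t; simp)+
  define Ft where "Ft x s = Wt x s * (w x s)\<^sup>2 + W x s * (2 * w x s * wt x s)" for x s
  have D: "((\<lambda>s. \<integral>x. W x s * (w x s)\<^sup>2 \<partial>lborel) has_real_derivative (\<integral>x. Ft x t \<partial>lborel)) (at t)"
  proof (rule has_real_derivative_integral_time[where R = R])
    show "continuous_on (UNIV \<times> {0<..}) (\<lambda>p. W (fst p) (snd p) * (w (fst p) (snd p))\<^sup>2)"
      "continuous_on (UNIV \<times> {0<..}) (\<lambda>p. Ft (fst p) (snd p))"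
      unfolding Ft_def by (intro continuous_intros cont cW)+
    show "((\<lambda>s. W x s * (w x s)\<^sup>2) has_real_derivative Ft x s) (at s)" if "0 < s" for x s
      unfolding Ft_def
      by (rule DERIV_cong[OF DERIV_mult[OF dW[OF that] DERIV_power[OF deriv(5)[OF that], where n = 2]]]) simp
  qed (use z t in auto)
  have i: "integrable lborel k"
    if "continuous_on UNIV k" "\<And>x. norm x > R \<Longrightarrow> k x = 0" for k :: "real \<times> real \<Rightarrow> real"
    using that by (rule integrable_compact_support)
  \<comment> \<open>Two integrations by parts split the diffusion into w^2 times the second
    derivative of the weight and the dissipation.\<close>
  have d1: "2 * (\<integral>x. w11 x t * (W x t * w x t) \<partial>lborel)
      = (\<integral>x. (w x t)\<^sup>2 * W11 x t \<partial>lborel) - 2 * (\<integral>x. W x t * (w1 x t)\<^sup>2 \<partial>lborel)"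
  proof -
    have "(\<integral>x. w11 x t * (W x t * w x t) \<partial>lborel) = - (\<integral>x. w1 x t * (W1 x t * w x t + W x t * w1 x t) \<partial>lborel)"
      by (rule ibp1[OF p(3) pd1_mult[OF pW(1) p(1)], where R = R]) (simp add: zW)
    also have "(\<integral>x. w1 x t * (W1 x t * w x t + W x t * w1 x t) \<partial>lborel)
        = (\<integral>x. w1 x t * w x t * W1 x t \<partial>lborel) + (\<integral>x. W x t * (w1 x t)\<^sup>2 \<partial>lborel)"
      by (subst Bochner_Integration.integral_add[symmetric])
        ((intro i continuous_intros c cw; simp add: zW z1)+, simp add: algebra_simps power2_eq_square)
    also have "(\<integral>x. w1 x t * w x t * W1 x t \<partial>lborel) = (1 / 2) * (\<integral>x. (w1 x t * w x t + w x t * w1 x t) * W1 x t \<partial>lborel)"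
    proof -
      have "(\<lambda>x. (w1 x t * w x t + w x t * w1 x t) * W1 x t) = (\<lambda>x. 2 * (w1 x t * w x t * W1 x t))"
        by (rule ext) (simp add: algebra_simps)
      then show ?thesis by simp
    qed
    also have "(\<integral>x. (w1 x t * w x t + w x t * w1 x t) * W1 x t \<partial>lborel) = - (\<integral>x. (w x t * w x t) * W11 x t \<partial>lborel)"
      by (rule ibp1[OF pd1_mult[OF p(1) p(1)] pW(3) z1(1)])
    finally show ?thesis by (simp add: power2_eq_square)
  qed
  have d2: "2 * (\<integral>x. w22 x t * (W x t * w x t) \<partial>lborel)
      = (\<integral>x. (w x t)\<^sup>2 * W22 x t \<partial>lborel) - 2 * (\<integral>x. W x t * (w2 x t)\<^sup>2 \<partial>lborel)"
  proof -
    have "(\<integral>x. w22 x t * (W x t * w x t) \<partial>lborel) = - (\<integral>x. w2 x t * (W2 x t * w x t + W x t * w2 x t) \<partial>lborel)"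
      by (rule ibp2[OF p(4) pd2_mult[OF pW(2) p(2)], where R = R]) (simp add: zW)
    also have "(\<integral>x. w2 x t * (W2 x t * w x t + W x t * w2 x t) \<partial>lborel)
        = (\<integral>x. w2 x t * w x t * W2 x t \<partial>lborel) + (\<integral>x. W x t * (w2 x t)\<^sup>2 \<partial>lborel)"
      by (subst Bochner_Integration.integral_add[symmetric])
        ((intro i continuous_intros c cw; simp add: zW z1)+, simp add: algebra_simps power2_eq_square)
    also have "(\<integral>x. w2 x t * w x t * W2 x t \<partial>lborel) = (1 / 2) * (\<integral>x. (w2 x t * w x t + w x t * w2 x t) * W2 x t \<partial>lborel)"
    proof -
      have "(\<lambda>x. (w2 x t * w x t + w x t * w2 x t) * W2 x t) = (\<lambda>x. 2 * (w2 x t * w x t * W2 x t))"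
        by (rule ext) (simp add: algebra_simps)
      then show ?thesis by simp
    qed
    also have "(\<integral>x. (w2 x t * w x t + w x t * w2 x t) * W2 x t \<partial>lborel) = - (\<integral>x. (w x t * w x t) * W22 x t \<partial>lborel)"
      by (rule ibp2[OF pd2_mult[OF p(2) p(2)] pW(4) z1(2)])
    finally show ?thesis by (simp add: power2_eq_square)
  qed
  let ?A = "\<lambda>x. Wt x t * (w x t)\<^sup>2"
  let ?P = "\<lambda>x. w11 x t * (W x t * w x t)" and ?Q = "\<lambda>x. w22 x t * (W x t * w x t)"
  let ?U = "\<lambda>x. W x t * (2 * w x t * (u dir1 t x * w1 x t + u dir2 t x * w2 x t))"
  let ?a = "\<lambda>x. (w x t)\<^sup>2 * W11 x t" and ?b = "\<lambda>x. (w x t)\<^sup>2 * W22 x t"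
  let ?c = "\<lambda>x. W x t * (w1 x t)\<^sup>2" and ?d = "\<lambda>x. W x t * (w2 x t)\<^sup>2"
  have I: "integrable lborel ?A" "integrable lborel ?P" "integrable lborel ?Q" "integrable lborel ?U"
    "integrable lborel ?a" "integrable lborel ?b" "integrable lborel ?c" "integrable lborel ?d"
    by (intro i continuous_intros c cw cu; simp add: zW z1 z2 zt)+
  have "(\<integral>x. Ft x t \<partial>lborel) = (\<integral>x. ?A x + nu * (2 * ?P x + 2 * ?Q x) - ?U x \<partial>lborel)"
    by (rule Bochner_Integration.integral_cong[OF refl]) (simp add: Ft_def pde[OF t(1)] algebra_simps)
  also have "\<dots> = (\<integral>x. ?A x \<partial>lborel) + nu * (2 * (\<integral>x. ?P x \<partial>lborel) + 2 * (\<integral>x. ?Q x \<partial>lborel)) - (\<integral>x. ?U x \<partial>lborel)"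
    using I(1-4) by simp
  also have "\<dots> = (\<integral>x. ?A x \<partial>lborel) + nu * ((\<integral>x. ?a x \<partial>lborel) - 2 * (\<integral>x. ?c x \<partial>lborel)
      + ((\<integral>x. ?b x \<partial>lborel) - 2 * (\<integral>x. ?d x \<partial>lborel))) - (\<integral>x. ?U x \<partial>lborel)"
    unfolding d1 d2 ..
  also have "\<dots> = (\<integral>x. ?A x + nu * (?a x - 2 * ?c x + (?b x - 2 * ?d x)) - ?U x \<partial>lborel)"
    using I by simp
  also have "\<dots> \<le> (\<integral>x. (Wt x t + nu * (W11 x t + W22 x t) + V\<^sup>2 / nu * W x t) * (w x t)\<^sup>2 \<partial>lborel)"
  proof (rule integral_mono)
    show "integrable lborel (\<lambda>x. ?A x + nu * (?a x - 2 * ?c x + (?b x - 2 * ?d x)) - ?U x)"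
      using I by simp
    show "integrable lborel (\<lambda>x. (Wt x t + nu * (W11 x t + W22 x t) + V\<^sup>2 / nu * W x t) * (w x t)\<^sup>2)"
      by (intro i continuous_intros c cw; simp add: zW z2 zt)
    fix x
    \<comment> \<open>Completed square (2 \<nu> b + a v)^2 / (2 \<nu>) >= 0, which uses up the whole
      dissipation of one direction; the two directions add up to V^2 / \<nu>.\<close>
    have young: "- (2 * nu * b\<^sup>2) - 2 * a * (v * b) \<le> V\<^sup>2 / (2 * nu) * a\<^sup>2" if "\<bar>v\<bar> \<le> V" for a b v :: real
    proof -
      have "0 \<le> (2 * nu * b + a * v)\<^sup>2 / (2 * nu)" using nu by simp
      also have "(2 * nu * b + a * v)\<^sup>2 = 4 * nu\<^sup>2 * b\<^sup>2 + 4 * nu * a * b * v + a\<^sup>2 * v\<^sup>2"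
        by (simp add: power2_eq_square algebra_simps)
      also have "\<dots> / (2 * nu) = 2 * nu * b\<^sup>2 + 2 * a * (v * b) + v\<^sup>2 / (2 * nu) * a\<^sup>2"
        using nu by (simp add: add_divide_distrib power2_eq_square)
      finally have 1: "- (2 * nu * b\<^sup>2) - 2 * a * (v * b) \<le> v\<^sup>2 / (2 * nu) * a\<^sup>2" by simp
      have "v\<^sup>2 \<le> V\<^sup>2" using that abs_le_square_iff[of v V] by simp
      then have "v\<^sup>2 / (2 * nu) * a\<^sup>2 \<le> V\<^sup>2 / (2 * nu) * a\<^sup>2"
        using nu by (intro mult_right_mono divide_right_mono) auto
      with 1 show ?thesis by linarith
    qed
    have y: "- (2 * nu * (w1 x t)\<^sup>2) - 2 * w x t * (u dir1 t x * w1 x t) \<le> V\<^sup>2 / (2 * nu) * (w x t)\<^sup>2"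
      "- (2 * nu * (w2 x t)\<^sup>2) - 2 * w x t * (u dir2 t x * w2 x t) \<le> V\<^sup>2 / (2 * nu) * (w x t)\<^sup>2"
      using V unfolding vel_le_def by (blast intro: young)+
    have "V\<^sup>2 / (2 * nu) * (w x t)\<^sup>2 + V\<^sup>2 / (2 * nu) * (w x t)\<^sup>2 = V\<^sup>2 / nu * (w x t)\<^sup>2"
      using nu by (simp add: field_simps)
    then have "(- (2 * nu * (w1 x t)\<^sup>2) - 2 * w x t * (u dir1 t x * w1 x t))
        + (- (2 * nu * (w2 x t)\<^sup>2) - 2 * w x t * (u dir2 t x * w2 x t)) \<le> V\<^sup>2 / nu * (w x t)\<^sup>2"
      using y by linarith
    from mult_left_mono[OF this W0[of x]]
    show "?A x + nu * (?a x - 2 * ?c x + (?b x - 2 * ?d x)) - ?U x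
        \<le> (Wt x t + nu * (W11 x t + W22 x t) + V\<^sup>2 / nu * W x t) * (w x t)\<^sup>2"
      by (simp add: algebra_simps)
  qed
  finally show ?thesis using D by blast
qed

text \<open>\<open>l0\<close> is the square of the initial length; dividing by the factor \<pi>
  \<lambda>^2 of the enstrophy weight is postponed to the end.\<close>

definition energy :: "real \<Rightarrow> real \<Rightarrow> real \<Rightarrow> real \<Rightarrow> real" where
  "energy \<epsilon> R l0 t = (\<integral>x. weight \<epsilon> R (l0 + 4 * nu * t) ((norm x)\<^sup>2) * (w x t)\<^sup>2 \<partial>lborel)"

text \<open>The cutoff error of the weight is paired with w^2 <= B^2 and an integrable majorant. It
  becomes a source of order 1/R^2 at fixed \<epsilon>, while the growth rate depends on
  neither.\<close>

lemma energy_growth: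
  assumes e: "0 < \<epsilon>" "\<epsilon> \<le> 1" "0 < l0" "0 < R" and st: "0 < s" "s \<le> t" "t \<le> T"
    and V: "\<And>\<tau>. 0 < \<tau> \<Longrightarrow> \<tau> \<le> t \<Longrightarrow> vel_le V \<tau>"
  shows "energy \<epsilon> R l0 t \<le> exp ((4 * nu * (1 / l0 + 6) + V\<^sup>2 / nu) * (t - s)) *
    (energy \<epsilon> R l0 s + 4 * nu * (27 / (\<epsilon> * R\<^sup>2)) * (exp (1 / \<epsilon>) / \<epsilon>\<^sup>2) * mollifier_mass * B\<^sup>2 * (t - s))"
proof (rule gronwall_affine[OF st(2)])
  have B: "0 \<le> B" using B_nonneg st by linarith
  show "0 \<le> 4 * nu * (1 / l0 + 6) + V\<^sup>2 / nu" using nu e by simp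
  show "0 \<le> 4 * nu * (27 / (\<epsilon> * R\<^sup>2)) * (exp (1 / \<epsilon>) / \<epsilon>\<^sup>2) * mollifier_mass * B\<^sup>2" using nu e mollifier_mass_pos by simp
  fix \<tau> assume \<tau>: "s \<le> \<tau>" "\<tau> \<le> t"
  then have \<tau>': "0 < \<tau>" "\<tau> \<le> T" using st by auto
  define L where "L r = l0 + 4 * nu * r" for r
  have L: "0 < L r" "l0 \<le> L r" if "0 < r" for r using that e nu by (auto simp: L_def add_pos_pos)
  have ne: "L r + \<epsilon> * (norm x)\<^sup>2 \<noteq> 0" "1 + \<epsilon> * (norm x)\<^sup>2 \<noteq> 0" if "0 < r" for r and x :: "real \<times> real"
    using Y_denoms[OF e(1) L(1)[OF that], of "(norm x)\<^sup>2"] by auto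
  let ?W = "\<lambda>(x::real\<times>real) r. weight \<epsilon> R (L r) ((norm x)\<^sup>2)"
  let ?Wt = "\<lambda>(x::real\<times>real) r. 4 * nu * weightL \<epsilon> R (L r) ((norm x)\<^sup>2)"
  let ?W1 = "\<lambda>(x::real\<times>real) r. 2 * fst x * weight1 \<epsilon> R (L r) ((norm x)\<^sup>2)"
  let ?W2 = "\<lambda>(x::real\<times>real) r. 2 * snd x * weight1 \<epsilon> R (L r) ((norm x)\<^sup>2)"
  let ?W11 = "\<lambda>(x::real\<times>real) r. 2 * weight1 \<epsilon> R (L r) ((norm x)\<^sup>2) + 4 * (fst x)\<^sup>2 * weight2 \<epsilon> R (L r) ((norm x)\<^sup>2)"
  let ?W22 = "\<lambda>(x::real\<times>real) r. 2 * weight1 \<epsilon> R (L r) ((norm x)\<^sup>2) + 4 * (snd x)\<^sup>2 * weight2 \<epsilon> R (L r) ((norm x)\<^sup>2)"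
  note dH = has_real_derivative_weight[OF e(1) L(1)[OF \<tau>'(1)]]
  have cH2: "continuous_on {0..} (weight2 \<epsilon> R (L \<tau>))"
    unfolding weight2_def[abs_def] Yexp_def Ya_def Ya1_def
    using Y_denoms[OF e(1) L(1)[OF \<tau>'(1)]]
    by (intro continuous_intros continuous_on_bump ballI power_not_zero) (auto simp: less_imp_neq[symmetric])
  have cH1: "continuous_on {0..} (weight1 \<epsilon> R (L \<tau>))"
    using dH(2) by (intro continuous_at_imp_continuous_on ballI DERIV_isCont) auto
  have cw: "continuous_on (UNIV \<times> {0<..}) (\<lambda>p::(real\<times>real)\<times>real. k ((norm (fst p))\<^sup>2))"
    if "continuous_on UNIV k" for k :: "real \<Rightarrow> real"
    by (rule continuous_on_compose2[OF that]) (auto intro!: continuous_intros)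
  have cY: "continuous_on (UNIV \<times> {0<..}) (\<lambda>p::(real\<times>real)\<times>real. Yexp \<epsilon> (L (snd p)) ((norm (fst p))\<^sup>2))"
    unfolding Yexp_def using ne by (auto simp: L_def intro!: continuous_intros)
  have "\<exists>D. ((\<lambda>r. \<integral>x. ?W x r * (w x r)\<^sup>2 \<partial>lborel) has_real_derivative D) (at \<tau>) \<and>
    D \<le> (\<integral>x. (?Wt x \<tau> + nu * (?W11 x \<tau> + ?W22 x \<tau>) + V\<^sup>2 / nu * ?W x \<tau>) * (w x \<tau>)\<^sup>2 \<partial>lborel)"
  proof (rule energy_derivative[where ?W1.0 = ?W1 and ?W2.0 = ?W2 and R = R])
    show "continuous_on (UNIV \<times> {0<..}) (\<lambda>p. ?W (fst p) (snd p))"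
      unfolding weight_def by (intro continuous_intros cY cw continuous_on_bump)
    show "continuous_on (UNIV \<times> {0<..}) (\<lambda>p. ?Wt (fst p) (snd p))"
      unfolding weightL_def
    proof (intro continuous_intros cY cw continuous_on_bump)
      show "\<forall>p\<in>(UNIV :: (real\<times>real) set) \<times> {0<..}. (L (snd p) + \<epsilon> * (norm (fst p))\<^sup>2)\<^sup>2 \<noteq> 0"
        by (intro ballI power_not_zero ne(1)) auto
      show "continuous_on (UNIV \<times> {0<..}) (\<lambda>p::(real\<times>real)\<times>real. L (snd p))" unfolding L_def by (intro continuous_intros)
    qed
    show "((\<lambda>r. ?W x r) has_real_derivative ?Wt x r) (at r)" if "0 < r" for x r
    proof -
      have "((\<lambda>r. L r) has_real_derivative 4 * nu) (at r)"
        unfolding L_def by (auto intro!: derivative_eq_intros)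
      from DERIV_chain2[OF has_real_derivative_weight(3)[OF e(1) L(1)[OF that]] this]
      show ?thesis by (simp add: mult.commute)
    qed
    show "pd1 (\<lambda>x. ?W x \<tau>) (\<lambda>x. ?W1 x \<tau>)" "pd2 (\<lambda>x. ?W x \<tau>) (\<lambda>x. ?W2 x \<tau>)"
      by (rule pd_radial[OF dH(1) cH1]; simp)+
    show "pd1 (\<lambda>x. ?W1 x \<tau>) (\<lambda>x. ?W11 x \<tau>)" "pd2 (\<lambda>x. ?W2 x \<tau>) (\<lambda>x. ?W22 x \<tau>)"
      by (rule pd_radial2[OF dH(1,2) cH2]; simp)+
    show "0 \<le> ?W x \<tau>" for x
      using weight_nonneg[OF e(4)] by simp
    show "?W x r = 0" if "norm x > R" for x r
    proof -
      have "R\<^sup>2 \<le> (norm x)\<^sup>2" using that e by (intro power_mono) auto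
      then show ?thesis using bump_zero(1)[OF e(4)] by (simp add: weight_def)
    qed
    show "vel_le V \<tau>" using V \<tau> \<tau>' by blast
  qed (use \<tau>' in auto)
  then obtain D where D: "((\<lambda>r. \<integral>x. ?W x r * (w x r)\<^sup>2 \<partial>lborel) has_real_derivative D) (at \<tau>)"
    "D \<le> (\<integral>x. (?Wt x \<tau> + nu * (?W11 x \<tau> + ?W22 x \<tau>) + V\<^sup>2 / nu * ?W x \<tau>) * (w x \<tau>)\<^sup>2 \<partial>lborel)" by blast
  define C where "C = 4 * nu * (1 / l0 + 6) + V\<^sup>2 / nu"
  define K where "K = 4 * nu * (27 / (\<epsilon> * R\<^sup>2)) * (exp (1 / \<epsilon>) / \<epsilon>\<^sup>2)"
  have [measurable]: "(\<lambda>x. w x \<tau>) \<in> borel_measurable borel"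
    by (rule borel_measurable_continuous_onI[OF continuous_w[OF \<tau>'(1)]])
  have WW: "?W11 x \<tau> + ?W22 x \<tau> = 4 * (weight1 \<epsilon> R (L \<tau>) ((norm x)\<^sup>2) + (norm x)\<^sup>2 * weight2 \<epsilon> R (L \<tau>) ((norm x)\<^sup>2))" for x
    unfolding norm_pair_sq by (simp add: algebra_simps)
  have pw: "(?Wt x \<tau> + nu * (?W11 x \<tau> + ?W22 x \<tau>) + V\<^sup>2 / nu * ?W x \<tau>) * (w x \<tau>)\<^sup>2
      \<le> C * (?W x \<tau> * (w x \<tau>)\<^sup>2) + K * B\<^sup>2 * mollifier x" for x
  proof -
    let ?\<rho> = "(norm x)\<^sup>2"
    have "4 * nu * (weightL \<epsilon> R (L \<tau>) ?\<rho> + weight1 \<epsilon> R (L \<tau>) ?\<rho> + ?\<rho> * weight2 \<epsilon> R (L \<tau>) ?\<rho>)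
        \<le> 4 * nu * ((1 / l0 + 6) * weight \<epsilon> R (L \<tau>) ?\<rho> + 27 / (\<epsilon> * R\<^sup>2) * Yexp \<epsilon> (L \<tau>) ?\<rho>)"
      using nu L[OF \<tau>'(1)] e by (intro mult_left_mono weight_supersolution) auto
    also have "\<dots> \<le> 4 * nu * ((1 / l0 + 6) * weight \<epsilon> R (L \<tau>) ?\<rho> + 27 / (\<epsilon> * R\<^sup>2) * (exp (1 / \<epsilon>) / \<epsilon>\<^sup>2 * mollifier x))"
      using nu e by (intro mult_left_mono add_left_mono Yexp_le_mollifier L \<tau>') auto
    finally have "?Wt x \<tau> + nu * (?W11 x \<tau> + ?W22 x \<tau>) + V\<^sup>2 / nu * ?W x \<tau> \<le> C * ?W x \<tau> + K * mollifier x"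
      unfolding WW by (simp add: C_def K_def algebra_simps)
    then have "(?Wt x \<tau> + nu * (?W11 x \<tau> + ?W22 x \<tau>) + V\<^sup>2 / nu * ?W x \<tau>) * (w x \<tau>)\<^sup>2 \<le> (C * ?W x \<tau> + K * mollifier x) * (w x \<tau>)\<^sup>2"
      by (rule mult_right_mono) simp
    also have "\<dots> = C * (?W x \<tau> * (w x \<tau>)\<^sup>2) + (K * mollifier x) * (w x \<tau>)\<^sup>2" by (simp add: algebra_simps)
    also have "(K * mollifier x) * (w x \<tau>)\<^sup>2 \<le> (K * mollifier x) * B\<^sup>2"
    proof (rule mult_left_mono)
      show "(w x \<tau>)\<^sup>2 \<le> B\<^sup>2" using bounded_w[OF \<tau>', of x] B abs_le_square_iff[of "w x \<tau>" B] by simp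
      show "0 \<le> K * mollifier x" using nu e mollifier_pos[of x] by (simp add: K_def)
    qed
    finally show ?thesis by (simp add: mult_ac)
  qed
  have cW: "continuous_on UNIV (\<lambda>x::real\<times>real. weight \<epsilon> R (L \<tau>) ((norm x)\<^sup>2))"
    using pd_radial(1)[OF dH(1) cH1] by (simp add: pd1_def)
  have zW: "?W x \<tau> = 0" if "norm x > R" for x
  proof -
    have "R\<^sup>2 \<le> (norm x)\<^sup>2" using that e by (intro power_mono) auto
    then show ?thesis using bump_zero(1)[OF e(4)] by (simp add: weight_def)
  qed
  have iW: "integrable lborel (\<lambda>x. ?W x \<tau> * (w x \<tau>)\<^sup>2)"
    by (rule integrable_compact_support[of _ R]) (use cW zW continuous_w[OF \<tau>'(1)] in \<open>auto intro!: continuous_intros\<close>)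
  have "D \<le> C * (\<integral>x. ?W x \<tau> * (w x \<tau>)\<^sup>2 \<partial>lborel) + K * B\<^sup>2 * mollifier_mass"
  proof (cases "integrable lborel (\<lambda>x. (?Wt x \<tau> + nu * (?W11 x \<tau> + ?W22 x \<tau>) + V\<^sup>2 / nu * ?W x \<tau>) * (w x \<tau>)\<^sup>2)")
    case True
    have "D \<le> (\<integral>x. C * (?W x \<tau> * (w x \<tau>)\<^sup>2) + K * B\<^sup>2 * mollifier x \<partial>lborel)"
      by (rule order_trans[OF D(2) integral_mono[OF True _ pw]]) (use iW integrable_mollifier in simp)
    then show ?thesis using iW integrable_mollifier by (simp add: mollifier_mass_def)
  next
    \<comment> \<open>The integral then has the default value 0, so D <= 0 lies below the
      nonnegative right side.\<close>
    case False
    then have "D \<le> 0" using D(2) by (simp add: not_integrable_integral_eq)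
    moreover have "0 \<le> (\<integral>x. ?W x \<tau> * (w x \<tau>)\<^sup>2 \<partial>lborel)"
      using weight_nonneg[OF e(4)] by (intro integral_nonneg_AE AE_I2) simp
    moreover have "0 \<le> C" "0 \<le> K * B\<^sup>2 * mollifier_mass" using nu e mollifier_mass_pos by (auto simp: C_def K_def)
    ultimately show ?thesis by (meson add_nonneg_nonneg mult_nonneg_nonneg order_trans)
  qed
  then show "\<exists>D. (energy \<epsilon> R l0 has_real_derivative D) (at \<tau>) \<and> D \<le> (4 * nu * (1 / l0 + 6) + V\<^sup>2 / nu) * energy \<epsilon> R l0 \<tau>
      + 4 * nu * (27 / (\<epsilon> * R\<^sup>2)) * (exp (1 / \<epsilon>) / \<epsilon>\<^sup>2) * mollifier_mass * B\<^sup>2"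
    using D(1) unfolding energy_def[abs_def] C_def K_def L_def by (auto simp: mult_ac)
qed

end

section \<open>Letting the initial time tend to 0 and removing the regularisation\<close>

context vorticity_flow
begin

text \<open>The v^2 part uses that the weight is at most exp (|x|^2 / l0), as L >= l0. The
  difference w^2 - v^2 = (w + v) (w - v) uses the bound exp (1 / \<epsilon>), which is harmless at
  fixed \<epsilon> because it multiplies an L^1 distance that vanishes with s.\<close>

lemma energy_initial:
  assumes e: "0 < \<epsilon>" "\<epsilon> \<le> 1" "0 < l0" "0 < R" and s: "0 < s" "s \<le> T"
    and v: "integrable lborel v" "AE x in lborel. \<bar>v x\<bar> \<le> C"
    and E: "integrable lborel (\<lambda>x. exp ((norm x)\<^sup>2 / l0) * (v x)\<^sup>2)"
  shows "energy \<epsilon> R l0 s \<le> (\<integral>x. exp ((norm x)\<^sup>2 / l0) * (v x)\<^sup>2 \<partial>lborel)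
    + exp (1 / \<epsilon>) * (B + C) * (\<integral>x. \<bar>w x s - v x\<bar> \<partial>lborel)"
proof -
  define L where "L = l0 + 4 * nu * s"
  have L: "0 < L" "l0 \<le> L" using e s nu by (auto simp: L_def add_pos_pos)
  have iD: "integrable lborel (\<lambda>x. \<bar>w x s - v x\<bar>)" using integrable_w[OF s(1)] v(1) by simp
  have "energy \<epsilon> R l0 s \<le> (\<integral>x. exp ((norm x)\<^sup>2 / l0) * (v x)\<^sup>2 + exp (1 / \<epsilon>) * (B + C) * \<bar>w x s - v x\<bar> \<partial>lborel)"
    unfolding energy_def L_def[symmetric]
  proof (rule integral_mono_AE')
    show "integrable lborel (\<lambda>x. exp ((norm x)\<^sup>2 / l0) * (v x)\<^sup>2 + exp (1 / \<epsilon>) * (B + C) * \<bar>w x s - v x\<bar>)"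
      using E iD by simp
    show "AE x in lborel. weight \<epsilon> R L ((norm x)\<^sup>2) * (w x s)\<^sup>2
        \<le> exp ((norm x)\<^sup>2 / l0) * (v x)\<^sup>2 + exp (1 / \<epsilon>) * (B + C) * \<bar>w x s - v x\<bar>"
      using v(2)
    proof eventually_elim
      case (elim x)
      let ?\<rho> = "(norm x)\<^sup>2"
      define g where "g = exp (?\<rho> / (L + \<epsilon> * ?\<rho>))"
      have p: "0 < L + \<epsilon> * ?\<rho>" "0 < 1 + \<epsilon> * ?\<rho>" using Y_denoms[OF e(1) L(1)] by auto
      have b: "0 \<le> bump R ?\<rho>" "bump R ?\<rho> \<le> 1" using bump_bounds[OF e(4)] by auto
      have "Yexp \<epsilon> L ?\<rho> \<le> g"
      proof -
        have "1 \<le> (1 + \<epsilon> * ?\<rho>)\<^sup>2" using e by (intro one_le_power) auto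
        then show ?thesis using e L p by (simp add: Yexp_eq g_def divide_le_eq mult_le_cancel_left1)
      qed
      then have "weight \<epsilon> R L ?\<rho> \<le> g * 1" unfolding weight_def using b by (intro mult_mono) (auto simp: g_def)
      then have Hg: "weight \<epsilon> R L ?\<rho> * (w x s)\<^sup>2 \<le> g * (w x s)\<^sup>2" by (intro mult_right_mono) auto
      have g1: "g \<le> exp (1 / \<epsilon>)" unfolding g_def by (rule exp_quotient_le) (use e L in auto)
      have g2: "g \<le> exp (?\<rho> / l0)"
        unfolding g_def using e L p by (auto intro!: divide_left_mono add_increasing2)
      have "(w x s)\<^sup>2 - (v x)\<^sup>2 = (w x s + v x) * (w x s - v x)" by (simp add: power2_eq_square algebra_simps)
      also have "\<dots> \<le> \<bar>w x s + v x\<bar> * \<bar>w x s - v x\<bar>" by (simp flip: abs_mult)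
      also have "\<dots> \<le> (B + C) * \<bar>w x s - v x\<bar>"
        using bounded_w[OF s, of x] elim by (intro mult_right_mono) auto
      finally have "g * (w x s)\<^sup>2 \<le> g * ((v x)\<^sup>2 + (B + C) * \<bar>w x s - v x\<bar>)"
        by (intro mult_left_mono) (auto simp: g_def)
      also have "\<dots> = g * (v x)\<^sup>2 + g * ((B + C) * \<bar>w x s - v x\<bar>)" by (simp add: distrib_left)
      also have "\<dots> \<le> exp (?\<rho> / l0) * (v x)\<^sup>2 + exp (1 / \<epsilon>) * ((B + C) * \<bar>w x s - v x\<bar>)"
        using bounded_w[OF s, of x] elim by (intro add_mono mult_right_mono g1 g2) auto
      finally show ?case using Hg by (simp add: mult.assoc)
    qed
    show "AE x in lborel. 0 \<le> exp ((norm x)\<^sup>2 / l0) * (v x)\<^sup>2 + exp (1 / \<epsilon>) * (B + C) * \<bar>w x s - v x\<bar>"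
      using v(2)
    proof eventually_elim
      case (elim x)
      have "0 \<le> B + C" using bounded_w[OF s, of x] elim by linarith
      then show ?case by simp
    qed
  qed
  then show ?thesis using E iD by simp
qed

lemma weighted_enstrophy_finite:
  assumes l0: "0 < l0" and t: "0 < t" "t \<le> T"
    and v: "integrable lborel v" "AE x in lborel. \<bar>v x\<bar> \<le> C"
    and E: "integrable lborel (\<lambda>x. exp ((norm x)\<^sup>2 / l0) * (v x)\<^sup>2)"
    and lim: "((\<lambda>s. \<integral>x. \<bar>w x s - v x\<bar> \<partial>lborel) \<longlongrightarrow> 0) (at_right 0)"
    and V: "\<And>\<tau>. 0 < \<tau> \<Longrightarrow> \<tau> \<le> t \<Longrightarrow> vel_le V \<tau>"
  shows "(\<integral>\<^sup>+x. ennreal (exp ((norm x)\<^sup>2 / (l0 + 4 * nu * t)) * (w x t)\<^sup>2) \<partial>lborel) < \<infinity>"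
proof -
  define L where "L = l0 + 4 * nu * t"
  have L: "0 < L" using l0 t nu by (simp add: L_def add_pos_pos)
  define G where "G = 4 * nu * (1 / l0 + 6) + V\<^sup>2 / nu"
  have G: "0 \<le> G" using nu l0 by (simp add: G_def)
  define E0 where "E0 = (\<integral>x. exp ((norm x)\<^sup>2 / l0) * (v x)\<^sup>2 \<partial>lborel)"
  define K where "K \<epsilon> R = 4 * nu * (27 / (\<epsilon> * R\<^sup>2)) * (exp (1 / \<epsilon>) / \<epsilon>\<^sup>2) * mollifier_mass * B\<^sup>2" for \<epsilon> R
  have K0: "0 \<le> K \<epsilon> R" if "0 < \<epsilon>" for \<epsilon> R using that nu mollifier_mass_pos by (simp add: K_def)
  let ?D = "\<lambda>s. \<integral>x. \<bar>w x s - v x\<bar> \<partial>lborel"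
  \<comment> \<open>Letting s -> 0 at fixed \<epsilon> and R removes the distance to the datum
    together with its factor exp (1 / \<epsilon>).\<close>
  have bound: "energy \<epsilon> R l0 t \<le> exp (G * t) * (E0 + K \<epsilon> R * t)" if e: "0 < \<epsilon>" "\<epsilon> \<le> 1" "0 < R" for \<epsilon> R
  proof (rule tendsto_lowerbound)
    have "((\<lambda>s. exp (G * t) * (E0 + exp (1 / \<epsilon>) * (B + C) * ?D s + K \<epsilon> R * t)) \<longlongrightarrow>
        exp (G * t) * (E0 + exp (1 / \<epsilon>) * (B + C) * 0 + K \<epsilon> R * t)) (at_right 0)"
      by (intro tendsto_intros lim)
    then show "((\<lambda>s. exp (G * t) * (E0 + exp (1 / \<epsilon>) * (B + C) * ?D s + K \<epsilon> R * t)) \<longlongrightarrow>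
        exp (G * t) * (E0 + K \<epsilon> R * t)) (at_right 0)" by simp
    have "\<forall>\<^sub>F s in at_right 0. 0 < s \<and> s < t"
      using t by (auto simp: eventually_at_right_field)
    then show "\<forall>\<^sub>F s in at_right 0. energy \<epsilon> R l0 t \<le> exp (G * t) * (E0 + exp (1 / \<epsilon>) * (B + C) * ?D s + K \<epsilon> R * t)"
    proof eventually_elim
      case (elim s)
      have g: "energy \<epsilon> R l0 t \<le> exp (G * (t - s)) * (energy \<epsilon> R l0 s + K \<epsilon> R * (t - s))"
        unfolding G_def K_def by (rule energy_growth) (use e l0 elim t V in auto)
      have n: "0 \<le> energy \<epsilon> R l0 s"
        unfolding energy_def using weight_nonneg[OF e(3)] by (intro integral_nonneg_AE AE_I2) simp
      have "exp (G * (t - s)) * (energy \<epsilon> R l0 s + K \<epsilon> R * (t - s)) \<le> exp (G * t) * (energy \<epsilon> R l0 s + K \<epsilon> R * t)"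
        using elim G K0[OF e(1), of R] n
        by (intro mult_mono add_left_mono mult_left_mono) (auto intro!: mult_left_mono)
      also have "\<dots> \<le> exp (G * t) * (E0 + exp (1 / \<epsilon>) * (B + C) * ?D s + K \<epsilon> R * t)"
        unfolding E0_def by (intro mult_left_mono add_right_mono energy_initial[OF e(1,2) l0 e(3) _ _ v E]) (use elim t in auto)
      finally show ?case using g by linarith
    qed
  qed simp
  define \<epsilon> where "\<epsilon> n = 1 / real (Suc n)" for n
  \<comment> \<open>K \<epsilon> R equals K \<epsilon> 1 / R^2, so R >= 1 and R >= K \<epsilon> 1
    make it at most 1. The summand n forces R to infinity.\<close>
  define k where "k n = n + nat \<lceil>K (\<epsilon> n) 1\<rceil>" for n
  define R where "R n = real (Suc (k n))" for n
  have e: "0 < \<epsilon> n" "\<epsilon> n \<le> 1" "0 < R n" for n by (auto simp: \<epsilon>_def R_def)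
  have KR: "K (\<epsilon> n) (R n) \<le> 1" for n
  proof -
    have "K (\<epsilon> n) 1 \<le> R n" unfolding R_def k_def by linarith
    also have "\<dots> \<le> (R n)\<^sup>2" unfolding R_def by (simp add: power2_eq_square)
    finally have "K (\<epsilon> n) 1 / (R n)\<^sup>2 \<le> 1" using e(3)[of n] by (simp add: divide_le_eq)
    moreover have "K (\<epsilon> n) (R n) = K (\<epsilon> n) 1 / (R n)\<^sup>2" by (simp add: K_def)
    ultimately show ?thesis by simp
  qed
  have en_bound: "energy (\<epsilon> n) (R n) l0 t \<le> exp (G * t) * (E0 + t)" for n
  proof -
    have "K (\<epsilon> n) (R n) * t \<le> 1 * t" using KR[of n] t by (intro mult_right_mono) auto
    then have "exp (G * t) * (E0 + K (\<epsilon> n) (R n) * t) \<le> exp (G * t) * (E0 + t)" by simp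
    then show ?thesis using bound[OF e(1,2,3), of n n] by linarith
  qed
  define h where "h n x = weight (\<epsilon> n) (R n) L ((norm x)\<^sup>2) * (w x t)\<^sup>2" for n and x :: "real \<times> real"
  have h0: "0 \<le> h n x" for n x
    unfolding h_def using weight_nonneg[OF e(3)] by simp
  have hc: "continuous_on UNIV (h n)" for n
  proof -
    have c1: "continuous_on {0..} (weight1 (\<epsilon> n) (R n) L)"
      using has_real_derivative_weight(2)[OF e(1) L]
      by (intro continuous_at_imp_continuous_on ballI DERIV_isCont) auto
    have "continuous_on UNIV (\<lambda>x::real\<times>real. weight (\<epsilon> n) (R n) L ((norm x)\<^sup>2))"
      using pd_radial(1)[OF has_real_derivative_weight(1)[OF e(1) L] c1] by (simp add: pd1_def)
    then show ?thesis unfolding h_def[abs_def] by (intro continuous_intros continuous_w t)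
  qed
  have hz: "h n x = 0" if "norm x > R n" for n x
  proof -
    have "(R n)\<^sup>2 \<le> (norm x)\<^sup>2" using that e(3)[of n] by (intro power_mono) auto
    then show ?thesis using bump_zero(1)[OF e(3)] by (simp add: h_def weight_def)
  qed
  have hi: "integrable lborel (h n)" for n by (rule integrable_compact_support[OF hc hz])
  have klim: "filterlim k at_top sequentially"
    by (rule filterlim_at_top_mono[OF filterlim_ident]) (simp add: k_def)
  have hlim: "(\<lambda>n. h n x) \<longlonglongrightarrow> exp ((norm x)\<^sup>2 / L) * (w x t)\<^sup>2" for x
  proof -
    let ?\<rho> = "(norm x)\<^sup>2"
    have el: "\<epsilon> \<longlonglongrightarrow> 0" unfolding \<epsilon>_def[abs_def] by (intro LIMSEQ_Suc lim_1_over_n)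
    have "(\<lambda>n. exp (?\<rho> / (L + \<epsilon> n * ?\<rho>) - 2 * ln (1 + \<epsilon> n * ?\<rho>))) \<longlonglongrightarrow> exp (?\<rho> / (L + 0 * ?\<rho>) - 2 * ln (1 + 0 * ?\<rho>))"
      by (intro tendsto_intros el) (use L in auto)
    then have Y: "(\<lambda>n. Yexp (\<epsilon> n) L ?\<rho>) \<longlonglongrightarrow> exp (?\<rho> / L)" by (simp add: Yexp_def)
    have b: "(\<lambda>n. bump (R n) ?\<rho>) \<longlonglongrightarrow> 1"
      unfolding R_def by (rule filterlim_compose[OF bump_tendsto klim])
    have "(\<lambda>n. h n x) \<longlonglongrightarrow> exp (?\<rho> / L) * 1 * (w x t)\<^sup>2"
      unfolding h_def weight_def by (intro tendsto_mult Y b tendsto_const)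
    then show ?thesis by simp
  qed
  have "(\<integral>\<^sup>+x. ennreal (exp ((norm x)\<^sup>2 / L) * (w x t)\<^sup>2) \<partial>lborel)
      = (\<integral>\<^sup>+x. liminf (\<lambda>n. ennreal (h n x)) \<partial>lborel)"
  proof (rule nn_integral_cong)
    fix x
    have "(\<lambda>n. ennreal (h n x)) \<longlonglongrightarrow> ennreal (exp ((norm x)\<^sup>2 / L) * (w x t)\<^sup>2)"
      by (intro tendsto_ennrealI hlim)
    then show "ennreal (exp ((norm x)\<^sup>2 / L) * (w x t)\<^sup>2) = liminf (\<lambda>n. ennreal (h n x))"
      by (rule lim_imp_Liminf[OF sequentially_bot, symmetric])
  qed
  also have "\<dots> \<le> liminf (\<lambda>n. \<integral>\<^sup>+x. ennreal (h n x) \<partial>lborel)"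
  proof (rule nn_integral_liminf)
    fix n
    have [measurable]: "h n \<in> borel_measurable borel" by (rule borel_measurable_continuous_onI[OF hc])
    show "(\<lambda>x. ennreal (h n x)) \<in> borel_measurable lborel" by measurable
  qed
  also have "\<dots> \<le> ennreal (exp (G * t) * (E0 + t))"
  proof (rule Liminf_le)
    have "(\<integral>\<^sup>+x. ennreal (h n x) \<partial>lborel) \<le> ennreal (exp (G * t) * (E0 + t))" for n
    proof -
      have "(\<integral>\<^sup>+x. ennreal (h n x) \<partial>lborel) = ennreal (energy (\<epsilon> n) (R n) l0 t)"
        unfolding energy_def L_def[symmetric] h_def[symmetric]
        by (rule nn_integral_eq_integral[OF hi]) (simp add: h0)
      then show ?thesis using en_bound[of n] by (simp add: ennreal_leI)
    qed
    then show "\<forall>\<^sub>F n in sequentially. (\<integral>\<^sup>+x. ennreal (h n x) \<partial>lborel) \<le> ennreal (exp (G * t) * (E0 + t))"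
      by simp
  qed simp
  finally show ?thesis unfolding L_def[symmetric] by (rule le_less_trans) simp
qed

end

theorem mainTheorem1:
  fixes nu lam0 :: real
    and w0 :: "real \<times> real \<Rightarrow> real"
    and w :: "real \<times> real \<Rightarrow> real \<Rightarrow> real"
  assumes "nu > 0" and "lam0 > 0"
    and "w0 \<in> borel_measurable lborel"
    and "\<exists>C. AE x in lborel. \<bar>w0 x\<bar> \<le> C"
    and "(\<integral>\<^sup>+x. ennreal ((w0 x)\<^sup>2 / Phi lam0 x) \<partial>lborel) < \<infinity>"
    and "vorticity_solution nu w0 w"
  shows "\<forall>t>0. (\<integral>\<^sup>+x. ennreal ((w x t)\<^sup>2 / Phi (sqrt (lam0\<^sup>2 + 4 * nu * t)) x) \<partial>lborel) < \<infinity>"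
proof (intro allI impI)
  fix t :: real assume t: "t > 0"
  obtain C where C: "AE x in lborel. \<bar>w0 x\<bar> \<le> C" using assms(4) by blast
  obtain w1 w2 w11 w22 wt where
    cont: "continuous_on (UNIV \<times> {0<..}) (\<lambda>p. w (fst p) (snd p))"
      "continuous_on (UNIV \<times> {0<..}) (\<lambda>p. w1 (fst p) (snd p))"
      "continuous_on (UNIV \<times> {0<..}) (\<lambda>p. w2 (fst p) (snd p))"
      "continuous_on (UNIV \<times> {0<..}) (\<lambda>p. w11 (fst p) (snd p))"
      "continuous_on (UNIV \<times> {0<..}) (\<lambda>p. w22 (fst p) (snd p))"
      "continuous_on (UNIV \<times> {0<..}) (\<lambda>p. wt (fst p) (snd p))"
    and eqs: "\<forall>x1 x2 t. t > 0 \<longrightarrow>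
           ((\<lambda>s. w (s, x2) t) has_real_derivative w1 (x1, x2) t) (at x1) \<and>
           ((\<lambda>s. w (x1, s) t) has_real_derivative w2 (x1, x2) t) (at x2) \<and>
           ((\<lambda>s. w1 (s, x2) t) has_real_derivative w11 (x1, x2) t) (at x1) \<and>
           ((\<lambda>s. w2 (x1, s) t) has_real_derivative w22 (x1, x2) t) (at x2) \<and>
           ((\<lambda>s. w (x1, x2) s) has_real_derivative wt (x1, x2) t) (at t) \<and>
           wt (x1, x2) t =
             nu * (w11 (x1, x2) t + w22 (x1, x2) t)
             - (fst (BS_velocity (\<lambda>y. w y t) (x1, x2)) * w1 (x1, x2) t
                + snd (BS_velocity (\<lambda>y. w y t) (x1, x2)) * w2 (x1, x2) t)"
    using assms(6) unfolding vorticity_solution_def by (elim conjE exE) blast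
  have int: "integrable lborel (\<lambda>x. w x s)" if "0 < s" for s
    using assms(6) that by (simp add: vorticity_solution_def)
  have lim: "((\<lambda>s. \<integral>\<^sup>+x. ennreal \<bar>w x s - w0 x\<bar> \<partial>lborel) \<longlongrightarrow> 0) (at_right 0)"
    using assms(6) by (simp add: vorticity_solution_def)
  have "\<forall>T>0. \<exists>B. \<forall>s\<in>{0<..T}. \<forall>x. \<bar>w x s\<bar> \<le> B"
    using assms(6) unfolding vorticity_solution_def by (elim conjE)
  then obtain B where B: "\<And>s x. 0 < s \<Longrightarrow> s \<le> t + 1 \<Longrightarrow> \<bar>w x s\<bar> \<le> B"
    using t by (metis add_pos_pos greaterThanAtMost_iff zero_less_one)
  \<comment> \<open>Horizon t + 1, because \<open>velocity_bounded\<close> reaches only times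
    strictly below it.\<close>
  interpret vorticity_flow nu B "t + 1" w w1 w2 w11 w22 wt
  proof
    fix x :: "real \<times> real" and s :: real assume s: "0 < s"
    show "((\<lambda>r. w x r) has_real_derivative wt x s) (at s)"
      "wt x s = nu * (w11 x s + w22 x s)
        - (velo dir1 0 (\<lambda>y. w y s) x * w1 x s + velo dir2 0 (\<lambda>y. w y s) x * w2 x s)"
      using eqs[rule_format, OF s, where ?x1.0 = "fst x" and ?x2.0 = "snd x"]
      unfolding BS_velocity_eq fst_conv snd_conv prod.collapse by blast+
  qed (use assms(1) int B cont eqs in auto)
  have [measurable]: "w0 \<in> borel_measurable borel" using assms(3) by simp
  have [measurable]: "(\<lambda>x. w x s) \<in> borel_measurable borel" if "0 < s" for s
    using int[OF that] by (auto dest: borel_measurable_integrable)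
  have "\<forall>\<^sub>F s in at_right 0. (\<integral>\<^sup>+x. ennreal \<bar>w x s - w0 x\<bar> \<partial>lborel) < 1"
    using lim by (rule order_tendstoD) simp
  then obtain \<delta> where \<delta>: "0 < \<delta>" "\<And>s. 0 < s \<Longrightarrow> s < \<delta> \<Longrightarrow> (\<integral>\<^sup>+x. ennreal \<bar>w x s - w0 x\<bar> \<partial>lborel) < 1"
    unfolding eventually_at_right_field by auto
  have iD: "integrable lborel (\<lambda>x. w x s - w0 x)" if "0 < s" "s < \<delta>" for s
  proof (rule integrableI_bounded)
    show "(\<lambda>x. w x s - w0 x) \<in> borel_measurable lborel" using that by measurable
    show "(\<integral>\<^sup>+x. ennreal (norm (w x s - w0 x)) \<partial>lborel) < \<infinity>"
      using less_trans[OF \<delta>(2)[OF that], of \<infinity>] by simp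
  qed
  \<comment> \<open>At one small time both w and w - w0 are integrable, the latter because the datum
    is attained in L^1.\<close>
  have i0: "integrable lborel w0"
    using Bochner_Integration.integrable_diff[OF int[of "\<delta> / 2"] iD[of "\<delta> / 2"]] \<delta>(1) by simp
  have nnD: "(\<integral>\<^sup>+x. ennreal \<bar>w x s - w0 x\<bar> \<partial>lborel) = ennreal (\<integral>x. \<bar>w x s - w0 x\<bar> \<partial>lborel)" if "0 < s" for s
    using int[OF that] i0 by (intro nn_integral_eq_integral) auto
  \<comment> \<open>L^1 convergence to the datum keeps the L^1 norm bounded near time 0, as
    \<open>velocity_bounded\<close> asks.\<close>
  have mass: "(\<integral>x. \<bar>w x s\<bar> \<partial>lborel) \<le> (\<integral>x. \<bar>w0 x\<bar> \<partial>lborel) + 1" if s: "0 < s" "s < \<delta>" for s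
  proof -
    have "(\<integral>x. \<bar>w x s\<bar> \<partial>lborel) \<le> (\<integral>x. \<bar>w0 x\<bar> + \<bar>w x s - w0 x\<bar> \<partial>lborel)"
      using int[OF s(1)] i0 by (intro integral_mono) auto
    also have "\<dots> = (\<integral>x. \<bar>w0 x\<bar> \<partial>lborel) + (\<integral>x. \<bar>w x s - w0 x\<bar> \<partial>lborel)"
      using int[OF s(1)] i0 by simp
    finally show ?thesis using \<delta>(2)[OF s] unfolding nnD[OF s(1)] by simp
  qed
  obtain V where V: "\<And>s. 0 < s \<Longrightarrow> s \<le> t \<Longrightarrow> vel_le V s"
    by (rule velocity_bounded[OF \<delta>(1) mass, of t]) auto
  have lim': "((\<lambda>s. \<integral>x. \<bar>w x s - w0 x\<bar> \<partial>lborel) \<longlongrightarrow> 0) (at_right 0)"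
  proof -
    have "\<forall>\<^sub>F s in at_right 0. (\<integral>\<^sup>+x. ennreal \<bar>w x s - w0 x\<bar> \<partial>lborel) = ennreal (\<integral>x. \<bar>w x s - w0 x\<bar> \<partial>lborel)"
      using nnD by (auto simp: eventually_at_right_field intro!: exI[of _ 1])
    then have "((\<lambda>s. ennreal (\<integral>x. \<bar>w x s - w0 x\<bar> \<partial>lborel)) \<longlongrightarrow> ennreal 0) (at_right 0)"
      using Lim_transform_eventually[OF lim] by simp
    then show ?thesis by (subst (asm) tendsto_ennreal_iff) auto
  qed
  have l0: "0 < lam0\<^sup>2" using assms(2) by simp
  have E: "integrable lborel (\<lambda>x. exp ((norm x)\<^sup>2 / lam0\<^sup>2) * (w0 x)\<^sup>2)"
  proof -
    have "integrable lborel (\<lambda>x. (w0 x)\<^sup>2 / Phi lam0 x)"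
    proof (rule integrableI_bounded)
      show "(\<lambda>x. (w0 x)\<^sup>2 / Phi lam0 x) \<in> borel_measurable lborel" unfolding Phi_def by measurable
      show "(\<integral>\<^sup>+x. ennreal (norm ((w0 x)\<^sup>2 / Phi lam0 x)) \<partial>lborel) < \<infinity>"
        using assms(5) by (simp add: Phi_def)
    qed
    from integrable_mult_right[OF this, of "1 / (pi * lam0\<^sup>2)"] show ?thesis
      using assms(2) by (simp add: Phi_def exp_minus field_simps)
  qed
  define L where "L = lam0\<^sup>2 + 4 * nu * t"
  have L: "0 < L" using l0 t assms(1) by (simp add: L_def add_pos_pos)
  have "(\<integral>\<^sup>+x. ennreal (exp ((norm x)\<^sup>2 / L) * (w x t)\<^sup>2) \<partial>lborel) < \<infinity>"
    unfolding L_def by (rule weighted_enstrophy_finite[OF l0 t _ i0 C E lim' V]) auto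
  then have fin: "ennreal (pi * L) * (\<integral>\<^sup>+x. ennreal (exp ((norm x)\<^sup>2 / L) * (w x t)\<^sup>2) \<partial>lborel) < \<infinity>"
    by (simp add: ennreal_mult_less_top)
  \<comment> \<open>Restores the normalisation: 1 / \<open>Phi\<close> at length sqrt L is \<pi> L
    exp (|x|^2 / L).\<close>
  have "(\<integral>\<^sup>+x. ennreal ((w x t)\<^sup>2 / Phi (sqrt L) x) \<partial>lborel)
      = (\<integral>\<^sup>+x. ennreal (pi * L) * ennreal (exp ((norm x)\<^sup>2 / L) * (w x t)\<^sup>2) \<partial>lborel)"
    using L by (intro nn_integral_cong) (simp add: Phi_def exp_minus field_simps flip: ennreal_mult)
  also have "\<dots> = ennreal (pi * L) * (\<integral>\<^sup>+x. ennreal (exp ((norm x)\<^sup>2 / L) * (w x t)\<^sup>2) \<partial>lborel)"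
    using t by (intro nn_integral_cmult) measurable
  finally show "(\<integral>\<^sup>+x. ennreal ((w x t)\<^sup>2 / Phi (sqrt (lam0\<^sup>2 + 4 * nu * t)) x) \<partial>lborel) < \<infinity>"
    using fin by (simp add: L_def)
qed

end
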